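(* There exists a constant $c>0$ such that for every $V>0$, $$c\min\{V,\,V^{6/7}\}\le F^{3D}_s(V)\le c^{-1}\min\{V,\,V^{6/7}\}.$$
   Context: For $h:\mathbb{R}^2\to[0,\infty)$ let $\Omega_h:=\{(x,y,z)\in\mathbb{R}^3:0<z<h(x,y)\}$. For $V>0$, $$F^{3D}_s(V):=\inf\left\{\int_{\Omega_h}|\nabla u|^2\,dx\,dy\,dz+\int_{\mathbb{R}^2}|\nabla h|^2\,dx\,dy\right\},$$ where the infimum is over all pairs $(u,h)$ with $h\in W^{1,\infty}(\mathbb{R}^2)$, $h\ge0$, $\int_{\mathbb{R}^2}h\,dx\,dy=V$, $u\in H^1(\Omega_h;\mathbb{R}^2)$, and $u(x,y,0)=(x,y)$ (in the sense of traces) for $(x,y)\in\operatorname{supp}h$. *)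

theory Defs
  imports "HOL-Analysis.Analysis"
begin

type_synonym R2 = "real \<times> real"
type_synonym R3 = "R2 \<times> real"

section \<open>Sobolev spaces\<close>

primrec C_k :: "nat \<Rightarrow> ('a::euclidean_space \<Rightarrow> 'b::real_normed_vector) \<Rightarrow> bool" where
  "C_k 0 f \<longleftrightarrow> continuous_on UNIV f"
| "C_k (Suc k) f \<longleftrightarrow>
     (\<forall>x. f differentiable (at x)) \<and>
     (\<forall>b\<in>Basis. C_k k (\<lambda>x. frechet_derivative f (at x) b))"

definition C_infinity :: "('a::euclidean_space \<Rightarrow> 'b::real_normed_vector) \<Rightarrow> bool" where
  "C_infinity f \<longleftrightarrow> (\<forall>k. C_k k f)"

definition test_function :: "'a::euclidean_space set \<Rightarrow> ('a \<Rightarrow> real) \<Rightarrow> bool" where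
  "test_function \<Omega> \<phi> \<longleftrightarrow>
     C_infinity \<phi> \<and> compact (closure {x. \<phi> x \<noteq> 0}) \<and> closure {x. \<phi> x \<noteq> 0} \<subseteq> \<Omega>"

definition locally_integrable ::
    "'a::euclidean_space set \<Rightarrow> ('a \<Rightarrow> 'b::euclidean_space) \<Rightarrow> bool" where
  "locally_integrable \<Omega> f \<longleftrightarrow> (\<forall>K. compact K \<and> K \<subseteq> \<Omega> \<longrightarrow> set_integrable lborel K f)"

text \<open>
  Functions on an open set \<open>\<Omega>\<close> are represented by total functions whose values outside \<open>\<Omega>\<close>
  are irrelevant, and almost-everywhere classes by Borel measurable representatives.
  A gradient is the family \<open>Du\<close> of its partial derivatives: \<open>Du b x\<close> is the derivative of \<open>u\<close>
  at \<open>x\<close> in the direction of the basis vector \<open>b\<close>. As a weak gradient is determined only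
  almost everywhere, it is given by a relation, in the manner of \<open>has_derivative\<close>.
\<close>

definition has_weak_gradient ::
    "'a::euclidean_space set \<Rightarrow> ('a \<Rightarrow> 'b::euclidean_space) \<Rightarrow> ('a \<Rightarrow> 'a \<Rightarrow> 'b) \<Rightarrow> bool" where
  "has_weak_gradient \<Omega> u Du \<longleftrightarrow>
     locally_integrable \<Omega> u \<and>
     (\<forall>b\<in>Basis. locally_integrable \<Omega> (Du b) \<and>
       (\<forall>\<phi>. test_function \<Omega> \<phi> \<longrightarrow>
         (LINT x:\<Omega>|lborel. frechet_derivative \<phi> (at x) b *\<^sub>R u x) =
         - (LINT x:\<Omega>|lborel. \<phi> x *\<^sub>R Du b x)))"

definition norm_grad_sq :: "('a::euclidean_space \<Rightarrow> 'a \<Rightarrow> 'b::euclidean_space) \<Rightarrow> 'a \<Rightarrow> real" where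
  "norm_grad_sq Du x = (\<Sum>b\<in>Basis. (norm (Du b x))\<^sup>2)"

definition L2 :: "'a::euclidean_space set \<Rightarrow> ('a \<Rightarrow> 'b::euclidean_space) set" where
  "L2 \<Omega> = {f. set_borel_measurable lborel \<Omega> f \<and> set_integrable lborel \<Omega> (\<lambda>x. (norm (f x))\<^sup>2)}"

definition Linfinity :: "'a::euclidean_space set \<Rightarrow> ('a \<Rightarrow> 'b::euclidean_space) set" where
  "Linfinity \<Omega> = {f. set_borel_measurable lborel \<Omega> f \<and>
     (\<exists>C. AE x in lborel. x \<in> \<Omega> \<longrightarrow> norm (f x) \<le> C)}"

definition H1 :: "'a::euclidean_space set \<Rightarrow> ('a \<Rightarrow> 'b::euclidean_space) set" where
  "H1 \<Omega> = {u. u \<in> L2 \<Omega> \<and> (\<exists>Du. has_weak_gradient \<Omega> u Du \<and> (\<forall>b\<in>Basis. Du b \<in> L2 \<Omega>))}"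

definition W1infinity :: "'a::euclidean_space set \<Rightarrow> ('a \<Rightarrow> 'b::euclidean_space) set" where
  "W1infinity \<Omega> = {h. h \<in> Linfinity \<Omega> \<and>
     (\<exists>Dh. has_weak_gradient \<Omega> h Dh \<and> (\<forall>b\<in>Basis. Dh b \<in> Linfinity \<Omega>))}"

text \<open>
  \<open>T\<close> is the trace, on the bottom \<open>B \<times> {0}\<close> of the cylinder \<open>B \<times> (0,d)\<close> over a ball \<open>B\<close>, of the
  \<open>H\<^sup>1\<close>-function \<open>u\<close> with weak gradient \<open>Du\<close>: the trace operator is the continuous extension
  to \<open>H\<^sup>1\<close> of the restriction of functions that are smooth up to the boundary.
\<close>

definition has_bottom_trace ::
    "'a::euclidean_space set \<Rightarrow> real \<Rightarrow> ('a \<times> real \<Rightarrow> 'b::euclidean_space) \<Rightarrow>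
     ('a \<times> real \<Rightarrow> 'a \<times> real \<Rightarrow> 'b) \<Rightarrow> ('a \<Rightarrow> 'b) \<Rightarrow> bool" where
  "has_bottom_trace B d u Du T \<longleftrightarrow>
     (\<exists>w :: nat \<Rightarrow> 'a \<times> real \<Rightarrow> 'b.
       (\<forall>n. C_infinity (w n)) \<and>
       (\<lambda>n. \<integral>\<^sup>+x\<in>B \<times> {0<..<d}.
              ennreal ((norm (w n x - u x))\<^sup>2 +
                norm_grad_sq (\<lambda>b x. frechet_derivative (w n) (at x) b - Du b x) x) \<partial>lborel)
         \<longlonglongrightarrow> 0 \<and>
       (\<lambda>n. \<integral>\<^sup>+p\<in>B. ennreal ((norm (w n (p, 0) - T p))\<^sup>2) \<partial>lborel) \<longlonglongrightarrow> 0)"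

section \<open>The variational problem\<close>

definition Omega :: "(R2 \<Rightarrow> real) \<Rightarrow> R3 set" where
  "Omega h = {((x, y), z) | x y z. 0 < z \<and> z < h (x, y)}"

text \<open>
  The condition \<open>u(x,y,0) = (x,y)\<close>. The flat part of the boundary of \<open>Omega h\<close> lies over the
  open set \<open>{h > 0}\<close>, which is covered by the balls \<open>B\<close> for which some cylinder \<open>B \<times> (0,d)\<close>
  is contained in \<open>Omega h\<close>. Over the remaining points of \<open>supp h\<close> there is no trace.
\<close>

definition bottom_condition :: "(R2 \<Rightarrow> real) \<Rightarrow> (R3 \<Rightarrow> R2) \<Rightarrow> (R3 \<Rightarrow> R3 \<Rightarrow> R2) \<Rightarrow> bool" where
  "bottom_condition h u Du \<longleftrightarrow>
     (\<forall>p r d. 0 < r \<and> 0 < d \<and> ball p r \<times> {0<..<d} \<subseteq> Omega h \<longrightarrow>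
       has_bottom_trace (ball p r) d u Du (\<lambda>(x, y). (x, y)))"

text \<open>
  The set \<open>Omega h\<close> depends on the representative of \<open>h \<in> W\<^sup>1\<^sup>,\<^sup>\<infinity>\<close>; as usual it is the
  continuous one.
\<close>

definition admissible ::
    "real \<Rightarrow> (R3 \<Rightarrow> R2) \<Rightarrow> (R3 \<Rightarrow> R3 \<Rightarrow> R2) \<Rightarrow> (R2 \<Rightarrow> real) \<Rightarrow> (R2 \<Rightarrow> R2 \<Rightarrow> real) \<Rightarrow> bool" where
  "admissible V u Du h Dh \<longleftrightarrow>
     h \<in> W1infinity UNIV \<and> continuous_on UNIV h \<and> has_weak_gradient UNIV h Dh \<and>
     (\<forall>p. 0 \<le> h p) \<and> integrable lborel h \<and> (LINT p|lborel. h p) = V \<and>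
     u \<in> H1 (Omega h) \<and> has_weak_gradient (Omega h) u Du \<and>
     bottom_condition h u Du"

definition energy ::
    "(R3 \<Rightarrow> R3 \<Rightarrow> R2) \<Rightarrow> (R2 \<Rightarrow> real) \<Rightarrow> (R2 \<Rightarrow> R2 \<Rightarrow> real) \<Rightarrow> ennreal" where
  "energy Du h Dh =
     (\<integral>\<^sup>+x\<in>Omega h. ennreal (norm_grad_sq Du x) \<partial>lborel) +
     (\<integral>\<^sup>+p. ennreal (norm_grad_sq Dh p) \<partial>lborel)"

definition F_s_3D :: "real \<Rightarrow> ennreal" where
  "F_s_3D V = Inf {energy Du h Dh | u Du h Dh. admissible V u Du h Dh}"

end

theory Submission
  imports Defs
begin

text \<open>
  Write \<open>E\<close> for the energy of an admissible pair.

  For a coordinate direction \<open>b\<close> let \<open>r\<^sub>b \<le> h\<close> be the largest minorant of \<open>h\<close> that is 1-Lipschitz on lines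
  parallel to \<open>b\<close>. The elastic energy controls its integral: \<open>\<integral>r\<^sub>b \<le> 5 E\<close>. Indeed the integral of
  \<open>(u - (x, y)) \<bullet> b\<close> over the subgraph of \<open>r\<^sub>b\<close> is invariant under translations along \<open>b\<close>, whereas \<open>(x, y) \<bullet> b\<close>
  grows at unit rate; so the gradient of \<open>u\<close> has to make up for the whole volume of the subgraph, the
  contribution of the moving upper boundary being controlled by \<open>\<partial>\<^sub>z u\<close> and the bottom condition
  (\<open>shifted_subgraph_identity\<close>, \<open>elastic_energy_bounds_lip_minorant\<close>).

  The surface energy controls the excess of \<open>h\<close> over \<open>r\<^sub>b\<close>: from a point \<open>p\<close> one reaches, within distance
  \<open>r\<^sub>b p\<close> along \<open>b\<close>, a point at which \<open>h\<close> is at most \<open>r\<^sub>b p\<close>. This leads to the Hardy inequality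
  \<open>\<integral>\<^sub>S h \<le> \<integral>\<^sub>S r\<^sub>b + 2 \<mu> \<integral>\<bar>\<partial>\<^sub>b h\<bar>\<^sup>2 + (2 / \<mu>) \<integral>\<^sub>S r\<^sub>b\<^sup>2\<close> for every \<open>\<mu> > 0\<close> (\<open>hardy_lip_minorant\<close>). Using at every
  point the direction with the smaller minorant, only the square of \<open>m = min r\<^sub>1 r\<^sub>2\<close> enters. As \<open>r\<^sub>b\<^sup>2\<close> at \<open>p\<close>
  is at most twice the integral of \<open>r\<^sub>b\<close> over the line through \<open>p\<close>, the integral of \<open>r\<^sub>1\<^sup>2 r\<^sub>2\<^sup>2\<close> is at most
  \<open>4 \<integral>r\<^sub>1 \<integral>r\<^sub>2\<close>, and \<open>m\<^sup>2 \<le> \<nu> r\<^sub>1 + r\<^sub>1\<^sup>2 r\<^sub>2\<^sup>2 / \<nu>\<^sup>2\<close> with \<open>\<nu> = E\<^sup>1\<^sup>/\<^sup>3\<close> bounds \<open>\<integral>m\<^sup>2\<close> by a multiple of \<open>E\<^sup>4\<^sup>/\<^sup>3\<close>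
  (\<open>nn_integral_min_lip_minorants\<close>). With \<open>\<mu> = E\<^sup>1\<^sup>/\<^sup>6\<close> this gives \<open>V \<le> 10 E + 422 E\<^sup>7\<^sup>/\<^sup>6\<close> (\<open>volume_le\<close>), which is the
  lower bound.

  For the upper bound take an island of radius \<open>R\<close> and height \<open>H\<close>, so that \<open>R\<^sup>2 H\<close> is of order \<open>V\<close> and the surface
  energy of order \<open>H\<^sup>2\<close>. The displacement \<open>u = (x, y)\<close> costs \<open>2 V\<close>, and \<open>H\<^sup>2 = V\<close> gives the bound by \<open>V\<close>. The
  displacement \<open>u = exp (- z / R) (x, y)\<close> costs at most a multiple of \<open>R\<^sup>3\<close>, and balancing with \<open>H\<^sup>2\<close> gives the
  bound by \<open>V\<^sup>6\<^sup>/\<^sup>7\<close> (\<open>energy_upper_bound\<close>).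
\<close>

section \<open>Smooth functions\<close>

text \<open>
  The argument order makes \<open>partial f\<close> the gradient of a smooth function in the form in which weak
  gradients are given.
\<close>

abbreviation partial :: "('a::euclidean_space \<Rightarrow> 'b::real_normed_vector) \<Rightarrow> 'a \<Rightarrow> 'a \<Rightarrow> 'b" where
  "partial f e x \<equiv> frechet_derivative f (at x) e"

text \<open>
  Almost all integrals below are taken over the whole space; the notation leaves out the measure.
\<close>

abbreviation lebesgue_nn :: "('a::euclidean_space \<Rightarrow> ennreal) \<Rightarrow> ennreal" (binder "\<integral>\<^sub>+" 10) where
  "lebesgue_nn f \<equiv> nn_integral lborel f"

lemma frechet_derivative_eqI:
  "(f has_derivative f') (at x) \<Longrightarrow> frechet_derivative f (at x) = f'"
  by (metis frechet_derivative_at)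

lemma C_k_mono: "C_k (Suc k) f \<Longrightarrow> C_k k f"
proof (induction k arbitrary: f)
  case 0
  then show ?case
    by (auto intro!: continuous_at_imp_continuous_on differentiable_imp_continuous_within)
next
  case (Suc k)
  then show ?case by (metis C_k.simps(2))
qed

lemma C_k_const: "C_k k (\<lambda>x. c)"
proof (induction k arbitrary: c)
  case (Suc k)
  then show ?case by (simp add: frechet_derivative_eqI[OF has_derivative_const])
qed simp

lemma C_k_add:
  assumes "C_k k f" "C_k k g"
  shows "C_k k (\<lambda>x. f x + g x)"
  using assms
proof (induction k arbitrary: f g)
  case (Suc k)
  have "frechet_derivative (\<lambda>x. f x + g x) (at x) =
     (\<lambda>v. partial f v x + partial g v x)" for x
    using Suc.prems
    by (intro frechet_derivative_eqI has_derivative_add) (auto simp flip: frechet_derivative_works)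
  with Suc show ?case by simp
qed (auto intro: continuous_intros)

lemma C_k_scaleR:
  fixes f :: "'a::euclidean_space \<Rightarrow> real" and g :: "'a \<Rightarrow> 'b::real_normed_vector"
  assumes "C_k k f" "C_k k g"
  shows "C_k k (\<lambda>x. f x *\<^sub>R g x)"
  using assms
proof (induction k arbitrary: f g)
  case (Suc k)
  have "frechet_derivative (\<lambda>x. f x *\<^sub>R g x) (at x) =
     (\<lambda>v. f x *\<^sub>R partial g v x + partial f v x *\<^sub>R g x)" for x
    using Suc.prems
    by (intro frechet_derivative_eqI has_derivative_scaleR) (auto simp flip: frechet_derivative_works)
  moreover have "C_k k (\<lambda>x. f x *\<^sub>R partial g b x + partial f b x *\<^sub>R g x)"
    if "b \<in> Basis" for b
    using Suc that C_k_mono[of k f] C_k_mono[of k g] by (intro C_k_add Suc.IH) auto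
  ultimately show ?case
    using Suc.prems by (auto intro!: derivative_intros)
qed (auto intro: continuous_intros)

lemma C_infinity_const: "C_infinity (\<lambda>x. c)"
  by (simp add: C_infinity_def C_k_const)

lemma C_infinity_scaleR:
  "C_infinity f \<Longrightarrow> C_infinity g \<Longrightarrow> C_infinity (\<lambda>x. f x *\<^sub>R g x)"
  by (simp add: C_infinity_def C_k_scaleR)

lemma C_infinity_mult:
  fixes f g :: "'a::euclidean_space \<Rightarrow> real"
  shows "C_infinity f \<Longrightarrow> C_infinity g \<Longrightarrow> C_infinity (\<lambda>x. f x * g x)"
  using C_infinity_scaleR[of f g] by simp

lemma C_infinity_prod:
  fixes f :: "'i \<Rightarrow> 'a::euclidean_space \<Rightarrow> real"
  assumes "\<And>i. i \<in> I \<Longrightarrow> C_infinity (f i)"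
  shows "C_infinity (\<lambda>x. \<Prod>i\<in>I. f i x)"
  using assms by (induction I rule: infinite_finite_induct) (auto simp: C_infinity_const C_infinity_mult)

lemma C_infinity_bounded_linear:
  assumes "bounded_linear f"
  shows "C_infinity f"
proof -
  have "C_k k f" for k
    using assms
    by (cases k) (auto simp: C_k_const frechet_derivative_eqI[OF bounded_linear_imp_has_derivative]
        intro: bounded_linear_imp_differentiable linear_continuous_on)
  then show ?thesis by (simp add: C_infinity_def)
qed


text \<open>
  The case of the chain rule that covers translations and dilations of test functions.
\<close>

lemma has_derivative_affine_compose:
  assumes "f differentiable (at (s *\<^sub>R x + a))"
  shows "((\<lambda>x. f (s *\<^sub>R x + a)) has_derivative (\<lambda>v. s *\<^sub>R partial f v (s *\<^sub>R x + a))) (at x)"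
proof -
  interpret linear "frechet_derivative f (at (s *\<^sub>R x + a))"
    using assms by (rule linear_frechet_derivative)
  have "((\<lambda>x. f (s *\<^sub>R x + a)) has_derivative (\<lambda>v. partial f (s *\<^sub>R v) (s *\<^sub>R x + a))) (at x)"
    using assms
    by (intro has_derivative_compose[of "\<lambda>x. s *\<^sub>R x + a" "\<lambda>v. s *\<^sub>R v" x UNIV f])
      (auto intro!: derivative_eq_intros simp flip: frechet_derivative_works)
  then show ?thesis by (simp add: scale)
qed

lemma C_k_affine: "C_k k f \<Longrightarrow> C_k k (\<lambda>x. f (s *\<^sub>R x + a))"
proof (induction k arbitrary: f)
  case 0
  then show ?case
    by (auto intro!: continuous_on_compose2[of UNIV f] continuous_intros)
next
  case (Suc k)
  have "frechet_derivative (\<lambda>x. f (s *\<^sub>R x + a)) (at x) = (\<lambda>v. s *\<^sub>R partial f v (s *\<^sub>R x + a))" for x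
    using Suc.prems by (intro frechet_derivative_eqI has_derivative_affine_compose) auto
  moreover have "(\<lambda>x. f (s *\<^sub>R x + a)) differentiable at x" for x
    using Suc.prems has_derivative_affine_compose[of f s x a] by (auto simp: differentiable_def)
  ultimately show ?case
    using Suc.prems Suc.IH[of "\<lambda>x. partial f b x" for b]
    by (auto intro!: C_k_scaleR[OF C_k_const])
qed

lemma C_infinity_affine: "C_infinity f \<Longrightarrow> C_infinity (\<lambda>x. f (s *\<^sub>R x + a))"
  by (simp add: C_infinity_def C_k_affine)

lemma C_infinity_differentiable: "C_infinity f \<Longrightarrow> f differentiable (at x)"
  unfolding C_infinity_def by (metis C_k.simps(2))

lemma C_infinity_partial: "C_infinity f \<Longrightarrow> b \<in> Basis \<Longrightarrow> C_infinity (\<lambda>x. partial f b x)"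
  unfolding C_infinity_def by (metis C_k.simps(2))

lemma C_infinity_continuous: "C_infinity f \<Longrightarrow> continuous_on S f"
  unfolding C_infinity_def using C_k.simps(1) continuous_on_subset by blast

lemma C_infinity_borel:
  fixes f :: "'a::euclidean_space \<Rightarrow> 'b::euclidean_space"
  shows "C_infinity f \<Longrightarrow> f \<in> borel_measurable borel"
  by (intro borel_measurable_continuous_onI C_infinity_continuous)

lemmas cont_borel = borel_measurable_continuous_onI continuous_intros

lemma C_infinity_line_derivative:
  assumes "C_infinity f"
  shows "((\<lambda>t. f (p + t *\<^sub>R b)) has_vector_derivative partial f b (p + t *\<^sub>R b)) (at t within S)"
proof -
  have "f differentiable at (p + t *\<^sub>R b)" using assms by (rule C_infinity_differentiable)
  then interpret linear "frechet_derivative f (at (p + t *\<^sub>R b))"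
    by (rule linear_frechet_derivative)
  have "(f has_derivative frechet_derivative f (at (p + t *\<^sub>R b))) (at (p + t *\<^sub>R b))"
    using assms C_infinity_differentiable frechet_derivative_works by blast
  then have "((\<lambda>t. f (p + t *\<^sub>R b)) has_derivative (\<lambda>s. partial f (s *\<^sub>R b) (p + t *\<^sub>R b))) (at t within S)"
    by (intro has_derivative_compose[of "\<lambda>t. p + t *\<^sub>R b" "\<lambda>s. s *\<^sub>R b" t S f]) (auto intro!: derivative_eq_intros)
  then show ?thesis by (simp add: has_vector_derivative_def scale)
qed

section \<open>Smooth bumps on boxes\<close>

text \<open>
  The functions \<open>x\<^sup>-\<^sup>j exp (- 1 / x)\<close>, extended by \<open>0\<close> to \<open>x \<le> 0\<close>. Differentiating one of them gives a combination
  of the next two, so the whole family is smooth as soon as each member is differentiable.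
\<close>

definition exp_flat :: "nat \<Rightarrow> real \<Rightarrow> real" where
  "exp_flat j x = (if 0 < x then (1 / x) ^ j * exp (- (1 / x)) else 0)"

lemma exp_flat_tendsto_0: "(exp_flat j \<longlongrightarrow> 0) (at 0)"
proof -
  have "((\<lambda>y::real. y ^ j / exp y) \<longlongrightarrow> 0) at_top"
    by (rule tendsto_power_div_exp_0)
  then have "((\<lambda>x::real. (1 / x) ^ j / exp (1 / x)) \<longlongrightarrow> 0) (at_right 0)"
    using filterlim_compose[OF _ filterlim_inverse_at_top_right] by (fastforce simp: inverse_eq_divide)
  then have "(exp_flat j \<longlongrightarrow> 0) (at_right 0)"
    by (rule Lim_transform_eventually)
       (auto simp: eventually_at_filter exp_flat_def exp_minus divide_inverse)
  moreover have "(exp_flat j \<longlongrightarrow> 0) (at_left 0)"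
    by (rule Lim_transform_eventually[OF tendsto_const])
       (auto simp: eventually_at_filter exp_flat_def)
  ultimately show ?thesis by (simp add: filterlim_split_at)
qed

lemma exp_flat_derivative:
  "(exp_flat j has_real_derivative exp_flat (j + 2) x - j * exp_flat (j + 1) x) (at x)"
proof (cases "x = 0")
  case True
  \<comment> \<open>The difference quotient at \<open>0\<close> is \<open>exp_flat (Suc j)\<close>.\<close>
  have "((\<lambda>y. exp_flat j y / y) \<longlongrightarrow> 0) (at 0)"
    by (rule Lim_transform_eventually[OF exp_flat_tendsto_0[of "Suc j"]])
       (auto simp: eventually_at_filter exp_flat_def)
  with True show ?thesis
    by (simp add: has_field_derivative_iff exp_flat_def)
next
  case False
  show ?thesis
  proof (cases "x > 0")
    case True
    have "((\<lambda>x. (1 / x) ^ j * exp (- (1 / x))) has_real_derivative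
        exp_flat (j + 2) x - j * exp_flat (j + 1) x) (at x)"
    proof (cases j)
      case 0
      with True show ?thesis
        by (auto intro!: derivative_eq_intros simp: exp_flat_def field_simps power2_eq_square)
    next
      case (Suc m)
      have "((\<lambda>x. 1 / x) has_real_derivative - (1 / x * (1 / x))) (at x)"
        using True by (auto intro!: derivative_eq_intros simp: field_simps power2_eq_square)
      from DERIV_power_Suc[OF this, of m] DERIV_fun_exp[OF DERIV_minus[OF this]]
      have "((\<lambda>x. (1 / x) ^ Suc m * exp (- (1 / x))) has_real_derivative
          ((1 + real m) * (- (1 / x * (1 / x)) * (1 / x) ^ m)) * exp (- (1 / x)) +
          (exp (- (1 / x)) * - (- (1 / x * (1 / x)))) * (1 / x) ^ Suc m) (at x)"
        by (rule DERIV_mult)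
      with True Suc show ?thesis
        by (simp add: exp_flat_def algebra_simps)
    qed
    then show ?thesis
      by (rule has_field_derivative_transform_within_open[where S = "{0<..}"])
         (use True in \<open>auto simp: exp_flat_def\<close>)
  next
    case neg: False
    with False have "x < 0" by simp
    have "((\<lambda>x. 0) has_real_derivative exp_flat (j + 2) x - j * exp_flat (j + 1) x) (at x)"
      using \<open>x < 0\<close> by (simp add: exp_flat_def)
    then show ?thesis
      by (rule has_field_derivative_transform_within_open[where S = "{..<0}"])
         (use \<open>x < 0\<close> in \<open>auto simp: exp_flat_def\<close>)
  qed
qed

lemma C_infinity_exp_flat:
  fixes e :: "'a::euclidean_space"
  shows "C_infinity (\<lambda>x. exp_flat j (s * (x \<bullet> e) + c))"
proof -
  have D: "((\<lambda>x. exp_flat j (s * (x \<bullet> e) + c)) has_derivative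
      (\<lambda>v. (s * (v \<bullet> e)) * (exp_flat (j + 2) (s * (x \<bullet> e) + c) - j * exp_flat (j + 1) (s * (x \<bullet> e) + c)))) (at x)"
    for j x
  proof -
    have "((\<lambda>x. s * (x \<bullet> e) + c) has_derivative (\<lambda>v. s * (v \<bullet> e))) (at x)"
      by (auto intro!: derivative_eq_intros)
    from has_derivative_compose[OF this exp_flat_derivative[THEN has_field_derivative_imp_has_derivative]]
    show ?thesis by (simp add: mult.commute)
  qed
  have "C_k k (\<lambda>x. exp_flat j (s * (x \<bullet> e) + c))" for k j
  proof (induction k arbitrary: j)
    case 0
    show ?case
      using D by (auto intro!: continuous_at_imp_continuous_on has_derivative_continuous)
  next
    case (Suc k)
    have "C_k k (\<lambda>x. (s * (b \<bullet> e)) *\<^sub>R (exp_flat (j + 2) (s * (x \<bullet> e) + c) +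
        (- real j) *\<^sub>R exp_flat (j + 1) (s * (x \<bullet> e) + c)))" for b
      by (intro C_k_scaleR C_k_const C_k_add Suc)
    then show ?case
      by (auto simp: frechet_derivative_eqI[OF D] differentiable_def intro: D)
  qed
  then show ?thesis by (simp add: C_infinity_def)
qed

text \<open>
  The product over the coordinates of \<open>exp (- 1 / (n (x - a)))\<close> and \<open>exp (- 1 / (n (b - x)))\<close> increases
  to the indicator of the box as \<open>n \<rightarrow> \<infinity>\<close>.
\<close>

definition box_bump :: "'a::euclidean_space \<Rightarrow> 'a \<Rightarrow> nat \<Rightarrow> 'a \<Rightarrow> real" where
  "box_bump a b n x =
     (\<Prod>e\<in>Basis. exp_flat 0 (real n * (x \<bullet> e) + - (real n * (a \<bullet> e))) * exp_flat 0 (- real n * (x \<bullet> e) + real n * (b \<bullet> e)))"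

lemma exp_flat_0_bounds: "0 \<le> exp_flat 0 x" "exp_flat 0 x \<le> 1"
  by (auto simp: exp_flat_def)

lemma exp_flat_0_mono: "x \<le> y \<Longrightarrow> exp_flat 0 x \<le> exp_flat 0 y"
  by (auto simp: exp_flat_def frac_le)

lemma box_bump_nonneg: "0 \<le> box_bump a b n x"
  by (auto simp: box_bump_def intro!: prod_nonneg mult_nonneg_nonneg exp_flat_0_bounds)

lemma box_bump_outside: "x \<notin> box a b \<Longrightarrow> box_bump a b n x = 0"
proof -
  assume "x \<notin> box a b"
  then obtain e where "e \<in> Basis" "x \<bullet> e \<le> a \<bullet> e \<or> b \<bullet> e \<le> x \<bullet> e"
    by (force simp: mem_box)
  moreover from this have "real n * (x \<bullet> e) \<le> real n * (a \<bullet> e) \<or> real n * (b \<bullet> e) \<le> real n * (x \<bullet> e)"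
    by (auto intro: mult_left_mono)
  ultimately show ?thesis
    by (force simp: box_bump_def exp_flat_def intro!: prod_zero)
qed

lemma box_bump_inside: "x \<in> box a b \<Longrightarrow> 0 < n \<Longrightarrow> 0 < box_bump a b n x"
  by (auto simp: box_bump_def mem_box exp_flat_def intro!: prod_pos)

lemma test_function_box_bump: "test_function UNIV (box_bump a b n)"
proof -
  have "closure {x. box_bump a b n x \<noteq> 0} \<subseteq> cbox a b"
    using box_bump_outside[of _ a b n] box_subset_cbox[of a b] by (intro closure_minimal) blast+
  moreover have "C_infinity (box_bump a b n)"
    unfolding box_bump_def by (intro C_infinity_prod C_infinity_mult C_infinity_exp_flat)
  ultimately show ?thesis
    unfolding test_function_def
    by (simp add: compact_eq_bounded_closed bounded_subset[OF bounded_cbox])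
qed

lemma box_bump_mono: "m \<le> n \<Longrightarrow> box_bump a b m x \<le> box_bump a b n x"
proof (cases "x \<in> box a b")
  case True
  assume "m \<le> n"
  have *: "exp_flat 0 (real m * u) \<le> exp_flat 0 (real n * u)" if "0 \<le> u" for u
    using \<open>m \<le> n\<close> that by (auto intro!: exp_flat_0_mono mult_right_mono)
  have "exp_flat 0 (real m * (x \<bullet> e) + - (real m * (a \<bullet> e))) * exp_flat 0 (- real m * (x \<bullet> e) + real m * (b \<bullet> e))
      \<le> exp_flat 0 (real n * (x \<bullet> e) + - (real n * (a \<bullet> e))) * exp_flat 0 (- real n * (x \<bullet> e) + real n * (b \<bullet> e))"
    if "e \<in> Basis" for e
  proof -
    have "0 \<le> x \<bullet> e - a \<bullet> e" "0 \<le> b \<bullet> e - x \<bullet> e" using True that by (auto simp: mem_box less_imp_le)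
    from this[THEN *] show ?thesis
      by (intro mult_mono exp_flat_0_bounds) (auto simp: algebra_simps)
  qed
  then show ?thesis
    unfolding box_bump_def by (intro prod_mono) (auto intro!: mult_nonneg_nonneg exp_flat_0_bounds)
qed (simp add: box_bump_outside)

lemma box_bump_tendsto: "(\<lambda>n. box_bump a b n x) \<longlonglongrightarrow> indicator (box a b) x"
proof (cases "x \<in> box a b")
  case True
  have *: "(\<lambda>n. exp_flat 0 (real n * u)) \<longlonglongrightarrow> 1" if "0 < u" for u
  proof -
    have "(\<lambda>n. exp (- (1 / u * (1 / real n)))) \<longlonglongrightarrow> exp (- (1 / u * 0))"
      by (intro tendsto_intros lim_1_over_n)
    then have "(\<lambda>n. exp (- (1 / u * (1 / real n)))) \<longlonglongrightarrow> 1" by simp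
    then show ?thesis
      by (rule Lim_transform_eventually)
         (use that in \<open>auto simp: exp_flat_def intro!: eventually_sequentiallyI[of 1]\<close>)
  qed
  have "(\<lambda>n. exp_flat 0 (real n * (x \<bullet> e) + - (real n * (a \<bullet> e))) * exp_flat 0 (- real n * (x \<bullet> e) + real n * (b \<bullet> e))) \<longlonglongrightarrow> 1"
    if "e \<in> Basis" for e
  proof -
    have "0 < x \<bullet> e - a \<bullet> e" "0 < b \<bullet> e - x \<bullet> e" using True that by (auto simp: mem_box)
    from tendsto_mult[OF this[THEN *]] show ?thesis by (simp add: algebra_simps)
  qed
  then have "(\<lambda>n. box_bump a b n x) \<longlonglongrightarrow> (\<Prod>e\<in>(Basis::'a set). 1)"
    unfolding box_bump_def by (rule tendsto_prod)
  with True show ?thesis by simp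
qed (simp add: box_bump_outside)

section \<open>Integration by parts for smooth functions\<close>

lemma nn_integral_translate:
  fixes f :: "'a::euclidean_space \<Rightarrow> ennreal"
  assumes "f \<in> borel_measurable borel"
  shows "(\<integral>\<^sub>+x. f (x + c)) = (\<integral>\<^sub>+x. f x)"
proof -
  have "(\<integral>\<^sub>+x. f x) = (\<integral>\<^sup>+x. f x \<partial>distr lborel borel ((+) c))"
    by (simp add: lborel_distr_plus)
  also have "\<dots> = (\<integral>\<^sub>+x. f (c + x))"
    using assms by (subst nn_integral_distr) auto
  finally show ?thesis by (simp add: add.commute)
qed

lemma integral_translate:
  fixes f :: "'a::euclidean_space \<Rightarrow> 'b::{banach,second_countable_topology}"
  assumes "f \<in> borel_measurable borel"
  shows "(LINT x|lborel. f (x + c)) = (LINT x|lborel. f x)"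
proof -
  have "(LINT x|lborel. f x) = (LINT x|distr lborel borel ((+) c). f x)"
    by (simp add: lborel_distr_plus)
  also have "\<dots> = (LINT x|lborel. f (c + x))"
    using assms by (subst integral_distr) auto
  finally show ?thesis by (simp add: add.commute)
qed

lemma integrable_translate:
  fixes f :: "'a::euclidean_space \<Rightarrow> 'b::{banach,second_countable_topology}"
  assumes "integrable lborel f"
  shows "integrable lborel (\<lambda>x. f (x + c))"
proof -
  have "integrable (distr lborel borel ((+) c)) f"
    using assms by (simp add: lborel_distr_plus)
  then have "integrable lborel (\<lambda>x. f (c + x))"
    by (subst (asm) integrable_distr_eq) (use assms in auto)
  then show ?thesis by (simp add: add.commute)
qed

lemma AE_translate:
  fixes c :: "'a::euclidean_space"
  assumes "AE x in lborel. P x"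
  shows "AE x in lborel. P (x + c)"
proof -
  have "AE x in distr lborel borel ((+) c). P x"
    using assms by (subst lborel_distr_plus)
  then have "AE x in lborel. P (c + x)"
    by (rule AE_distrD[rotated]) simp
  then show ?thesis by (simp add: add.commute)
qed

lemma integrable_continuous_compact_support:
  fixes f :: "'a::euclidean_space \<Rightarrow> 'b::euclidean_space"
  assumes "continuous_on UNIV f" "compact K" "\<And>x. x \<notin> K \<Longrightarrow> f x = 0"
  shows "integrable lborel f"
proof -
  have "integrable lborel (\<lambda>x. indicator K x *\<^sub>R f x)"
    using assms continuous_on_subset by (intro borel_integrable_compact) blast+
  also have "(\<lambda>x. indicator K x *\<^sub>R f x) = f"
    using assms(3) by (fastforce simp: indicator_def)
  finally show ?thesis .
qed

lemma test_function_UNIV_iff: "test_function UNIV \<phi> \<longleftrightarrow> C_infinity \<phi> \<and> bounded {x. \<phi> x \<noteq> 0}"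
  by (auto simp: test_function_def compact_eq_bounded_closed closure_subset bounded_subset)

lemma test_function_affine:
  assumes "test_function UNIV \<phi>" "s \<noteq> 0"
  shows "test_function UNIV (\<lambda>x. \<phi> (s *\<^sub>R x + a))"
proof -
  have "{x. \<phi> (s *\<^sub>R x + a) \<noteq> 0} \<subseteq> (\<lambda>x. (1 / s) *\<^sub>R x) ` ((\<lambda>x. x - a) ` {x. \<phi> x \<noteq> 0})"
  proof
    fix x assume "x \<in> {x. \<phi> (s *\<^sub>R x + a) \<noteq> 0}"
    then show "x \<in> (\<lambda>x. (1 / s) *\<^sub>R x) ` ((\<lambda>x. x - a) ` {x. \<phi> x \<noteq> 0})"
      using \<open>s \<noteq> 0\<close> by (intro image_eqI[of _ _ "s *\<^sub>R x"] image_eqI[of _ _ "s *\<^sub>R x + a"]) auto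
  qed
  moreover have "bounded ((\<lambda>x. (1 / s) *\<^sub>R x) ` ((\<lambda>x. x - a) ` {x. \<phi> x \<noteq> 0}))"
    using assms(1) unfolding test_function_UNIV_iff
    by (intro bounded_scaling bounded_translation_minus) simp
  ultimately have "bounded {x. \<phi> (s *\<^sub>R x + a) \<noteq> 0}"
    by (rule bounded_subset[rotated])
  then show ?thesis
    using assms(1) by (simp add: test_function_UNIV_iff C_infinity_affine)
qed

lemma partial_eq_0_outside_support:
  assumes "x \<notin> closure {x. f x \<noteq> 0}"
  shows "partial f b x = 0"
proof -
  have "(f has_derivative (\<lambda>_. 0)) (at x)"
    using assms closure_subset[of "{x. f x \<noteq> 0}"]
    by (intro has_derivative_transform_within_open[OF has_derivative_const[of 0], where s = "- closure {x. f x \<noteq> 0}"])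
      auto
  then show ?thesis by (simp add: frechet_derivative_eqI)
qed

lemma partial_eq_0_outside_cball:
  assumes "{x. f x \<noteq> 0} \<subseteq> cball 0 r" "x \<notin> cball 0 r"
  shows "partial f b x = 0"
  using assms(2) closure_minimal[OF assms(1) closed_cball]
  by (intro partial_eq_0_outside_support) blast

text \<open>
  Translating the derivative by \<open>t b\<close> does not change its integral. Averaging over \<open>t \<in> [0, 1]\<close> turns the
  integrand into \<open>f (x + b) - f x\<close>, whose integral vanishes.
\<close>

lemma integral_partial_eq_0:
  fixes f :: "'a::euclidean_space \<Rightarrow> 'b::euclidean_space"
  assumes f: "C_infinity f" "bounded {x. f x \<noteq> 0}" and b: "b \<in> Basis"
  shows "integrable lborel (\<lambda>x. partial f b x)"
    and "(LINT x|lborel. partial f b x) = 0"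
proof -
  obtain r where "\<forall>x\<in>{x. f x \<noteq> 0}. norm x \<le> r"
    using f(2) unfolding bounded_iff by (rule exE)
  then have r: "{x. f x \<noteq> 0} \<subseteq> cball 0 r"
    by auto
  define g where "g = (\<lambda>x. partial f b x)"
  have g0: "g x = 0" if "x \<notin> cball 0 r" for x
    unfolding g_def using partial_eq_0_outside_cball[OF r that] .
  have cont: "continuous_on S g" for S
    unfolding g_def by (intro C_infinity_continuous C_infinity_partial f b)
  have [measurable]: "g \<in> borel_measurable borel"
    using cont by (rule borel_measurable_continuous_onI)
  show int: "integrable lborel (\<lambda>x. partial f b x)"
    unfolding g_def[symmetric]
    using cont compact_cball g0 by (rule integrable_continuous_compact_support)
  have intf: "integrable lborel f"
    using C_infinity_continuous[OF f(1)] compact_cball[of 0 r] r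
    by (intro integrable_continuous_compact_support[of f "cball 0 r"]) auto
  let ?G = "\<lambda>(t::real) x. indicator {0..1} t *\<^sub>R g (x + t *\<^sub>R b)"
  have "integrable lborel (\<lambda>z::real \<times> 'a. indicator ({0..1} \<times> cball 0 (r + 1)) z *\<^sub>R g (snd z + fst z *\<^sub>R b))"
    by (intro borel_integrable_compact compact_Times compact_Icc compact_cball
        continuous_on_compose2[OF cont] continuous_intros) auto
  also have "(\<lambda>z. indicator ({0..1} \<times> cball 0 (r + 1)) z *\<^sub>R g (snd z + fst z *\<^sub>R b)) = case_prod ?G"
  proof -
    have "g (x + t *\<^sub>R b) = 0" if "t \<in> {0..1}" "x \<notin> cball 0 (r + 1)" for t x
    proof -
      have "norm x \<le> norm (x + t *\<^sub>R b) + norm (t *\<^sub>R b)"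
        by (metis add_diff_cancel_right' norm_triangle_ineq4)
      then show ?thesis using that b by (intro g0) auto
    qed
    then show ?thesis by (fastforce simp: indicator_def)
  qed
  finally have "integrable (lborel \<Otimes>\<^sub>M lborel) (case_prod ?G)"
    by (simp add: lborel_prod)
  then have fubini: "(LINT x|lborel. LINT t|lborel. ?G t x) = (LINT t|lborel. LINT x|lborel. ?G t x)"
    by (rule lborel_pair.Fubini_integral)
  have "(LINT t|lborel. ?G t x) = f (x + 1 *\<^sub>R b) - f (x + 0 *\<^sub>R b)" for x
    unfolding g_def
    by (rule integral_FTC_Icc[where F = "\<lambda>t. f (x + t *\<^sub>R b)"])
       (auto intro!: C_infinity_line_derivative f continuous_on_compose2[OF cont[unfolded g_def]] continuous_intros)
  then have "(LINT x|lborel. f (x + 1 *\<^sub>R b) - f (x + 0 *\<^sub>R b)) = (LINT x|lborel. LINT t|lborel. ?G t x)"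
    by simp
  also note fubini
  also have "(LINT t|lborel. LINT x|lborel. ?G t x) = (LINT t|lborel. indicator {0..1::real} t *\<^sub>R (LINT x|lborel. g x))"
    by (simp add: integral_translate)
  also have "\<dots> = (LINT x|lborel. g x)"
    by simp
  finally have "(LINT x|lborel. f (x + 1 *\<^sub>R b) - f (x + 0 *\<^sub>R b)) = (LINT x|lborel. g x)" .
  moreover have "(LINT x|lborel. f (x + 1 *\<^sub>R b) - f (x + 0 *\<^sub>R b)) = 0"
    using intf by (simp add: integrable_translate integral_translate)
  ultimately show "(LINT x|lborel. partial f b x) = 0"
    by (simp add: g_def)
qed

text \<open>
  The product of \<open>u\<close> with a test function is smooth and compactly supported in \<open>\<Omega>\<close>, so the integrals
  of its partial derivatives vanish and there is no boundary term.
\<close>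

lemma has_weak_gradient_C_infinity:
  fixes u :: "'a::euclidean_space \<Rightarrow> 'b::euclidean_space"
  assumes u: "C_infinity u" and "open \<Omega>"
  shows "has_weak_gradient \<Omega> u (partial u)"
  unfolding has_weak_gradient_def
proof (intro conjI ballI allI impI)
  have *: "locally_integrable \<Omega> f" if "C_infinity f" for f :: "'a \<Rightarrow> 'b"
    unfolding locally_integrable_def set_integrable_def
    using C_infinity_continuous[OF that] by (auto intro: borel_integrable_compact)
  show "locally_integrable \<Omega> u" using u by (rule *)
  fix b :: 'a assume b: "b \<in> Basis"
  then show "locally_integrable \<Omega> (\<lambda>x. partial u b x)"
    by (intro * C_infinity_partial u)
  fix \<phi> :: "'a \<Rightarrow> real" assume \<phi>: "test_function \<Omega> \<phi>"
  then have \<phi>': "C_infinity \<phi>" and supp: "closure {x. \<phi> x \<noteq> 0} \<subseteq> \<Omega>" and com: "compact (closure {x. \<phi> x \<noteq> 0})"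
    by (auto simp: test_function_def)
  have bd: "bounded {x. \<phi> x *\<^sub>R u x \<noteq> 0}"
    using compact_imp_bounded[OF com] by (rule bounded_subset) (use closure_subset[of "{x. \<phi> x \<noteq> 0}"] in auto)
  have sm: "C_infinity (\<lambda>x. \<phi> x *\<^sub>R u x)" by (intro C_infinity_scaleR \<phi>' u)
  note product_rule = frechet_derivative_eqI[OF has_derivative_scaleR[OF
        C_infinity_differentiable[OF \<phi>', THEN frechet_derivative_works[THEN iffD1]]
        C_infinity_differentiable[OF u, THEN frechet_derivative_works[THEN iffD1]]]]
  let ?S = "closure {x. \<phi> x \<noteq> 0}"
  have i1: "integrable lborel (\<lambda>x. \<phi> x *\<^sub>R partial u b x)"
  proof (rule integrable_continuous_compact_support[OF _ com])
    show "continuous_on UNIV (\<lambda>x. \<phi> x *\<^sub>R partial u b x)"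
      by (intro C_infinity_continuous C_infinity_scaleR C_infinity_partial \<phi>' u b)
  next
    fix x assume "x \<notin> ?S"
    then have "\<phi> x = 0" using closure_subset[of "{x. \<phi> x \<noteq> 0}"] by blast
    then show "\<phi> x *\<^sub>R partial u b x = 0" by simp
  qed
  have i2: "integrable lborel (\<lambda>x. partial \<phi> b x *\<^sub>R u x)"
  proof (rule integrable_continuous_compact_support[OF _ com])
    show "continuous_on UNIV (\<lambda>x. partial \<phi> b x *\<^sub>R u x)"
      by (intro C_infinity_continuous C_infinity_scaleR C_infinity_partial \<phi>' u b)
  qed (simp add: partial_eq_0_outside_support)
  have "0 = (LINT x|lborel. \<phi> x *\<^sub>R partial u b x + partial \<phi> b x *\<^sub>R u x)"
    using integral_partial_eq_0(2)[OF sm bd b] by (simp add: product_rule)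
  also have "\<dots> = (LINT x|lborel. \<phi> x *\<^sub>R partial u b x) + (LINT x|lborel. partial \<phi> b x *\<^sub>R u x)"
    using i1 i2 by (rule Bochner_Integration.integral_add)
  also have "(LINT x|lborel. \<phi> x *\<^sub>R partial u b x) = (LINT x:\<Omega>|lborel. \<phi> x *\<^sub>R partial u b x)"
    unfolding set_lebesgue_integral_def using supp closure_subset[of "{x. \<phi> x \<noteq> 0}"]
    by (intro Bochner_Integration.integral_cong) (auto simp: indicator_def)
  also have "(LINT x|lborel. partial \<phi> b x *\<^sub>R u x) = (LINT x:\<Omega>|lborel. partial \<phi> b x *\<^sub>R u x)"
    unfolding set_lebesgue_integral_def using supp
    by (intro Bochner_Integration.integral_cong)
      (auto simp: indicator_def subset_iff intro!: partial_eq_0_outside_support)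
  finally show "(LINT x:\<Omega>|lborel. partial \<phi> b x *\<^sub>R u x) =
      - (LINT x:\<Omega>|lborel. \<phi> x *\<^sub>R partial u b x)"
    by (simp add: eq_neg_iff_add_eq_0 add.commute)
qed

section \<open>Weakly differentiable functions on lines\<close>

lemma borel_measurable_fst_snd [measurable]:
  "fst \<in> (borel :: ('a::second_countable_topology \<times> 'b::second_countable_topology) measure) \<rightarrow>\<^sub>M borel"
  "snd \<in> (borel :: ('a::second_countable_topology \<times> 'b::second_countable_topology) measure) \<rightarrow>\<^sub>M borel"
  by (auto intro!: cont_borel)

lemma nn_integral_lborel_pair:
  fixes f :: "'a::euclidean_space \<times> 'b::euclidean_space \<Rightarrow> ennreal"
  assumes [measurable]: "f \<in> borel_measurable borel"
  shows "(\<integral>\<^sub>+z. f z) = (\<integral>\<^sub>+x. \<integral>\<^sub>+y. f (x, y))"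
    and "(\<integral>\<^sub>+z. f z) = (\<integral>\<^sub>+y. \<integral>\<^sub>+x. f (x, y))"
proof -
  have [measurable]: "f \<in> borel_measurable (lborel \<Otimes>\<^sub>M lborel)"
    using assms by (simp add: lborel_prod)
  show "(\<integral>\<^sub>+z. f z) = (\<integral>\<^sub>+x. \<integral>\<^sub>+y. f (x, y))"
    by (subst lborel.nn_integral_fst) (simp_all add: lborel_prod)
  show "(\<integral>\<^sub>+z. f z) = (\<integral>\<^sub>+y. \<integral>\<^sub>+x. f (x, y))"
    by (subst lborel_pair.nn_integral_snd) (simp_all add: lborel_prod)
qed

lemma nn_integral_shear:
  fixes f :: "real \<times> 'a::euclidean_space \<Rightarrow> ennreal"
  assumes [measurable]: "f \<in> borel_measurable borel"
  shows "(\<integral>\<^sub>+p. \<integral>\<^sub>+\<tau>. f (\<tau>, p)) = (\<integral>\<^sub>+p. \<integral>\<^sub>+\<tau>. f (\<tau>, p - \<tau> *\<^sub>R b))"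
proof -
  have [measurable]: "(\<lambda>z. f (fst z, snd z - fst z *\<^sub>R b)) \<in> borel_measurable borel"
    by (rule measurable_compose[OF _ assms]) (auto intro!: cont_borel)
  have [measurable]: "(\<lambda>p. f (\<tau>, p)) \<in> borel_measurable borel" for \<tau>
    by (rule measurable_compose[OF _ assms]) (auto intro!: cont_borel)
  have "(\<integral>\<^sub>+p. \<integral>\<^sub>+\<tau>. f (\<tau>, p)) = (\<integral>\<^sub>+\<tau>. \<integral>\<^sub>+p. f (\<tau>, p))"
    using nn_integral_lborel_pair[OF assms] by simp
  also have "\<dots> = (\<integral>\<^sub>+\<tau>. \<integral>\<^sub>+p. f (\<tau>, p - \<tau> *\<^sub>R b))"
    using nn_integral_translate[of "\<lambda>p. f (\<tau>, p)" "- \<tau> *\<^sub>R b" for \<tau>] by simp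
  also have "\<dots> = (\<integral>\<^sub>+p. \<integral>\<^sub>+\<tau>. f (\<tau>, p - \<tau> *\<^sub>R b))"
    using nn_integral_lborel_pair[of "\<lambda>z. f (fst z, snd z - fst z *\<^sub>R b)"] by simp
  finally show ?thesis .
qed

lemma integrable_kernel_product:
  fixes k :: "real \<times> 'a::euclidean_space \<Rightarrow> real" and D :: "'a \<Rightarrow> real"
  assumes k: "continuous_on UNIV k" and K: "compact K"
    and zero: "\<And>\<tau> p. \<tau> \<in> {0..t} \<Longrightarrow> p \<notin> K \<Longrightarrow> k (\<tau>, p) = 0"
    and D [measurable]: "D \<in> borel_measurable borel" and DK: "set_integrable lborel K D"
  shows "integrable lborel (\<lambda>z. indicator {0..t} (fst z) * k z * D (snd z))"
proof -
  have [measurable]: "k \<in> borel_measurable borel" using k by (rule borel_measurable_continuous_onI)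
  have [measurable]: "K \<in> sets borel" using K by (rule borel_compact)
  have "compact (k ` ({0..t} \<times> K))"
    using K k by (intro compact_continuous_image compact_Times compact_Icc) (auto intro: continuous_on_subset)
  then have "bounded (k ` ({0..t} \<times> K))" by (rule compact_imp_bounded)
  then obtain C where C: "\<And>z. z \<in> {0..t} \<times> K \<Longrightarrow> \<bar>k z\<bar> \<le> C"
    by (auto simp: bounded_iff)
  have "(\<integral>\<^sub>+p. ennreal \<bar>indicator K p * D p\<bar>) < \<infinity>"
    using DK by (simp add: set_integrable_def integrable_iff_bounded)
  then have fin: "(\<integral>\<^sub>+p. ennreal \<bar>indicator K p * D p\<bar>) * ennreal \<bar>C\<bar> * emeasure lborel {0..t} < \<infinity>"
    by (auto simp: ennreal_mult_less_top emeasure_lborel_Icc_eq)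
  show ?thesis
  proof (rule integrableI_bounded)
    have "(\<integral>\<^sub>+z. ennreal (norm (indicator {0..t} (fst z) * k z * D (snd z))))
        \<le> (\<integral>\<^sub>+z. indicator {0..t} (fst z) * (ennreal \<bar>indicator K (snd z) * D (snd z)\<bar> * ennreal \<bar>C\<bar>))"
    proof (rule nn_integral_mono)
      fix z :: "real \<times> 'a"
      show "ennreal (norm (indicator {0..t} (fst z) * k z * D (snd z)))
          \<le> indicator {0..t} (fst z) * (ennreal \<bar>indicator K (snd z) * D (snd z)\<bar> * ennreal \<bar>C\<bar>)"
      proof (cases "z \<in> {0..t} \<times> K")
        case True
        then have "\<bar>k z\<bar> * \<bar>D (snd z)\<bar> \<le> \<bar>D (snd z)\<bar> * \<bar>C\<bar>"
          using C[OF True] by (subst mult.commute) (intro mult_left_mono, auto)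
        with True show ?thesis
          by (auto simp: abs_mult indicator_def ennreal_mult[symmetric] intro!: ennreal_leI)
      next
        case False
        then show ?thesis using zero[of "fst z" "snd z"] by (cases z) (auto simp: indicator_def)
      qed
    qed
    also have "\<dots> = (\<integral>\<^sub>+\<tau>. indicator {0..t} \<tau> * ((\<integral>\<^sub>+p. ennreal \<bar>indicator K p * D p\<bar>) * ennreal \<bar>C\<bar>))"
      by (subst nn_integral_lborel_pair(1)) (auto simp: nn_integral_cmult nn_integral_multc)
    also have "\<dots> = (\<integral>\<^sub>+p. ennreal \<bar>indicator K p * D p\<bar>) * ennreal \<bar>C\<bar> * emeasure lborel {0..t}"
      by (subst nn_integral_multc) (auto simp: mult.commute)
    finally show "(\<integral>\<^sub>+z. ennreal (norm (indicator {0..t} (fst z) * k z * D (snd z)))) < \<infinity>"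
      using fin by (rule le_less_trans)
  qed simp
qed

text \<open>
  Local integrability gives measurability on compact sets; these exhaust the open set.
\<close>

lemma locally_integrable_borel:
  fixes f :: "'a::euclidean_space \<Rightarrow> 'b::euclidean_space"
  assumes "locally_integrable \<Omega> f" "open \<Omega>"
  shows "(\<lambda>x. indicator \<Omega> x *\<^sub>R f x) \<in> borel_measurable borel"
proof -
  obtain C where C: "\<And>n. compact (C n)" "\<And>n. C n \<subseteq> \<Omega>" "\<And>n. C n \<subseteq> interior (C (Suc n))" "\<Union> (range C) = \<Omega>"
    using open_Union_compact_subsets[OF \<open>open \<Omega>\<close>] by metis
  have "C n \<subseteq> C (Suc n)" for n by (rule order_trans[OF C(3) interior_subset])
  then have inc: "C m \<subseteq> C n" if "m \<le> n" for m n
    using that by (rule lift_Suc_mono_le[of C])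
  show ?thesis
  proof (rule borel_measurable_LIMSEQ_metric)
    show "(\<lambda>x. indicator (C n) x *\<^sub>R f x) \<in> borel_measurable borel" for n
    proof -
      have "set_integrable lborel (C n) f"
        using assms(1) C(1,2) unfolding locally_integrable_def by blast
      then show ?thesis
        unfolding set_integrable_def by (auto dest: borel_measurable_integrable)
    qed
    show "(\<lambda>n. indicator (C n) x *\<^sub>R f x) \<longlonglongrightarrow> indicator \<Omega> x *\<^sub>R f x" for x
    proof (cases "x \<in> \<Omega>")
      case True
      then obtain m where "x \<in> C m" using C(4) by auto
      then have "\<forall>\<^sub>F n in sequentially. indicator \<Omega> x *\<^sub>R f x = indicator (C n) x *\<^sub>R f x"
        using True inc by (intro eventually_sequentiallyI[of m]) (auto simp: indicator_def)
      then show ?thesis by (rule Lim_transform_eventually[OF tendsto_const])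
    next
      case False
      then have "x \<notin> C n" for n using C(2) by blast
      with False show ?thesis by simp
    qed
  qed
qed

lemma test_function_support:
  assumes "test_function UNIV \<phi>"
  obtains r where "{x. \<phi> x \<noteq> 0} \<subseteq> cball 0 r"
proof -
  obtain r where "\<forall>x\<in>{x. \<phi> x \<noteq> 0}. norm x \<le> r"
    using assms unfolding test_function_UNIV_iff bounded_iff by blast
  then show ?thesis by (intro that[of r]) auto
qed

lemma translated_tests_vanish_outside:
  fixes b :: "'a::euclidean_space"
  assumes "{x. \<phi> x \<noteq> 0} \<subseteq> cball 0 r" "b \<in> Basis" "\<tau> \<in> {0..t}" "p \<notin> cball 0 (r + t)"
  shows "p - \<tau> *\<^sub>R b \<notin> cball 0 r"
proof -
  have "norm p \<le> norm (p - \<tau> *\<^sub>R b) + norm (\<tau> *\<^sub>R b)"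
    by (metis diff_add_cancel norm_triangle_ineq)
  with assms show ?thesis by auto
qed

text \<open>
  The increment of \<open>\<phi>\<close> from \<open>p\<close> to \<open>p - t b\<close> is the integral of \<open>- \<partial>\<^sub>b \<phi>\<close> over the segment. Each translate of \<open>\<phi>\<close>
  is again a test function, so the weak derivative can be moved onto \<open>h\<close> before integrating over \<open>\<tau>\<close>.
\<close>

lemma weak_gradient_test_difference:
  fixes h :: "'a::euclidean_space \<Rightarrow> real"
  assumes h: "continuous_on UNIV h" and wg: "has_weak_gradient UNIV h Dh" and b: "b \<in> Basis"
    and \<phi>: "test_function UNIV \<phi>" and t: "0 \<le> t"
  defines "F \<equiv> (\<lambda>z::real \<times> 'a. indicator {0..t} (fst z) * \<phi> (snd z - fst z *\<^sub>R b) * Dh b (snd z))"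
  shows "integrable lborel F"
    and "(LINT z|lborel. F z) = (LINT p|lborel. h p * \<phi> (p - t *\<^sub>R b)) - (LINT p|lborel. h p * \<phi> p)"
proof -
  have C\<phi>: "C_infinity \<phi>" using \<phi> by (simp add: test_function_UNIV_iff)
  obtain r where r: "{x. \<phi> x \<noteq> 0} \<subseteq> cball 0 r" using \<phi> by (rule test_function_support)
  define \<psi> where "\<psi> = (\<lambda>x. partial \<phi> b x)"
  note out = translated_tests_vanish_outside[OF r b]
  have c\<phi>: "continuous_on S \<phi>" for S using C\<phi> by (rule C_infinity_continuous)
  have c\<psi>: "continuous_on S \<psi>" for S
    unfolding \<psi>_def by (intro C_infinity_continuous C_infinity_partial C\<phi> b)
  have z\<phi>: "\<phi> (p - \<tau> *\<^sub>R b) = 0" if "\<tau> \<in> {0..t}" "p \<notin> cball 0 (r + t)" for \<tau> p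
    using out[OF that] r by auto
  have z\<psi>: "\<psi> (p - \<tau> *\<^sub>R b) = 0" if "\<tau> \<in> {0..t}" "p \<notin> cball 0 (r + t)" for \<tau> p
    unfolding \<psi>_def using r out[OF that] by (rule partial_eq_0_outside_cball)
  have li: "locally_integrable UNIV h" "locally_integrable UNIV (Dh b)"
    using wg b by (auto simp: has_weak_gradient_def)
  have [measurable]: "Dh b \<in> borel_measurable borel" "h \<in> borel_measurable borel"
    using li[THEN locally_integrable_borel] by simp_all
  have lK: "set_integrable lborel (cball 0 (r + t)) h" "set_integrable lborel (cball 0 (r + t)) (Dh b)"
    using li by (auto simp: locally_integrable_def)
  show intF: "integrable lborel F"
    unfolding F_def
    by (rule integrable_kernel_product[where K = "cball 0 (r + t)"])
       (use z\<phi> lK in \<open>auto intro!: continuous_on_compose2[OF c\<phi>] continuous_intros\<close>)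
  let ?G = "\<lambda>z::real \<times> 'a. indicator {0..t} (fst z) * - \<psi> (snd z - fst z *\<^sub>R b) * h (snd z)"
  have intG: "integrable lborel ?G"
    by (rule integrable_kernel_product[where K = "cball 0 (r + t)"])
       (use z\<psi> lK in \<open>auto intro!: continuous_on_compose2[OF c\<psi>] continuous_intros\<close>)
  have weak: "(LINT p|lborel. \<phi> (p - \<tau> *\<^sub>R b) * Dh b p) = (LINT p|lborel. - \<psi> (p - \<tau> *\<^sub>R b) * h p)" for \<tau>
  proof -
    let ?\<phi> = "\<lambda>p. \<phi> (1 *\<^sub>R p + - \<tau> *\<^sub>R b)"
    have "test_function UNIV ?\<phi>" by (intro test_function_affine \<phi>) simp
    moreover have "partial ?\<phi> b p = \<psi> (p - \<tau> *\<^sub>R b)" for p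
      using frechet_derivative_eqI[OF has_derivative_affine_compose[OF C_infinity_differentiable[OF C\<phi>], of 1 "- \<tau> *\<^sub>R b" p]]
      by (simp add: \<psi>_def)
    ultimately have "(LINT p:UNIV|lborel. \<psi> (p - \<tau> *\<^sub>R b) *\<^sub>R h p) = - (LINT p:UNIV|lborel. ?\<phi> p *\<^sub>R Dh b p)"
      using wg b by (force simp: has_weak_gradient_def)
    then show ?thesis by (simp add: set_lebesgue_integral_def)
  qed
  have intpair: "integrable (lborel \<Otimes>\<^sub>M lborel) (\<lambda>(\<tau>, p). f (\<tau>, p))" if "integrable lborel f"
    for f :: "real \<times> 'a \<Rightarrow> real"
    using that by (simp add: lborel_prod)
  have inner: "(LINT \<tau>|lborel. ?G (\<tau>, p)) = h p * \<phi> (p - t *\<^sub>R b) - h p * \<phi> p" for p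
  proof -
    have "(LINT \<tau>|lborel. indicator {0..t} \<tau> *\<^sub>R (- \<psi> (p - \<tau> *\<^sub>R b))) = \<phi> (p - t *\<^sub>R b) - \<phi> (p - 0 *\<^sub>R b)"
    proof (rule integral_FTC_Icc[OF t, where F = "\<lambda>\<tau>. \<phi> (p - \<tau> *\<^sub>R b)"])
      fix \<tau>
      have "partial \<phi> (- b) (p - \<tau> *\<^sub>R b) = - \<psi> (p - \<tau> *\<^sub>R b)"
        unfolding \<psi>_def by (intro linear_neg linear_frechet_derivative C_infinity_differentiable C\<phi>)
      then show "((\<lambda>\<tau>. \<phi> (p - \<tau> *\<^sub>R b)) has_vector_derivative - \<psi> (p - \<tau> *\<^sub>R b)) (at \<tau> within {0..t})"
        using C_infinity_line_derivative[OF C\<phi>, of p "- b" \<tau> "{0..t}"] by simp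
    qed (auto intro!: continuous_on_compose2[OF c\<psi>] continuous_intros)
    from arg_cong[OF this, of "\<lambda>a. a * h p"] show ?thesis by (simp add: algebra_simps)
  qed
  have "(LINT z|lborel. F z) = (LINT \<tau>|lborel. LINT p|lborel. F (\<tau>, p))"
    using lborel_pair.integral_fst'[OF intF[unfolded lborel_prod[symmetric]]] by (simp add: lborel_prod)
  also have "\<dots> = (LINT \<tau>|lborel. LINT p|lborel. ?G (\<tau>, p))"
    using weak by (simp add: F_def mult.assoc)
  also have "\<dots> = (LINT p|lborel. LINT \<tau>|lborel. ?G (\<tau>, p))"
    by (rule lborel_pair.Fubini_integral[symmetric, OF intpair[OF intG]])
  also have "\<dots> = (LINT p|lborel. h p * \<phi> (p - t *\<^sub>R b) - h p * \<phi> p)"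
    by (simp only: inner)
  also have "\<dots> =
      (LINT p|lborel. h p * \<phi> (p - t *\<^sub>R b)) - (LINT p|lborel. h p * \<phi> p)"
  proof (rule Bochner_Integration.integral_diff)
    have i: "integrable lborel (\<lambda>p. h p * \<phi> (p - \<tau> *\<^sub>R b))" if "\<tau> \<in> {0..t}" for \<tau>
      by (rule integrable_continuous_compact_support[where K = "cball 0 (r + t)"])
         (use z\<phi>[OF that] in \<open>auto intro!: continuous_intros h continuous_on_compose2[OF c\<phi>]\<close>)
    show "integrable lborel (\<lambda>p. h p * \<phi> (p - t *\<^sub>R b))" using t by (intro i) simp
    show "integrable lborel (\<lambda>p. h p * \<phi> p)" using t i[of 0] by simp
  qed
  finally show "(LINT z|lborel. F z) = (LINT p|lborel. h p * \<phi> (p - t *\<^sub>R b)) - (LINT p|lborel. h p * \<phi> p)" .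
qed

lemma nn_integral_test_line_integral:
  fixes D :: "'a::euclidean_space \<Rightarrow> real"
  assumes [measurable]: "\<phi> \<in> borel_measurable borel" "D \<in> borel_measurable borel" and "\<And>p. 0 \<le> \<phi> p"
  shows "(\<integral>\<^sub>+p. ennreal (\<phi> p) * (\<integral>\<^sub>+\<tau>. indicator {0..t} \<tau> * ennreal (D (p + \<tau> *\<^sub>R b))))
       = (\<integral>\<^sub>+z. ennreal (indicator {0..t} (fst z) * \<phi> (snd z - fst z *\<^sub>R b) * D (snd z)))"
proof -
  have "(\<integral>\<^sub>+p. ennreal (\<phi> p) * (\<integral>\<^sub>+\<tau>. indicator {0..t} \<tau> * ennreal (D (p + \<tau> *\<^sub>R b))))
     = (\<integral>\<^sub>+p. \<integral>\<^sub>+\<tau>. ennreal (\<phi> p) * (indicator {0..t} \<tau> * ennreal (D (p + \<tau> *\<^sub>R b))))"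
    by (simp add: nn_integral_cmult)
  also have "\<dots> = (\<integral>\<^sub>+p. \<integral>\<^sub>+\<tau>. ennreal (\<phi> (p - \<tau> *\<^sub>R b)) * (indicator {0..t} \<tau> * ennreal (D p)))"
    using nn_integral_shear[of "\<lambda>z. ennreal (\<phi> (snd z)) * (indicator {0..t} (fst z) * ennreal (D (snd z + fst z *\<^sub>R b)))" b]
    by simp
  also have "\<dots> = (\<integral>\<^sub>+p. \<integral>\<^sub>+\<tau>. ennreal (indicator {0..t} \<tau> * \<phi> (p - \<tau> *\<^sub>R b) * D p))"
    using assms(3) by (intro nn_integral_cong) (auto simp: indicator_def ennreal_mult')
  also have "\<dots> = (\<integral>\<^sub>+z. ennreal (indicator {0..t} (fst z) * \<phi> (snd z - fst z *\<^sub>R b) * D (snd z)))"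
    by (subst nn_integral_lborel_pair(2)) simp_all
  finally show ?thesis .
qed

text \<open>
  The positive and negative parts of \<open>Dh b\<close> are collected on opposite sides. Both sides then are
  integrals of nonnegative functions against \<open>\<phi>\<close> and can be compared as measures.
\<close>

lemma weak_gradient_test_balance:
  fixes h :: "'a::euclidean_space \<Rightarrow> real"
  assumes h: "continuous_on UNIV h" "\<And>p. 0 \<le> h p" and wg: "has_weak_gradient UNIV h Dh" and b: "b \<in> Basis"
    and \<phi>: "test_function UNIV \<phi>" "\<And>p. 0 \<le> \<phi> p" and t: "0 \<le> t"
  defines "X \<equiv> \<lambda>s p. \<integral>\<^sub>+\<tau>. indicator {0..t} \<tau> * ennreal (s * Dh b (p + \<tau> *\<^sub>R b))"
  shows "(\<integral>\<^sub>+p. ennreal (\<phi> p) * (ennreal (h (p + t *\<^sub>R b)) + X (- 1) p)) =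
         (\<integral>\<^sub>+p. ennreal (\<phi> p) * (ennreal (h p) + X 1 p))"
    and "(\<integral>\<^sub>+p. ennreal (\<phi> p) * (ennreal (h p) + X 1 p)) < \<infinity>"
proof -
  have li: "locally_integrable UNIV (Dh b)"
    using wg b by (auto simp: has_weak_gradient_def)
  have [measurable]: "Dh b \<in> borel_measurable borel" "h \<in> borel_measurable borel" "\<phi> \<in> borel_measurable borel"
    using locally_integrable_borel[OF li] h(1) C_infinity_continuous[of \<phi> UNIV] \<phi>(1)
    by (auto simp: test_function_UNIV_iff intro: borel_measurable_continuous_onI)
  have C\<phi>: "C_infinity \<phi>" using \<phi> by (simp add: test_function_UNIV_iff)
  obtain r where r: "{x. \<phi> x \<noteq> 0} \<subseteq> cball 0 r" using \<phi>(1) by (rule test_function_support)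
  define F where "F = (\<lambda>z::real \<times> 'a. indicator {0..t} (fst z) * \<phi> (snd z - fst z *\<^sub>R b) * Dh b (snd z))"
  have F: "integrable lborel F"
    "(LINT z|lborel. F z) = (LINT p|lborel. h p * \<phi> (p - t *\<^sub>R b)) - (LINT p|lborel. h p * \<phi> p)"
    unfolding F_def using weak_gradient_test_difference[OF h(1) wg b \<phi>(1) t] by auto
  have XF: "(\<integral>\<^sub>+p. ennreal (\<phi> p) * X s p) = (\<integral>\<^sub>+z. ennreal (s * F z))" for s
    using nn_integral_test_line_integral[of \<phi> "\<lambda>p. s * Dh b p" t b] \<phi>(2)
    by (simp add: X_def F_def algebra_simps)
  have intsF: "integrable lborel (\<lambda>z. s * F z)" for s using F(1) by simp
  have fin: "(\<integral>\<^sub>+z. ennreal (s * F z)) < \<infinity>" for s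
  proof -
    have "(\<integral>\<^sub>+z. ennreal (s * F z)) \<le> (\<integral>\<^sub>+z. ennreal (norm (s * F z)))"
      by (intro nn_integral_mono ennreal_leI) auto
    also have "\<dots> < \<infinity>" using intsF[of s] by (simp only: integrable_iff_bounded)
    finally show ?thesis .
  qed
  have hi: "integrable lborel (\<lambda>p. h p * \<phi> (p - s *\<^sub>R b))" if "s \<in> {0..t}" for s
  proof (rule integrable_continuous_compact_support[where K = "cball 0 (r + t)"])
    show "continuous_on UNIV (\<lambda>p. h p * \<phi> (p - s *\<^sub>R b))"
      by (intro continuous_intros h continuous_on_compose2[OF C_infinity_continuous[OF C\<phi>, of UNIV]]) auto
    show "h p * \<phi> (p - s *\<^sub>R b) = 0" if "p \<notin> cball 0 (r + t)" for p
      using translated_tests_vanish_outside[OF r b \<open>s \<in> {0..t}\<close> that] r by auto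
  qed simp
  have hn: "(\<integral>\<^sub>+p. ennreal (\<phi> p) * ennreal (h (p + s *\<^sub>R b))) = ennreal (LINT p|lborel. h p * \<phi> (p - s *\<^sub>R b))"
    if "s \<in> {0..t}" for s
  proof -
    have "(\<integral>\<^sub>+p. ennreal (\<phi> p) * ennreal (h (p + s *\<^sub>R b))) = (\<integral>\<^sub>+p. ennreal (h p * \<phi> (p - s *\<^sub>R b)))"
      using nn_integral_translate[of "\<lambda>p. ennreal (h p * \<phi> (p - s *\<^sub>R b))" "s *\<^sub>R b"] h \<phi>
      by (simp add: ennreal_mult' mult.commute)
    also have "\<dots> = ennreal (LINT p|lborel. h p * \<phi> (p - s *\<^sub>R b))"
      using h \<phi> by (intro nn_integral_eq_integral hi that) auto
    finally show ?thesis .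
  qed
  have [measurable]: "X s \<in> borel_measurable borel" for s
    unfolding X_def by measurable
  have 1: "(\<integral>\<^sub>+p. ennreal (\<phi> p) * (ennreal (h (p + t *\<^sub>R b)) + X (- 1) p)) =
      ennreal (LINT p|lborel. h p * \<phi> (p - t *\<^sub>R b)) + (\<integral>\<^sub>+z. ennreal (- F z))"
    using hn[of t] XF[of "- 1"] t by (simp add: distrib_left nn_integral_add)
  have 2: "(\<integral>\<^sub>+p. ennreal (\<phi> p) * (ennreal (h p) + X 1 p)) =
      ennreal (LINT p|lborel. h p * \<phi> p) + (\<integral>\<^sub>+z. ennreal (F z))"
    using hn[of 0] XF[of 1] t by (simp add: distrib_left nn_integral_add)
  show "(\<integral>\<^sub>+p. ennreal (\<phi> p) * (ennreal (h p) + X 1 p)) < \<infinity>"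
    using 2 fin[of 1] by simp
  obtain P N where PN: "(\<integral>\<^sub>+z. ennreal (F z)) = ennreal P" "0 \<le> P"
      "(\<integral>\<^sub>+z. ennreal (- F z)) = ennreal N" "0 \<le> N"
    using fin[of 1] fin[of "- 1"] by (auto simp: less_top_ennreal)
  have "(LINT z|lborel. F z) = P - N"
    using real_lebesgue_integral_def[OF F(1)] PN by simp
  with F(2) have "(LINT p|lborel. h p * \<phi> (p - t *\<^sub>R b)) + N = (LINT p|lborel. h p * \<phi> p) + P"
    by simp
  moreover have "0 \<le> (LINT p|lborel. h p * \<phi> (p - t *\<^sub>R b))" "0 \<le> (LINT p|lborel. h p * \<phi> p)"
    using h \<phi> by (auto intro!: integral_nonneg_AE)
  ultimately show "(\<integral>\<^sub>+p. ennreal (\<phi> p) * (ennreal (h (p + t *\<^sub>R b)) + X (- 1) p)) =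
         (\<integral>\<^sub>+p. ennreal (\<phi> p) * (ennreal (h p) + X 1 p))"
    unfolding 1 2 PN using PN by (simp flip: ennreal_plus)
qed

text \<open>
  The bumps increase to the indicators of boxes, and boxes generate the Borel sets; so the two densities
  define the same measure.
\<close>

lemma AE_eq_if_eq_on_tests:
  fixes f g :: "'a::euclidean_space \<Rightarrow> ennreal"
  assumes [measurable]: "f \<in> borel_measurable borel" "g \<in> borel_measurable borel"
    and eq: "\<And>\<phi>. test_function UNIV \<phi> \<Longrightarrow> (\<And>x. 0 \<le> \<phi> x) \<Longrightarrow>
      (\<integral>\<^sub>+x. ennreal (\<phi> x) * f x) = (\<integral>\<^sub>+x. ennreal (\<phi> x) * g x)"
    and fin: "\<And>\<phi>. test_function UNIV \<phi> \<Longrightarrow> (\<And>x. 0 \<le> \<phi> x) \<Longrightarrow> (\<integral>\<^sub>+x. ennreal (\<phi> x) * f x) < \<infinity>"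
  shows "AE x in lborel. f x = g x"
proof (rule sigma_finite_measure.density_unique[OF lborel.sigma_finite_measure_axioms])
  have C: "C_infinity (box_bump a b n)" for a b :: 'a and n
    using test_function_box_bump[of a b n] by (simp add: test_function_UNIV_iff)
  have lim: "(\<lambda>n. \<integral>\<^sub>+x. ennreal (box_bump a b n x) * k x) \<longlonglongrightarrow> (\<integral>\<^sub>+x. indicator (box a b) x * k x)"
    if [measurable]: "k \<in> borel_measurable borel" for a b and k :: "'a \<Rightarrow> ennreal"
  proof (rule nn_integral_LIMSEQ)
    have [measurable]: "box_bump a b n \<in> borel_measurable borel" for n
      by (rule C_infinity_borel[OF C])
    show "(\<lambda>x. ennreal (box_bump a b n x) * k x) \<in> borel_measurable lborel" for n
      by measurable
    show "incseq (\<lambda>n x. ennreal (box_bump a b n x) * k x)"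
      by (auto simp: incseq_def le_fun_def intro!: mult_right_mono ennreal_leI box_bump_mono)
    fix x
    have "(\<lambda>n. ennreal (box_bump a b n x)) \<longlonglongrightarrow> ennreal (indicator (box a b) x)"
      by (intro tendsto_ennrealI box_bump_tendsto)
    then have L: "(\<lambda>n. ennreal (box_bump a b n x)) \<longlonglongrightarrow> indicator (box a b) x"
      by (simp add: ennreal_indicator)
    show "(\<lambda>n. ennreal (box_bump a b n x) * k x) \<longlonglongrightarrow> indicator (box a b) x * k x"
    proof (cases "x \<in> box a b")
      case True
      then show ?thesis
        using tendsto_mult_ennreal[OF L tendsto_const, of "k x"] by simp
    next
      case False
      then show ?thesis by (simp add: box_bump_outside)
    qed
  qed
  have box_eq: "(\<integral>\<^sub>+x. indicator (box a b) x * f x) = (\<integral>\<^sub>+x. indicator (box a b) x * g x)" for a b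
    by (rule LIMSEQ_unique[OF lim[of f a b]])
       (use lim[of g a b] eq[OF test_function_box_bump box_bump_nonneg, of a b] in simp_all)
  have box_fin: "(\<integral>\<^sub>+x. indicator (box a b) x * f x) < \<infinity>" for a b
  proof -
    \<comment> \<open>A multiple of a bump on a larger box dominates the indicator.\<close>
    obtain a' b' where ab: "cbox a b \<subseteq> box a' b'"
      using bounded_subset_box_symmetric[OF bounded_cbox] by blast
    obtain m where m: "0 < m" "\<And>x. x \<in> box a b \<Longrightarrow> m \<le> box_bump a' b' 1 x"
    proof (cases "cbox a b = {}")
      case True
      with that[of 1] box_subset_cbox[of a b] show ?thesis by auto
    next
      case False
      obtain y where "y \<in> cbox a b" "\<And>x. x \<in> cbox a b \<Longrightarrow> box_bump a' b' 1 y \<le> box_bump a' b' 1 x"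
        using continuous_attains_inf[OF compact_cbox False C_infinity_continuous[OF C, of _ a' b' 1]] by blast
      moreover from this ab have "0 < box_bump a' b' 1 y" by (intro box_bump_inside) auto
      ultimately show ?thesis using box_subset_cbox[of a b] by (intro that[of "box_bump a' b' 1 y"]) auto
    qed
    have "test_function UNIV (\<lambda>x. (1 / m) * box_bump a' b' 1 x)"
      unfolding test_function_UNIV_iff
    proof
      show "C_infinity (\<lambda>x. (1 / m) * box_bump a' b' 1 x)"
        by (intro C_infinity_mult C_infinity_const C)
      show "bounded {x. (1 / m) * box_bump a' b' 1 x \<noteq> 0}"
        by (rule bounded_subset[OF bounded_box[of a' b']]) (auto intro: ccontr simp: box_bump_outside)
    qed
    moreover have "0 \<le> (1 / m) * box_bump a' b' 1 x" for x
      using m(1) box_bump_nonneg[of a' b' 1 x] by simp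
    ultimately have "(\<integral>\<^sub>+x. ennreal ((1 / m) * box_bump a' b' 1 x) * f x) < \<infinity>"
      by (rule fin)
    moreover have "(\<integral>\<^sub>+x. indicator (box a b) x * f x) \<le> (\<integral>\<^sub>+x. ennreal ((1 / m) * box_bump a' b' 1 x) * f x)"
    proof (intro nn_integral_mono mult_right_mono)
      fix x
      show "indicator (box a b) x \<le> ennreal ((1 / m) * box_bump a' b' 1 x)"
        using m by (auto simp: indicator_def field_simps)
    qed simp
    ultimately show ?thesis by (rule le_less_trans[rotated])
  qed
  have dens: "emeasure (density lborel k) (box a b) = (\<integral>\<^sub>+x. indicator (box a b) x * k x)"
    if [measurable]: "k \<in> borel_measurable borel" for k and a b :: 'a
    by (subst emeasure_density) (auto simp: mult.commute)
  show "density lborel f = density lborel g"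
  proof (rule measure_eqI_generator_eq)
    let ?E = "range (\<lambda>(a, b). box a b::'a set)"
    show "Int_stable ?E"
      by (auto simp: Int_stable_def box_Int_box)
    show "?E \<subseteq> Pow UNIV" "sets (density lborel f) = sigma_sets UNIV ?E" "sets (density lborel g) = sigma_sets UNIV ?E"
      by (simp_all add: borel_eq_box)
    let ?A = "\<lambda>n::nat. box (- (real n *\<^sub>R One)) (real n *\<^sub>R One) :: 'a set"
    show "range ?A \<subseteq> ?E" "(\<Union>i. ?A i) = UNIV"
      unfolding UN_box_eq_UNIV by auto
    show "emeasure (density lborel f) (?A i) \<noteq> \<infinity>" for i
      using box_fin by (simp add: dens less_top)
    show "emeasure (density lborel f) X = emeasure (density lborel g) X" if "X \<in> ?E" for X
      using that box_eq by (auto simp: dens)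
  qed
qed simp_all

lemma weak_gradient_line_identity:
  fixes h :: "'a::euclidean_space \<Rightarrow> real"
  assumes h: "continuous_on UNIV h" "\<And>p. 0 \<le> h p" and wg: "has_weak_gradient UNIV h Dh" and b: "b \<in> Basis"
    and t: "0 \<le> t"
  shows "AE p in lborel.
    ennreal (h (p + t *\<^sub>R b)) + (\<integral>\<^sub>+\<tau>. indicator {0..t} \<tau> * ennreal (- 1 * Dh b (p + \<tau> *\<^sub>R b))) =
    ennreal (h p) + (\<integral>\<^sub>+\<tau>. indicator {0..t} \<tau> * ennreal (1 * Dh b (p + \<tau> *\<^sub>R b)))"
proof (rule AE_eq_if_eq_on_tests)
  have li: "locally_integrable UNIV (Dh b)"
    using wg b by (auto simp: has_weak_gradient_def)
  have [measurable]: "Dh b \<in> borel_measurable borel" "h \<in> borel_measurable borel"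
    using locally_integrable_borel[OF li] h(1) by (auto intro: borel_measurable_continuous_onI)
  show "(\<lambda>p. ennreal (h (p + t *\<^sub>R b)) + (\<integral>\<^sub>+\<tau>. indicator {0..t} \<tau> * ennreal (- 1 * Dh b (p + \<tau> *\<^sub>R b)))) \<in> borel_measurable borel"
    "(\<lambda>p. ennreal (h p) + (\<integral>\<^sub>+\<tau>. indicator {0..t} \<tau> * ennreal (1 * Dh b (p + \<tau> *\<^sub>R b)))) \<in> borel_measurable borel"
    by measurable
qed (use weak_gradient_test_balance[OF h wg b _ _ t] in simp_all)

text \<open>
  The line integral is taken over the open segment, so that the estimate is unaffected by its
  endpoints. One exceptional null set serves all \<open>t\<close>: it suffices to treat rational \<open>t\<close>, as the left side
  is continuous in \<open>t\<close> and the right side grows with the segment.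
\<close>

lemma weak_gradient_line_bound:
  fixes h :: "'a::euclidean_space \<Rightarrow> real"
  assumes h: "continuous_on UNIV h" "\<And>p. 0 \<le> h p" and wg: "has_weak_gradient UNIV h Dh" and b: "b \<in> Basis"
  shows "AE p in lborel. \<forall>t. ennreal \<bar>h (p + t *\<^sub>R b) - h p\<bar> \<le>
    (\<integral>\<^sub>+\<tau>. indicator (open_segment 0 t) \<tau> * ennreal \<bar>Dh b (p + \<tau> *\<^sub>R b)\<bar>)"
proof -
  have li: "locally_integrable UNIV (Dh b)"
    using wg b by (auto simp: has_weak_gradient_def)
  have [measurable]: "Dh b \<in> borel_measurable borel" "h \<in> borel_measurable borel"
    using locally_integrable_borel[OF li] h(1) by (auto intro: borel_measurable_continuous_onI)
  define A where "A p t \<longleftrightarrow> ennreal \<bar>h (p + t *\<^sub>R b) - h p\<bar> \<le>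
    (\<integral>\<^sub>+\<tau>. indicator {0<..<t} \<tau> * ennreal \<bar>Dh b (p + \<tau> *\<^sub>R b)\<bar>)" for p t
  have diff: "ennreal \<bar>x - y\<bar> \<le> Y" if nn: "0 \<le> x" "0 \<le> y" "ennreal x + X = ennreal y + Z" and le: "X \<le> Y" "Z \<le> Y" for x y X Y Z
  proof (cases "Y = \<infinity>")
    case False
    then obtain r s v where "X = ennreal r" "0 \<le> r" "Z = ennreal s" "0 \<le> s" "Y = ennreal v" "0 \<le> v"
      using le by (metis ennreal_cases infinity_ennreal_def neq_top_trans)
    with nn le show ?thesis by (auto simp flip: ennreal_plus intro!: ennreal_leI)
  qed simp
  have A: "AE p in lborel. A p t" if "0 \<le> t" for t
  proof -
    have le: "(\<integral>\<^sub>+\<tau>. indicator {0..t} \<tau> * ennreal (s * Dh b (p + \<tau> *\<^sub>R b))) \<le>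
        (\<integral>\<^sub>+\<tau>. indicator {0<..<t} \<tau> * ennreal \<bar>Dh b (p + \<tau> *\<^sub>R b)\<bar>)" if "s = 1 \<or> s = - 1" for s :: real and p
    proof (rule nn_integral_mono_AE)
      have "AE \<tau> in lborel. \<tau> \<noteq> 0 \<and> \<tau> \<noteq> t"
        using AE_lborel_singleton[of 0] AE_lborel_singleton[of t] by eventually_elim simp
      then show "AE \<tau> in lborel. indicator {0..t} \<tau> * ennreal (s * Dh b (p + \<tau> *\<^sub>R b)) \<le>
          indicator {0<..<t} \<tau> * ennreal \<bar>Dh b (p + \<tau> *\<^sub>R b)\<bar>"
        by eventually_elim (use that in \<open>auto simp: indicator_def intro!: ennreal_leI\<close>)
    qed
    from weak_gradient_line_identity[OF h wg b \<open>0 \<le> t\<close>] show ?thesis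
      unfolding A_def by eventually_elim (rule diff[OF h(2) h(2) _ le le], assumption, simp_all)
  qed
  let ?I = "\<lambda>p t. \<integral>\<^sub>+\<tau>. indicator (open_segment 0 t) \<tau> * ennreal \<bar>Dh b (p + \<tau> *\<^sub>R b)\<bar>"
  have "AE p in lborel. \<forall>t\<in>\<rat>. ennreal \<bar>h (p + t *\<^sub>R b) - h p\<bar> \<le> ?I p t"
  proof (rule AE_ball_countable'[OF _ countable_rat])
    fix t :: real
    show "AE p in lborel. ennreal \<bar>h (p + t *\<^sub>R b) - h p\<bar> \<le> ?I p t"
    proof (cases "0 \<le> t")
      case True
      with A[OF True] show ?thesis by (simp add: A_def open_segment_eq_real_ivl)
    next
      case False
      then have "indicator (open_segment 0 t) (\<tau> + t) = (indicator {0<..<- t} \<tau> :: ennreal)" for \<tau>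
        by (auto simp: open_segment_eq_real_ivl indicator_def)
      moreover have [measurable]: "open_segment 0 t \<in> sets borel" by (simp add: open_segment_eq_real_ivl)
      ultimately have "?I p t = (\<integral>\<^sub>+\<tau>. indicator {0<..<- t} \<tau> * ennreal \<bar>Dh b (p + t *\<^sub>R b + \<tau> *\<^sub>R b)\<bar>)" for p
        using nn_integral_translate[of "\<lambda>\<tau>. indicator (open_segment 0 t) \<tau> * ennreal \<bar>Dh b (p + \<tau> *\<^sub>R b)\<bar>" t]
        by (simp add: algebra_simps)
      with AE_translate[OF A[of "- t"], of "t *\<^sub>R b"] False show ?thesis
        by (simp add: A_def abs_minus_commute)
    qed
  qed
  then show ?thesis
  proof eventually_elim
    case (elim p)
    have ch: "isCont h x" for x using h(1) by (simp add: continuous_on_eq_continuous_at)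
    show ?case
    proof
      fix t :: real
      show "ennreal \<bar>h (p + t *\<^sub>R b) - h p\<bar> \<le> ?I p t"
      proof (cases "t = 0")
        case False
        have "\<exists>q\<in>\<rat>. q \<in> open_segment 0 t \<and> dist q t < 1 / real (Suc n)" for n
        proof (cases "0 < t")
          case True
          then obtain q where "q \<in> \<rat>" "max 0 (t - 1 / real (Suc n)) < q" "q < t"
            using Rats_dense_in_real[of "max 0 (t - 1 / real (Suc n))" t] by auto
          then show ?thesis by (intro bexI[of _ q]) (auto simp: open_segment_eq_real_ivl dist_real_def)
        next
          case False
          with \<open>t \<noteq> 0\<close> obtain q where "q \<in> \<rat>" "t < q" "q < min 0 (t + 1 / real (Suc n))"
            using Rats_dense_in_real[of t "min 0 (t + 1 / real (Suc n))"] by auto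
          then show ?thesis by (intro bexI[of _ q]) (auto simp: open_segment_eq_real_ivl dist_real_def)
        qed
        then obtain q where q: "\<And>n. q n \<in> \<rat>" "\<And>n. q n \<in> open_segment 0 t" "\<And>n. dist (q n) t < 1 / real (Suc n)"
          by metis
        have "(\<lambda>n. 1 / real (Suc n)) \<longlonglongrightarrow> 0"
          using LIMSEQ_inverse_real_of_nat by (simp add: inverse_eq_divide)
        then have "q \<longlonglongrightarrow> t"
          by (rule metric_tendsto_imp_tendsto) (use q(3) in \<open>auto intro!: always_eventually less_imp_le simp: dist_real_def\<close>)
        then have "(\<lambda>n. ennreal \<bar>h (p + q n *\<^sub>R b) - h p\<bar>) \<longlonglongrightarrow> ennreal \<bar>h (p + t *\<^sub>R b) - h p\<bar>"
          by (intro tendsto_ennrealI tendsto_intros isCont_tendsto_compose[OF ch])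
        moreover have "ennreal \<bar>h (p + q n *\<^sub>R b) - h p\<bar> \<le> ?I p t" for n
        proof (rule order_trans)
          show "ennreal \<bar>h (p + q n *\<^sub>R b) - h p\<bar> \<le> ?I p (q n)" using elim q(1) by blast
          have "open_segment 0 (q n) \<subseteq> open_segment 0 t"
            using q(2)[of n] by (auto simp: open_segment_eq_real_ivl split: if_splits)
          then show "?I p (q n) \<le> ?I p t"
            by (intro nn_integral_mono mult_right_mono) (auto simp: indicator_def)
        qed
        ultimately show ?thesis by (intro LIMSEQ_le_const2) blast+
      qed simp
    qed
  qed
qed

section \<open>The Lipschitz minorant along a direction\<close>

text \<open>
  For nonnegative \<open>h\<close> this is the largest minorant of \<open>h\<close> that is 1-Lipschitz in the parameter of every line
  parallel to \<open>b\<close>. Lines are used instead of planar cones because a function on the plane can dip to \<open>0\<close>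
  near isolated points at a negligible cost in \<open>\<integral>\<bar>\<nabla>h\<bar>\<^sup>2\<close>, whereas on a line a zero is felt at a distance.
\<close>

definition lip_minorant :: "('a::euclidean_space \<Rightarrow> real) \<Rightarrow> 'a \<Rightarrow> 'a \<Rightarrow> real" where
  "lip_minorant h b p = (INF t. h (p + t *\<^sub>R b) + \<bar>t\<bar>)"

context
  fixes h :: "'a::euclidean_space \<Rightarrow> real"
  assumes nonneg: "\<And>p. 0 \<le> h p"
begin

lemma lip_minorant_le: "lip_minorant h b p \<le> h (p + t *\<^sub>R b) + \<bar>t\<bar>"
  unfolding lip_minorant_def
  by (rule cINF_lower) (auto intro!: bdd_belowI[of _ 0] add_nonneg_nonneg nonneg)

lemma lip_minorant_nonneg: "0 \<le> lip_minorant h b p"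
  unfolding lip_minorant_def by (rule cINF_greatest) (auto intro!: add_nonneg_nonneg nonneg)

lemma lip_minorant_le_self: "lip_minorant h b p \<le> h p"
  using lip_minorant_le[of b p 0] by simp

lemma lip_minorant_shift_le: "lip_minorant h b (p + s *\<^sub>R b) \<le> lip_minorant h b p + \<bar>s\<bar>"
proof -
  have "lip_minorant h b (p + s *\<^sub>R b) - \<bar>s\<bar> \<le> lip_minorant h b p"
    unfolding lip_minorant_def[of h b p]
  proof (rule cINF_greatest)
    fix t
    show "lip_minorant h b (p + s *\<^sub>R b) - \<bar>s\<bar> \<le> h (p + t *\<^sub>R b) + \<bar>t\<bar>"
      using lip_minorant_le[of b "p + s *\<^sub>R b" "t - s"] by (simp add: algebra_simps)
  qed simp
  then show ?thesis by simp
qed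

lemma lip_minorant_le_shift: "lip_minorant h b p \<le> lip_minorant h b (p + s *\<^sub>R b) + \<bar>s\<bar>"
  using lip_minorant_shift_le[of b "p + s *\<^sub>R b" "- s"] by simp

lemma lip_minorant_attained:
  assumes "continuous_on UNIV h"
  obtains t where "lip_minorant h b p = h (p + t *\<^sub>R b) + \<bar>t\<bar>"
proof -
  \<comment> \<open>No \<open>t\<close> with \<open>\<bar>t\<bar> > h p\<close> improves on \<open>t = 0\<close>.\<close>
  have "continuous_on {- h p..h p} (\<lambda>t. h (p + t *\<^sub>R b) + \<bar>t\<bar>)"
    by (intro continuous_intros continuous_on_compose2[OF assms]) auto
  then obtain t where t: "\<And>s. s \<in> {- h p..h p} \<Longrightarrow> h (p + t *\<^sub>R b) + \<bar>t\<bar> \<le> h (p + s *\<^sub>R b) + \<bar>s\<bar>"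
    using continuous_attains_inf[of "{- h p..h p}" "\<lambda>t. h (p + t *\<^sub>R b) + \<bar>t\<bar>"] nonneg[of p] by fastforce
  have "h (p + t *\<^sub>R b) + \<bar>t\<bar> \<le> h (p + s *\<^sub>R b) + \<bar>s\<bar>" for s
  proof (cases "s \<in> {- h p..h p}")
    case False
    then show ?thesis using t[of 0] nonneg[of p] nonneg[of "p + s *\<^sub>R b"] by auto
  qed (rule t)
  then have "h (p + t *\<^sub>R b) + \<bar>t\<bar> \<le> lip_minorant h b p"
    unfolding lip_minorant_def by (intro cINF_greatest) auto
  with that[of t] lip_minorant_le[of b p t] show ?thesis by simp
qed

lemma continuous_on_lip_minorant:
  assumes h: "continuous_on UNIV h"
  shows "continuous_on UNIV (lip_minorant h b)"
  unfolding continuous_on_iff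
proof (intro ballI allI impI)
  fix p :: 'a and e :: real assume "0 < e"
  define H where "H = h p + 1"
  have "uniformly_continuous_on (cball p 1 \<times> {- H..H}) (\<lambda>z. h (fst z + snd z *\<^sub>R b))"
    by (intro compact_uniformly_continuous compact_Times compact_cball compact_Icc
        continuous_on_compose2[OF h] continuous_intros) auto
  moreover have "0 < min e 1" using \<open>0 < e\<close> by simp
  ultimately obtain d where "0 < d" and d: "\<And>z z'. z \<in> cball p 1 \<times> {- H..H} \<Longrightarrow> z' \<in> cball p 1 \<times> {- H..H} \<Longrightarrow>
      dist z' z < d \<Longrightarrow> dist (h (fst z' + snd z' *\<^sub>R b)) (h (fst z + snd z *\<^sub>R b)) < min e 1"
    unfolding uniformly_continuous_on_def by metis
  show "\<exists>d>0. \<forall>q\<in>UNIV. dist q p < d \<longrightarrow> dist (lip_minorant h b q) (lip_minorant h b p) < e"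
  proof (intro exI[of _ "min d 1"] conjI ballI impI)
    fix q assume q: "dist q p < min d 1"
    have close: "h (q + t *\<^sub>R b) < h (p + t *\<^sub>R b) + e \<and> h (p + t *\<^sub>R b) < h (q + t *\<^sub>R b) + e \<and>
        h (q + t *\<^sub>R b) < h (p + t *\<^sub>R b) + 1" if "\<bar>t\<bar> \<le> H" for t
      using d[of "(p, t)" "(q, t)"] q that
      by (auto simp: dist_real_def dist_commute dist_Pair_Pair abs_le_iff abs_less_iff)
    have "h q \<le> H" using close[of 0] nonneg[of p] by (auto simp: H_def)
    obtain s where s: "lip_minorant h b p = h (p + s *\<^sub>R b) + \<bar>s\<bar>" using h by (rule lip_minorant_attained)
    have "\<bar>s\<bar> \<le> H"
      using s lip_minorant_le_self[of b p] nonneg[of "p + s *\<^sub>R b"] by (simp add: H_def)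
    then have 1: "lip_minorant h b q < lip_minorant h b p + e"
      using s lip_minorant_le[of b q s] close[of s] by simp
    obtain t where t: "lip_minorant h b q = h (q + t *\<^sub>R b) + \<bar>t\<bar>" using h by (rule lip_minorant_attained)
    have "\<bar>t\<bar> \<le> H"
      using t lip_minorant_le_self[of b q] nonneg[of "q + t *\<^sub>R b"] \<open>h q \<le> H\<close> by simp
    then have 2: "lip_minorant h b p < lip_minorant h b q + e"
      using t lip_minorant_le[of b p t] close[of t] by simp
    from 1 2 show "dist (lip_minorant h b q) (lip_minorant h b p) < e" by (simp add: dist_real_def)
  qed (use \<open>0 < d\<close> in simp)
qed

end

section \<open>A Hardy inequality\<close>

lemma nn_integral_split_at_0:
  fixes f :: "real \<Rightarrow> ennreal"
  assumes [measurable]: "f \<in> borel_measurable borel"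
  shows "(\<integral>\<^sub>+x. f \<bar>x\<bar>) \<le> 2 * (\<integral>\<^sub>+x. f x * indicator {0..} x)"
proof -
  have "(\<integral>\<^sub>+x. f \<bar>x\<bar>) \<le> (\<integral>\<^sub>+x. f x * indicator {0..} x + f (- x) * indicator {0..} (- x))"
    by (intro nn_integral_mono) (auto simp: indicator_def abs_if)
  also have "\<dots> = (\<integral>\<^sub>+x. f x * indicator {0..} x) + (\<integral>\<^sub>+x. f (- x) * indicator {0..} (- x))"
    by (rule nn_integral_add) measurable
  also have "(\<integral>\<^sub>+x. f (- x) * indicator {0..} (- x)) = (\<integral>\<^sub>+x. f x * indicator {0..} x)"
    using nn_integral_real_affine[of "\<lambda>x. f x * indicator {0..} x" "- 1" 0] by simp
  finally show ?thesis by (simp add: mult_2)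
qed

lemma nn_integral_inverse_power_3_2:
  assumes "0 < a"
  shows "(\<integral>\<^sub>+\<tau>. ennreal (1 / ((a + \<bar>\<tau>\<bar>) * sqrt (a + \<bar>\<tau>\<bar>)))) \<le> ennreal (4 / sqrt a)"
proof -
  have "((\<lambda>x. - 2 / sqrt (a + x)) \<longlongrightarrow> 0) at_top"
    by (intro tendsto_divide_0[OF tendsto_const] filterlim_at_top_imp_at_infinity
        filterlim_compose[OF sqrt_at_top] filterlim_tendsto_add_at_top[OF tendsto_const filterlim_ident])
  then have "(\<integral>\<^sub>+x. ennreal (1 / ((a + x) * sqrt (a + x))) * indicator {0..} x) = ennreal (0 - - 2 / sqrt (a + 0))"
    using assms
    by (intro nn_integral_FTC_atLeast)
       (auto intro!: derivative_eq_intros simp: field_simps power2_eq_square)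
  moreover have "(\<integral>\<^sub>+x. ennreal (1 / ((a + \<bar>x\<bar>) * sqrt (a + \<bar>x\<bar>))))
     \<le> 2 * (\<integral>\<^sub>+x. ennreal (1 / ((a + x) * sqrt (a + x))) * indicator {0..} x)"
    by (rule nn_integral_split_at_0) measurable
  ultimately show ?thesis
    using assms by (simp add: ennreal_mult[symmetric] flip: ennreal_numeral)
qed

lemma nn_integral_inverse_sqrt:
  assumes "0 < a"
  shows "(\<integral>\<^sub>+\<tau>. indicator {- a<..<a} \<tau> * ennreal (1 / sqrt (a - \<bar>\<tau>\<bar>))) \<le> ennreal (4 * sqrt a)"
proof -
  let ?f = "\<lambda>x. if x \<in> {0..a} then 1 / sqrt (a - x) else 0"
  have "((\<lambda>x. 1 / sqrt (a - x)) has_integral (- 2 * sqrt (a - a)) - (- 2 * sqrt (a - 0))) {0..a}"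
  proof (rule fundamental_theorem_of_calculus_interior)
    fix x assume "x \<in> {0<..<a}"
    then have "((\<lambda>x. - 2 * sqrt (a - x)) has_real_derivative 1 / sqrt (a - x)) (at x)"
      by (auto intro!: derivative_eq_intros simp: field_simps)
    then show "((\<lambda>x. - 2 * sqrt (a - x)) has_vector_derivative 1 / sqrt (a - x)) (at x)"
      by (simp add: has_real_derivative_iff_has_vector_derivative)
  qed (use assms in \<open>auto intro!: continuous_intros\<close>)
  then have "(?f has_integral 2 * sqrt a) UNIV"
    by (simp only: has_integral_restrict_UNIV) simp
  then have f: "(\<integral>\<^sub>+x. ennreal (?f x)) = ennreal (2 * sqrt a)"
    by (intro nn_integral_has_integral_lborel) auto
  have "(\<integral>\<^sub>+\<tau>. indicator {- a<..<a} \<tau> * ennreal (1 / sqrt (a - \<bar>\<tau>\<bar>))) \<le> (\<integral>\<^sub>+\<tau>. ennreal (?f \<bar>\<tau>\<bar>))"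
    by (intro nn_integral_mono) (auto simp: indicator_def)
  also have "\<dots> \<le> 2 * (\<integral>\<^sub>+x. ennreal (?f x) * indicator {0..} x)"
    by (rule nn_integral_split_at_0) measurable
  also have "(\<integral>\<^sub>+x. ennreal (?f x) * indicator {0..} x) = (\<integral>\<^sub>+x. ennreal (?f x))"
    by (intro nn_integral_cong) (auto simp: indicator_def)
  also have "2 * \<dots> = ennreal (4 * sqrt a)"
    unfolding f using assms by (simp add: ennreal_mult[symmetric] flip: ennreal_numeral)
  finally show ?thesis .
qed

text \<open>
  The weight \<open>a\<^sup>1\<^sup>/\<^sup>2 \<rho>\<^sup>-\<^sup>3\<^sup>/\<^sup>2\<close> is chosen so that the first term is integrable in \<open>\<rho> \<in> [a, \<infinity>)\<close> and the
  second one in \<open>a \<in> (0, \<rho>]\<close>.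
\<close>

lemma weighted_young:
  fixes d \<mu> a \<rho> :: real
  assumes "0 < \<mu>" "0 < a" "0 < \<rho>"
  shows "d \<le> \<mu> / 2 * d\<^sup>2 * sqrt a / (\<rho> * sqrt \<rho>) + \<rho> * sqrt \<rho> / (2 * \<mu>) / sqrt a"
proof -
  define w where "w = \<mu> * sqrt a / (\<rho> * sqrt \<rho>)"
  have "0 < w" using assms by (simp add: w_def)
  have "0 \<le> (w * d - 1)\<^sup>2 / (2 * w)" using \<open>0 < w\<close> by simp
  also have "\<dots> = w / 2 * d\<^sup>2 + 1 / (2 * w) - d"
    using \<open>0 < w\<close> by (simp add: field_simps power2_eq_square)
  finally show ?thesis using assms by (simp add: w_def field_simps)
qed

text \<open>
  Let the infimum that defines \<open>r p\<close> be attained at \<open>p + t b\<close>. Then \<open>h p\<close> exceeds \<open>h (p + t b) \<le> r p\<close> by at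
  most the integral of \<open>\<bar>D\<bar>\<close> over the segment, and on the segment \<open>r (p + \<tau> b) + \<bar>\<tau>\<bar> = r p\<close>. A weighted Young
  inequality separates \<open>\<bar>D\<bar>\<^sup>2\<close> from \<open>r\<close>. The first term is integrated in \<open>p\<close> for a fixed end point
  \<open>p + \<tau> b\<close>, the second one in \<open>\<tau>\<close> for fixed \<open>p\<close>; both integrals of the weights are elementary.
\<close>

lemma hardy_lip_minorant:
  fixes h :: "'a::euclidean_space \<Rightarrow> real" and b :: 'a
  assumes h: "continuous_on UNIV h" "\<And>p. 0 \<le> h p"
    and D [measurable]: "D \<in> borel_measurable borel"
    and line: "AE p in lborel. \<forall>t. ennreal \<bar>h (p + t *\<^sub>R b) - h p\<bar> \<le>
      (\<integral>\<^sub>+\<tau>. indicator (open_segment 0 t) \<tau> * ennreal \<bar>D (p + \<tau> *\<^sub>R b)\<bar>)"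
    and S [measurable]: "S \<in> sets borel" and \<mu>: "0 < \<mu>"
  defines "r \<equiv> lip_minorant h b"
  shows "(\<integral>\<^sub>+p. indicator S p * ennreal (h p)) \<le>
    (\<integral>\<^sub>+p. indicator S p * ennreal (r p)) + ennreal (2 * \<mu>) * (\<integral>\<^sub>+p. ennreal ((D p)\<^sup>2))
    + ennreal (2 / \<mu>) * (\<integral>\<^sub>+p. indicator S p * ennreal ((r p)\<^sup>2))"
proof -
  have [measurable]: "h \<in> borel_measurable borel" "r \<in> borel_measurable borel"
    unfolding r_def using h
    by (auto intro!: borel_measurable_continuous_onI continuous_on_lip_minorant)
  \<comment> \<open>For given \<open>p\<close> the set \<open>K\<close> contains the \<open>\<tau>\<close> on the open segment to the minimizer, but does not refer to
    the choice of a minimizer, so it is measurable.\<close>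
  define K where "K = {z::real \<times> 'a. 0 < r (snd z + fst z *\<^sub>R b) \<and> r (snd z + fst z *\<^sub>R b) + \<bar>fst z\<bar> \<le> r (snd z)}"
  have [measurable]: "K \<in> sets borel" unfolding K_def by measurable
  have bound: "AE p in lborel. ennreal (h p) \<le> ennreal (r p) + (\<integral>\<^sub>+\<tau>. indicator K (\<tau>, p) * ennreal \<bar>D (p + \<tau> *\<^sub>R b)\<bar>)"
    using line
  proof eventually_elim
    case (elim p)
    obtain t where t: "r p = h (p + t *\<^sub>R b) + \<bar>t\<bar>"
      unfolding r_def using h(2,1) by (rule lip_minorant_attained)
    have inK: "(\<tau>, p) \<in> K" if "\<tau> \<in> open_segment 0 t" for \<tau>
    proof -
      have "\<bar>\<tau>\<bar> < \<bar>t\<bar>" "\<bar>t - \<tau>\<bar> = \<bar>t\<bar> - \<bar>\<tau>\<bar>"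
        using that by (auto simp: open_segment_eq_real_ivl split: if_splits)
      moreover have "r (p + \<tau> *\<^sub>R b) \<le> h (p + t *\<^sub>R b) + \<bar>t - \<tau>\<bar>"
        unfolding r_def using lip_minorant_le[of h b "p + \<tau> *\<^sub>R b" "t - \<tau>", OF h(2)]
        by (simp add: algebra_simps)
      moreover have "r p \<le> r (p + \<tau> *\<^sub>R b) + \<bar>\<tau>\<bar>"
        unfolding r_def using h(2) by (rule lip_minorant_le_shift)
      ultimately show ?thesis
        using t h(2)[of "p + t *\<^sub>R b"] by (auto simp: K_def)
    qed
    have "ennreal (h p) \<le> ennreal (h (p + t *\<^sub>R b) + \<bar>h (p + t *\<^sub>R b) - h p\<bar>)"
      by (intro ennreal_leI) auto
    also have "\<dots> = ennreal (h (p + t *\<^sub>R b)) + ennreal \<bar>h (p + t *\<^sub>R b) - h p\<bar>"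
      using h(2) by (simp add: ennreal_plus)
    also have "\<dots> \<le> ennreal (r p) + (\<integral>\<^sub>+\<tau>. indicator K (\<tau>, p) * ennreal \<bar>D (p + \<tau> *\<^sub>R b)\<bar>)"
    proof (rule add_mono)
      show "ennreal (h (p + t *\<^sub>R b)) \<le> ennreal (r p)" using t by (intro ennreal_leI) simp
      show "ennreal \<bar>h (p + t *\<^sub>R b) - h p\<bar> \<le> (\<integral>\<^sub>+\<tau>. indicator K (\<tau>, p) * ennreal \<bar>D (p + \<tau> *\<^sub>R b)\<bar>)"
        by (rule order_trans[OF elim[rule_format]])
           (use inK in \<open>auto intro!: nn_integral_mono simp: indicator_def\<close>)
    qed
    finally show ?case .
  qed
  define A where "A z = indicator K z * ennreal (\<mu> / 2 * (D (snd z + fst z *\<^sub>R b))\<^sup>2 *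
      sqrt (r (snd z + fst z *\<^sub>R b)) / (r (snd z) * sqrt (r (snd z))))" for z :: "real \<times> 'a"
  define B where "B z = indicator K z * ennreal (r (snd z) * sqrt (r (snd z)) / (2 * \<mu>) /
      sqrt (r (snd z + fst z *\<^sub>R b)))" for z :: "real \<times> 'a"
  have [measurable]: "A \<in> borel_measurable borel" "B \<in> borel_measurable borel"
    unfolding A_def B_def by measurable
  have [measurable]: "(\<lambda>\<tau>. (\<tau>, p)) \<in> borel_measurable borel" for p :: 'a
    by (auto intro!: cont_borel)
  have AB: "indicator K (\<tau>, p) * ennreal \<bar>D (p + \<tau> *\<^sub>R b)\<bar> \<le> A (\<tau>, p) + B (\<tau>, p)" for \<tau> p
  proof (cases "(\<tau>, p) \<in> K")
    case True
    then have pos: "0 < r (p + \<tau> *\<^sub>R b)" "0 < r p" by (auto simp: K_def)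
    have "ennreal \<bar>D (p + \<tau> *\<^sub>R b)\<bar> \<le> ennreal (\<mu> / 2 * \<bar>D (p + \<tau> *\<^sub>R b)\<bar>\<^sup>2 * sqrt (r (p + \<tau> *\<^sub>R b)) / (r p * sqrt (r p))
        + r p * sqrt (r p) / (2 * \<mu>) / sqrt (r (p + \<tau> *\<^sub>R b)))"
      by (intro ennreal_leI weighted_young pos \<mu>)
    also have "\<dots> = A (\<tau>, p) + B (\<tau>, p)"
      using True pos \<mu> unfolding A_def B_def by (subst ennreal_plus) auto
    finally show ?thesis using True by simp
  qed simp
  have Aint: "(\<integral>\<^sub>+p. \<integral>\<^sub>+\<tau>. A (\<tau>, p)) \<le> ennreal (2 * \<mu>) * (\<integral>\<^sub>+p. ennreal ((D p)\<^sup>2))"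
  proof -
    have "(\<integral>\<^sub>+p. \<integral>\<^sub>+\<tau>. A (\<tau>, p)) = (\<integral>\<^sub>+p. \<integral>\<^sub>+\<tau>. A (\<tau>, p - \<tau> *\<^sub>R b))"
      by (rule nn_integral_shear) measurable
    also have "\<dots> \<le> (\<integral>\<^sub>+p. ennreal (2 * \<mu>) * ennreal ((D p)\<^sup>2))"
    proof (rule nn_integral_mono)
      fix p
      show "(\<integral>\<^sub>+\<tau>. A (\<tau>, p - \<tau> *\<^sub>R b)) \<le> ennreal (2 * \<mu>) * ennreal ((D p)\<^sup>2)"
      proof (cases "0 < r p")
        case True
        have "A (\<tau>, p - \<tau> *\<^sub>R b) \<le> ennreal (\<mu> / 2 * (D p)\<^sup>2 * sqrt (r p)) * ennreal (1 / ((r p + \<bar>\<tau>\<bar>) * sqrt (r p + \<bar>\<tau>\<bar>)))" for \<tau>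
        proof (cases "(\<tau>, p - \<tau> *\<^sub>R b) \<in> K")
          case K: True
          define \<rho> where "\<rho> = r (p - \<tau> *\<^sub>R b)"
          have le: "r p + \<bar>\<tau>\<bar> \<le> \<rho>" using K by (simp add: K_def \<rho>_def)
          have "A (\<tau>, p - \<tau> *\<^sub>R b) = ennreal ((\<mu> / 2 * (D p)\<^sup>2 * sqrt (r p)) * (1 / (\<rho> * sqrt \<rho>)))"
            using K by (simp add: A_def \<rho>_def)
          also have "\<dots> \<le> ennreal ((\<mu> / 2 * (D p)\<^sup>2 * sqrt (r p)) * (1 / ((r p + \<bar>\<tau>\<bar>) * sqrt (r p + \<bar>\<tau>\<bar>))))"
            using True \<mu> le by (intro ennreal_leI mult_left_mono divide_left_mono mult_mono mult_pos_pos) auto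
          also have "\<dots> = ennreal (\<mu> / 2 * (D p)\<^sup>2 * sqrt (r p)) * ennreal (1 / ((r p + \<bar>\<tau>\<bar>) * sqrt (r p + \<bar>\<tau>\<bar>)))"
            using True \<mu> by (intro ennreal_mult) auto
          finally show ?thesis .
        qed (simp add: A_def)
        then have "(\<integral>\<^sub>+\<tau>. A (\<tau>, p - \<tau> *\<^sub>R b)) \<le>
            (\<integral>\<^sub>+\<tau>. ennreal (\<mu> / 2 * (D p)\<^sup>2 * sqrt (r p)) * ennreal (1 / ((r p + \<bar>\<tau>\<bar>) * sqrt (r p + \<bar>\<tau>\<bar>))))"
          by (rule nn_integral_mono)
        also have "\<dots> = ennreal (\<mu> / 2 * (D p)\<^sup>2 * sqrt (r p)) * (\<integral>\<^sub>+\<tau>. ennreal (1 / ((r p + \<bar>\<tau>\<bar>) * sqrt (r p + \<bar>\<tau>\<bar>))))"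
          by (rule nn_integral_cmult) measurable
        also have "\<dots> \<le> ennreal (\<mu> / 2 * (D p)\<^sup>2 * sqrt (r p)) * ennreal (4 / sqrt (r p))"
          using nn_integral_inverse_power_3_2[OF True] by (intro mult_left_mono) auto
        also have "\<dots> = ennreal (2 * \<mu> * (D p)\<^sup>2)"
          using True \<mu> by (subst ennreal_mult[symmetric]) (auto simp: field_simps)
        also have "\<dots> = ennreal (2 * \<mu>) * ennreal ((D p)\<^sup>2)"
          using \<mu> by (intro ennreal_mult) auto
        finally show ?thesis .
      next
        case False
        then have "A (\<tau>, p - \<tau> *\<^sub>R b) = 0" for \<tau> by (simp add: A_def K_def)
        then show ?thesis by simp
      qed
    qed
    also have "\<dots> = ennreal (2 * \<mu>) * (\<integral>\<^sub>+p. ennreal ((D p)\<^sup>2))"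
      by (rule nn_integral_cmult) measurable
    finally show ?thesis .
  qed
  have Bint: "(\<integral>\<^sub>+\<tau>. B (\<tau>, p)) \<le> ennreal (2 / \<mu>) * ennreal ((r p)\<^sup>2)" for p
  proof (cases "0 < r p")
    case True
    have "B (\<tau>, p) \<le> ennreal (r p * sqrt (r p) / (2 * \<mu>)) * (indicator {- r p<..<r p} \<tau> * ennreal (1 / sqrt (r p - \<bar>\<tau>\<bar>)))" for \<tau>
    proof (cases "(\<tau>, p) \<in> K")
      case K: True
      define a where "a = r (p + \<tau> *\<^sub>R b)"
      have a: "0 < a" "a + \<bar>\<tau>\<bar> \<le> r p" using K by (auto simp: K_def a_def)
      have "r p - \<bar>\<tau>\<bar> \<le> a"
        using lip_minorant_le_shift[of h b p \<tau>, OF h(2)] by (simp add: a_def r_def)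
      then have "sqrt (r p - \<bar>\<tau>\<bar>) \<le> sqrt a" by simp
      have "B (\<tau>, p) = ennreal (r p * sqrt (r p) / (2 * \<mu>) * (1 / sqrt a))"
        using K by (simp add: B_def a_def)
      also have "\<dots> \<le> ennreal (r p * sqrt (r p) / (2 * \<mu>) * (1 / sqrt (r p - \<bar>\<tau>\<bar>)))"
        using True \<mu> a \<open>sqrt (r p - \<bar>\<tau>\<bar>) \<le> sqrt a\<close>
        by (intro ennreal_leI mult_left_mono divide_left_mono mult_pos_pos) auto
      also have "\<dots> = ennreal (r p * sqrt (r p) / (2 * \<mu>)) * ennreal (1 / sqrt (r p - \<bar>\<tau>\<bar>))"
        using True \<mu> a by (intro ennreal_mult) auto
      finally show ?thesis using a by (simp add: indicator_def abs_if split: if_splits)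
    qed (simp add: B_def)
    then have "(\<integral>\<^sub>+\<tau>. B (\<tau>, p)) \<le>
        (\<integral>\<^sub>+\<tau>. ennreal (r p * sqrt (r p) / (2 * \<mu>)) * (indicator {- r p<..<r p} \<tau> * ennreal (1 / sqrt (r p - \<bar>\<tau>\<bar>))))"
      by (rule nn_integral_mono)
    also have "\<dots> = ennreal (r p * sqrt (r p) / (2 * \<mu>)) * (\<integral>\<^sub>+\<tau>. indicator {- r p<..<r p} \<tau> * ennreal (1 / sqrt (r p - \<bar>\<tau>\<bar>)))"
      by (rule nn_integral_cmult) measurable
    also have "\<dots> \<le> ennreal (r p * sqrt (r p) / (2 * \<mu>)) * ennreal (4 * sqrt (r p))"
      using nn_integral_inverse_sqrt[OF True] by (intro mult_left_mono) auto
    also have "\<dots> = ennreal (2 / \<mu> * (r p)\<^sup>2)"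
      using True \<mu> by (subst ennreal_mult[symmetric]) (auto simp: field_simps power2_eq_square)
    also have "\<dots> = ennreal (2 / \<mu>) * ennreal ((r p)\<^sup>2)"
      using \<mu> by (intro ennreal_mult) auto
    finally show ?thesis .
  next
    case False
    then have "B (\<tau>, p) = 0" for \<tau> by (auto simp: B_def K_def indicator_def)
    then show ?thesis by simp
  qed
  have [measurable]: "(\<lambda>p. \<integral>\<^sub>+\<tau>. A (\<tau>, p)) \<in> borel_measurable borel"
    "(\<lambda>p. \<integral>\<^sub>+\<tau>. B (\<tau>, p)) \<in> borel_measurable borel"
    by (auto simp: borel_prod[symmetric])
  have "(\<integral>\<^sub>+p. indicator S p * ennreal (h p)) \<le>
      (\<integral>\<^sub>+p. indicator S p * ennreal (r p) + (\<integral>\<^sub>+\<tau>. A (\<tau>, p)) + ennreal (2 / \<mu>) * (indicator S p * ennreal ((r p)\<^sup>2)))"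
  proof (rule nn_integral_mono_AE)
    show "AE p in lborel. indicator S p * ennreal (h p) \<le>
      indicator S p * ennreal (r p) + (\<integral>\<^sub>+\<tau>. A (\<tau>, p)) + ennreal (2 / \<mu>) * (indicator S p * ennreal ((r p)\<^sup>2))"
      using bound
    proof eventually_elim
      case (elim p)
      have "(\<integral>\<^sub>+\<tau>. indicator K (\<tau>, p) * ennreal \<bar>D (p + \<tau> *\<^sub>R b)\<bar>) \<le> (\<integral>\<^sub>+\<tau>. A (\<tau>, p) + B (\<tau>, p))"
        by (intro nn_integral_mono AB)
      also have "\<dots> = (\<integral>\<^sub>+\<tau>. A (\<tau>, p)) + (\<integral>\<^sub>+\<tau>. B (\<tau>, p))"
        by (rule nn_integral_add) measurable
      also have "\<dots> \<le> (\<integral>\<^sub>+\<tau>. A (\<tau>, p)) + ennreal (2 / \<mu>) * ennreal ((r p)\<^sup>2)"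
        by (intro add_left_mono Bint)
      finally have "ennreal (h p) \<le> ennreal (r p) + ((\<integral>\<^sub>+\<tau>. A (\<tau>, p)) + ennreal (2 / \<mu>) * ennreal ((r p)\<^sup>2))"
        using elim by (meson add_left_mono order_trans)
      then show ?case by (auto simp: indicator_def add.assoc)
    qed
  qed
  also have "\<dots> = (\<integral>\<^sub>+p. indicator S p * ennreal (r p)) + (\<integral>\<^sub>+p. \<integral>\<^sub>+\<tau>. A (\<tau>, p))
      + ennreal (2 / \<mu>) * (\<integral>\<^sub>+p. indicator S p * ennreal ((r p)\<^sup>2))"
    by (simp add: nn_integral_add nn_integral_cmult)
  also have "\<dots> \<le> (\<integral>\<^sub>+p. indicator S p * ennreal (r p)) + ennreal (2 * \<mu>) * (\<integral>\<^sub>+p. ennreal ((D p)\<^sup>2))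
      + ennreal (2 / \<mu>) * (\<integral>\<^sub>+p. indicator S p * ennreal ((r p)\<^sup>2))"
    by (intro add_mono Aint order_refl)
  finally show ?thesis .
qed

text \<open>
  On the line through \<open>p\<close> the minorant stays above the tent of height and half-width \<open>r p\<close>; one half
  of the tent has area \<open>(r p)\<^sup>2 / 2\<close>.
\<close>

lemma lip_minorant_square_le:
  fixes h :: "'a::euclidean_space \<Rightarrow> real" and b :: 'a
  assumes h: "\<And>p. 0 \<le> h p"
  defines "r \<equiv> lip_minorant h b"
  shows "ennreal ((r p)\<^sup>2) \<le> 2 * (\<integral>\<^sub>+\<tau>. ennreal (r (p + \<tau> *\<^sub>R b)))"
proof -
  have r0: "0 \<le> r p" for p unfolding r_def using h by (rule lip_minorant_nonneg)
  have "(\<integral>\<^sub>+\<tau>. ennreal (r p - \<tau>) * indicator {0..r p} \<tau>) = ennreal ((r p * r p - (r p)\<^sup>2 / 2) - (r p * 0 - 0\<^sup>2 / 2))"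
    by (intro nn_integral_FTC_Icc) (auto intro!: derivative_eq_intros r0)
  then have "ennreal ((r p)\<^sup>2) = 2 * (\<integral>\<^sub>+\<tau>. ennreal (r p - \<tau>) * indicator {0..r p} \<tau>)"
    by (simp add: power2_eq_square ennreal_mult[symmetric] flip: ennreal_numeral)
  also have "\<dots> \<le> 2 * (\<integral>\<^sub>+\<tau>. ennreal (r (p + \<tau> *\<^sub>R b)))"
  proof (intro mult_left_mono nn_integral_mono)
    fix \<tau>
    show "ennreal (r p - \<tau>) * indicator {0..r p} \<tau> \<le> ennreal (r (p + \<tau> *\<^sub>R b))"
      using lip_minorant_le_shift[of h b p \<tau>, OF h] by (auto simp: indicator_def r_def intro!: ennreal_leI)
  qed simp
  finally show ?thesis .
qed

section \<open>The volume bound\<close>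

lemma Basis_R2: "(Basis :: R2 set) = {(1, 0), (0, 1)}"
  by (auto simp: Basis_prod_def)

text \<open>
  A Loomis-Whitney argument. The two minorants are bounded by \<open>R1\<^sup>2 \<le> 2 G1 y\<close> and \<open>R2\<^sup>2 \<le> 2 G2 s\<close> at the point
  \<open>(s, y)\<close>, where \<open>G1\<close> and \<open>G2\<close> are integrals over lines; hence the integral of \<open>R1\<^sup>2 R2\<^sup>2\<close> factorizes. The number
  \<open>x\<^sup>6\<close> stands for the energy, and \<open>x\<^sup>2\<close> is the length scale at which the two bounds for the minimum balance.
\<close>

lemma nn_integral_min_lip_minorants:
  fixes h :: "R2 \<Rightarrow> real"
  assumes h: "continuous_on UNIV h" "\<And>p. 0 \<le> h p" and x: "0 < x"
    and r: "\<And>b. b \<in> Basis \<Longrightarrow> (\<integral>\<^sub>+p. ennreal (lip_minorant h b p)) \<le> ennreal (5 * x ^ 6)"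
  shows "(\<integral>\<^sub>+p. ennreal ((min (lip_minorant h (1, 0) p) (lip_minorant h (0, 1) p))\<^sup>2)) \<le> ennreal (105 * x ^ 8)"
proof -
  define R1 where "R1 = lip_minorant h (1, 0)"
  define R2 where "R2 = lip_minorant h (0, 1)"
  have cont: "continuous_on UNIV R1" "continuous_on UNIV R2"
    unfolding R1_def R2_def using h by (auto intro: continuous_on_lip_minorant)
  then have [measurable]: "R1 \<in> borel_measurable borel" "R2 \<in> borel_measurable borel"
    by (auto intro: borel_measurable_continuous_onI)
  have nn: "0 \<le> R1 p" "0 \<le> R2 p" for p
    unfolding R1_def R2_def using h(2) by (auto intro: lip_minorant_nonneg)
  have I1: "(\<integral>\<^sub>+p. ennreal (R1 p)) \<le> ennreal (5 * x ^ 6)" and I2: "(\<integral>\<^sub>+p. ennreal (R2 p)) \<le> ennreal (5 * x ^ 6)"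
    unfolding R1_def R2_def by (auto intro!: r simp: Basis_R2)
  define G1 where "G1 y = (\<integral>\<^sub>+s. ennreal (R1 (s, y)))" for y
  define G2 where "G2 s = (\<integral>\<^sub>+y. ennreal (R2 (s, y)))" for s
  have [measurable]: "(\<lambda>s. R1 (s, y)) \<in> borel_measurable borel" "(\<lambda>y. R2 (s, y)) \<in> borel_measurable borel" for s y
    by (auto intro!: borel_measurable_continuous_onI continuous_on_compose2[OF cont(1)] continuous_on_compose2[OF cont(2)] continuous_intros)
  have [measurable]: "G1 \<in> borel_measurable borel" "G2 \<in> borel_measurable borel"
    unfolding G1_def G2_def by (auto simp: borel_prod[symmetric])
  have sq1: "ennreal ((R1 (s, y))\<^sup>2) \<le> 2 * G1 y" for s y
    using lip_minorant_square_le[of h "(1, 0)" "(s, y)", OF h(2)]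
      nn_integral_translate[of "\<lambda>t. ennreal (R1 (t, y))" s]
    by (simp add: R1_def[symmetric] G1_def add.commute)
  have sq2: "ennreal ((R2 (s, y))\<^sup>2) \<le> 2 * G2 s" for s y
    using lip_minorant_square_le[of h "(0, 1)" "(s, y)", OF h(2)]
      nn_integral_translate[of "\<lambda>t. ennreal (R2 (s, t))" y]
    by (simp add: R2_def[symmetric] G2_def add.commute)
  have int1: "(\<integral>\<^sub>+y. G1 y) = (\<integral>\<^sub>+p. ennreal (R1 p))"
    unfolding G1_def by (rule nn_integral_lborel_pair(2)[symmetric]) measurable
  have int2: "(\<integral>\<^sub>+s. G2 s) = (\<integral>\<^sub>+p. ennreal (R2 p))"
    unfolding G2_def by (rule nn_integral_lborel_pair(1)[symmetric]) measurable
  have prod: "(\<integral>\<^sub>+p. ennreal ((R1 p)\<^sup>2) * ennreal ((R2 p)\<^sup>2)) \<le> ennreal (100 * x ^ 12)"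
  proof -
    have "(\<integral>\<^sub>+p. ennreal ((R1 p)\<^sup>2) * ennreal ((R2 p)\<^sup>2)) \<le> (\<integral>\<^sub>+p. (2 * G1 (snd p)) * (2 * G2 (fst p)))"
      by (intro nn_integral_mono mult_mono) (auto simp: sq1[of "fst p" "snd p" for p, simplified] sq2[of "fst p" "snd p" for p, simplified])
    also have "\<dots> = (\<integral>\<^sub>+s. \<integral>\<^sub>+y. (4 * G2 s) * G1 y)"
      by (subst nn_integral_lborel_pair(1)) (auto simp: mult_ac)
    also have "\<dots> = 4 * ((\<integral>\<^sub>+p. ennreal (R2 p)) * (\<integral>\<^sub>+p. ennreal (R1 p)))"
      by (simp add: nn_integral_cmult nn_integral_multc int1 int2 mult.assoc)
    also have "\<dots> \<le> 4 * (ennreal (5 * x ^ 6) * ennreal (5 * x ^ 6))"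
      by (intro mult_left_mono mult_mono I1 I2) auto
    also have "\<dots> = ennreal (100 * x ^ 12)"
      using x by (simp add: ennreal_mult[symmetric] flip: ennreal_numeral power_add)
    finally show ?thesis .
  qed
  have pt: "(min (R1 p) (R2 p))\<^sup>2 \<le> x\<^sup>2 * R1 p + 1 / x ^ 4 * ((R1 p)\<^sup>2 * (R2 p)\<^sup>2)" for p
  proof -
    define m where "m = min (R1 p) (R2 p)"
    have m: "0 \<le> m" "m \<le> R1 p" "m \<le> R2 p" using nn by (auto simp: m_def)
    show ?thesis
    proof (cases "m \<le> x\<^sup>2")
      case True
      have "m\<^sup>2 \<le> x\<^sup>2 * R1 p"
        unfolding power2_eq_square[of m] using True m by (intro mult_mono) auto
      also have "\<dots> \<le> x\<^sup>2 * R1 p + 1 / x ^ 4 * ((R1 p)\<^sup>2 * (R2 p)\<^sup>2)" by simp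
      finally show ?thesis by (simp add: m_def)
    next
      case False
      have "(x\<^sup>2)\<^sup>2 * m\<^sup>2 \<le> m\<^sup>2 * m\<^sup>2"
        using False m by (intro mult_right_mono power_mono) auto
      also have "\<dots> \<le> (R1 p)\<^sup>2 * (R2 p)\<^sup>2"
        using m by (intro mult_mono power_mono) auto
      finally have "m\<^sup>2 \<le> 1 / x ^ 4 * ((R1 p)\<^sup>2 * (R2 p)\<^sup>2)"
        using x by (simp add: field_simps flip: power_mult)
      also have "\<dots> \<le> x\<^sup>2 * R1 p + 1 / x ^ 4 * ((R1 p)\<^sup>2 * (R2 p)\<^sup>2)" using nn by simp
      finally show ?thesis by (simp add: m_def)
    qed
  qed
  have "(\<integral>\<^sub>+p. ennreal ((min (R1 p) (R2 p))\<^sup>2))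
      \<le> (\<integral>\<^sub>+p. ennreal (x\<^sup>2) * ennreal (R1 p) + ennreal (1 / x ^ 4) * (ennreal ((R1 p)\<^sup>2) * ennreal ((R2 p)\<^sup>2)))"
  proof (rule nn_integral_mono)
    fix p
    have "ennreal ((min (R1 p) (R2 p))\<^sup>2) \<le> ennreal (x\<^sup>2 * R1 p + 1 / x ^ 4 * ((R1 p)\<^sup>2 * (R2 p)\<^sup>2))"
      by (intro ennreal_leI pt)
    also have "\<dots> = ennreal (x\<^sup>2) * ennreal (R1 p) + ennreal (1 / x ^ 4) * (ennreal ((R1 p)\<^sup>2) * ennreal ((R2 p)\<^sup>2))"
      using nn x by (simp add: ennreal_mult[symmetric] flip: ennreal_plus)
    finally show "ennreal ((min (R1 p) (R2 p))\<^sup>2) \<le>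
      ennreal (x\<^sup>2) * ennreal (R1 p) + ennreal (1 / x ^ 4) * (ennreal ((R1 p)\<^sup>2) * ennreal ((R2 p)\<^sup>2))" .
  qed
  also have "\<dots> = ennreal (x\<^sup>2) * (\<integral>\<^sub>+p. ennreal (R1 p)) + ennreal (1 / x ^ 4) * (\<integral>\<^sub>+p. ennreal ((R1 p)\<^sup>2) * ennreal ((R2 p)\<^sup>2))"
    by (simp add: nn_integral_add nn_integral_cmult)
  also have "\<dots> \<le> ennreal (x\<^sup>2) * ennreal (5 * x ^ 6) + ennreal (1 / x ^ 4) * ennreal (100 * x ^ 12)"
    by (intro add_mono mult_left_mono I1 prod) auto
  also have "\<dots> = ennreal (105 * x ^ 8)"
  proof -
    have "x\<^sup>2 * (5 * x ^ 6) + 1 / x ^ 4 * (100 * x ^ 12) = 105 * x ^ 8"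
      using x by (simp add: field_simps flip: power_add)
    with x show ?thesis by (simp add: ennreal_mult[symmetric] flip: ennreal_plus)
  qed
  finally show ?thesis by (simp add: R1_def R2_def)
qed

text \<open>
  Each point is treated in the direction in which the minorant is smaller, so that the Hardy
  inequality only sees the square of the minimum. Its parameter is the sixth root of the energy, which
  makes \<open>\<mu> \<integral>\<bar>\<nabla>h\<bar>\<^sup>2\<close> and \<open>\<mu>\<^sup>-\<^sup>1 \<integral>(min R1 R2)\<^sup>2\<close> both of order \<open>x\<^sup>7\<close>.
\<close>

lemma volume_le:
  fixes h :: "R2 \<Rightarrow> real"
  assumes h: "continuous_on UNIV h" "\<And>p. 0 \<le> h p" and wg: "has_weak_gradient UNIV h Dh" and x: "0 < x"
    and r: "\<And>b. b \<in> Basis \<Longrightarrow> (\<integral>\<^sub>+p. ennreal (lip_minorant h b p)) \<le> ennreal (5 * x ^ 6)"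
    and D: "(\<integral>\<^sub>+p. ennreal (norm_grad_sq Dh p)) \<le> ennreal (x ^ 6)"
  shows "(\<integral>\<^sub>+p. ennreal (h p)) \<le> ennreal (10 * x ^ 6 + 422 * x ^ 7)"
proof -
  define R1 where "R1 = lip_minorant h (1, 0)"
  define R2 where "R2 = lip_minorant h (0, 1)"
  have [measurable]: "R1 \<in> borel_measurable borel" "R2 \<in> borel_measurable borel" "h \<in> borel_measurable borel"
    unfolding R1_def R2_def using h by (auto intro!: borel_measurable_continuous_onI continuous_on_lip_minorant)
  have [measurable]: "Dh b \<in> borel_measurable borel" if "b \<in> Basis" for b
    using wg that locally_integrable_borel[of UNIV "Dh b"] by (auto simp: has_weak_gradient_def)
  have [measurable]: "Dh (1, 0) \<in> borel_measurable borel" "Dh (0, 1) \<in> borel_measurable borel"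
    by (auto simp: Basis_R2)
  define S where "S = {p. R1 p \<le> R2 p}"
  have [measurable]: "S \<in> sets borel" unfolding S_def by measurable
  let ?M = "\<integral>\<^sub>+p. ennreal ((min (R1 p) (R2 p))\<^sup>2)"
  have M: "?M \<le> ennreal (105 * x ^ 8)"
    unfolding R1_def R2_def using h x r by (rule nn_integral_min_lip_minorants)
  have part: "(\<integral>\<^sub>+p. indicator A p * ennreal (h p)) \<le>
      ennreal (5 * x ^ 6) + ennreal (2 * x) * (\<integral>\<^sub>+p. ennreal ((Dh b p)\<^sup>2)) + ennreal (2 / x) * ennreal (105 * x ^ 8)"
    if [measurable]: "A \<in> sets borel" and b: "b \<in> Basis"
      and A: "\<And>p. p \<in> A \<Longrightarrow> lip_minorant h b p = min (R1 p) (R2 p)" for A b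
  proof -
    have "(\<integral>\<^sub>+p. indicator A p * ennreal (h p)) \<le>
        (\<integral>\<^sub>+p. indicator A p * ennreal (lip_minorant h b p)) + ennreal (2 * x) * (\<integral>\<^sub>+p. ennreal ((Dh b p)\<^sup>2))
        + ennreal (2 / x) * (\<integral>\<^sub>+p. indicator A p * ennreal ((lip_minorant h b p)\<^sup>2))"
      using b by (intro hardy_lip_minorant h x weak_gradient_line_bound[OF h wg]) auto
    also have "(\<integral>\<^sub>+p. indicator A p * ennreal (lip_minorant h b p)) \<le> (\<integral>\<^sub>+p. ennreal (lip_minorant h b p))"
      by (intro nn_integral_mono) (auto simp: indicator_def)
    also have "\<dots> \<le> ennreal (5 * x ^ 6)" using b by (rule r)
    also have "(\<integral>\<^sub>+p. indicator A p * ennreal ((lip_minorant h b p)\<^sup>2)) \<le> ?M"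
      by (intro nn_integral_mono) (auto simp: indicator_def A)
    also note M
    finally show ?thesis by (simp add: add_mono mult_left_mono)
  qed
  have Dsum: "(\<integral>\<^sub>+p. ennreal ((Dh (1, 0) p)\<^sup>2)) + (\<integral>\<^sub>+p. ennreal ((Dh (0, 1) p)\<^sup>2)) \<le> ennreal (x ^ 6)"
  proof -
    have "(\<integral>\<^sub>+p. ennreal ((Dh (1, 0) p)\<^sup>2)) + (\<integral>\<^sub>+p. ennreal ((Dh (0, 1) p)\<^sup>2))
        = (\<integral>\<^sub>+p. ennreal ((Dh (1, 0) p)\<^sup>2) + ennreal ((Dh (0, 1) p)\<^sup>2))"
      by (rule nn_integral_add[symmetric]) measurable
    also have "\<dots> = (\<integral>\<^sub>+p. ennreal (norm_grad_sq Dh p))"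
      by (simp add: norm_grad_sq_def Basis_R2 ennreal_plus)
    finally show ?thesis using D by simp
  qed
  have "(\<integral>\<^sub>+p. ennreal (h p)) = (\<integral>\<^sub>+p. indicator S p * ennreal (h p) + indicator (- S) p * ennreal (h p))"
    by (intro nn_integral_cong) (auto simp: indicator_def)
  also have "\<dots> = (\<integral>\<^sub>+p. indicator S p * ennreal (h p)) + (\<integral>\<^sub>+p. indicator (- S) p * ennreal (h p))"
    by (rule nn_integral_add) measurable
  also have "\<dots> \<le> (ennreal (5 * x ^ 6) + ennreal (2 * x) * (\<integral>\<^sub>+p. ennreal ((Dh (1, 0) p)\<^sup>2)) + ennreal (2 / x) * ennreal (105 * x ^ 8))
      + (ennreal (5 * x ^ 6) + ennreal (2 * x) * (\<integral>\<^sub>+p. ennreal ((Dh (0, 1) p)\<^sup>2)) + ennreal (2 / x) * ennreal (105 * x ^ 8))"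
  proof (intro add_mono part)
    show "lip_minorant h (1, 0) p = min (R1 p) (R2 p)" if "p \<in> S" for p
      using that by (simp add: S_def R1_def R2_def)
    show "lip_minorant h (0, 1) p = min (R1 p) (R2 p)" if "p \<in> - S" for p
      using that by (simp add: S_def R1_def R2_def)
  qed (auto simp: Basis_R2)
  also have "\<dots> = ennreal (2 * x) * ((\<integral>\<^sub>+p. ennreal ((Dh (1, 0) p)\<^sup>2)) + (\<integral>\<^sub>+p. ennreal ((Dh (0, 1) p)\<^sup>2)))
      + (ennreal (5 * x ^ 6) + ennreal (5 * x ^ 6) + ennreal (2 / x) * ennreal (105 * x ^ 8) + ennreal (2 / x) * ennreal (105 * x ^ 8))"
    by (simp add: distrib_left add_ac)
  also have "\<dots> \<le> ennreal (2 * x) * ennreal (x ^ 6)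
      + (ennreal (5 * x ^ 6) + ennreal (5 * x ^ 6) + ennreal (2 / x) * ennreal (105 * x ^ 8) + ennreal (2 / x) * ennreal (105 * x ^ 8))"
    by (intro add_right_mono mult_left_mono Dsum) auto
  also have "\<dots> = ennreal (10 * x ^ 6 + 422 * x ^ 7)"
  proof -
    have "2 * x * x ^ 6 + (5 * x ^ 6 + 5 * x ^ 6 + 2 / x * (105 * x ^ 8) + 2 / x * (105 * x ^ 8)) = 10 * x ^ 6 + 422 * x ^ 7"
      using x by (simp add: field_simps power_numeral_reduce)
    with x show ?thesis by (simp add: ennreal_mult[symmetric] flip: ennreal_plus)
  qed
  finally show ?thesis .
qed

section \<open>Smooth approximation up to the bottom\<close>

lemma C_infinity_line_bound:
  fixes w :: "'a::euclidean_space \<Rightarrow> 'b::euclidean_space"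
  assumes w: "C_infinity w" and e: "e \<in> Basis" and s: "0 \<le> s"
  shows "ennreal (norm (w (x + s *\<^sub>R e) - w x)) \<le>
    (\<integral>\<^sub>+\<tau>. indicator {0<..<s} \<tau> * ennreal (norm (partial w e (x + \<tau> *\<^sub>R e))))"
proof -
  let ?f = "\<lambda>\<tau>. partial w e (x + \<tau> *\<^sub>R e)"
  have "has_bochner_integral lborel (\<lambda>\<tau>. indicator {0..s} \<tau> *\<^sub>R ?f \<tau>) (w (x + s *\<^sub>R e) - w (x + 0 *\<^sub>R e))"
    by (rule has_bochner_integral_FTC_Icc[OF s, where F = "\<lambda>\<tau>. w (x + \<tau> *\<^sub>R e)"])
       (auto intro!: C_infinity_line_derivative w
          continuous_on_compose2[OF C_infinity_continuous[OF C_infinity_partial[OF w e], of UNIV]] continuous_intros)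
  then have i: "integrable lborel (\<lambda>\<tau>. indicator {0..s} \<tau> *\<^sub>R ?f \<tau>)"
    and eq: "(LINT \<tau>|lborel. indicator {0..s} \<tau> *\<^sub>R ?f \<tau>) = w (x + s *\<^sub>R e) - w x"
    by (auto simp: has_bochner_integral_iff)
  have "ennreal (norm (w (x + s *\<^sub>R e) - w x)) \<le> (\<integral>\<^sub>+\<tau>. ennreal (norm (indicator {0..s} \<tau> *\<^sub>R ?f \<tau>)))"
    using integral_norm_bound_ennreal[OF i] by (simp only: eq)
  also have "\<dots> = (\<integral>\<^sub>+\<tau>. indicator {0<..<s} \<tau> * ennreal (norm (?f \<tau>)))"
  proof (rule nn_integral_cong_AE)
    have "AE \<tau> in lborel. \<tau> \<noteq> 0 \<and> \<tau> \<noteq> s"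
      using AE_lborel_singleton[of 0] AE_lborel_singleton[of s] by eventually_elim simp
    then show "AE \<tau> in lborel. ennreal (norm (indicator {0..s} \<tau> *\<^sub>R ?f \<tau>)) = indicator {0<..<s} \<tau> * ennreal (norm (?f \<tau>))"
      by eventually_elim (auto simp: indicator_def)
  qed
  finally show ?thesis .
qed

lemma ennreal_norm_triangle: "ennreal (norm (a + b)) \<le> ennreal (norm a) + ennreal (norm b)"
  by (simp add: norm_triangle_ineq flip: ennreal_plus)

lemma C_infinity_line_bound_perturbed:
  fixes w :: "'a::euclidean_space \<Rightarrow> 'b::euclidean_space"
  assumes w: "C_infinity w" and e: "e \<in> Basis" and s: "0 \<le> s" and [measurable]: "D \<in> borel_measurable borel"
  shows "ennreal (norm (w (x + s *\<^sub>R e) - w x)) \<le>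
    (\<integral>\<^sub>+\<tau>. indicator {0<..<s} \<tau> * ennreal (norm (D (x + \<tau> *\<^sub>R e)))) +
    (\<integral>\<^sub>+\<tau>. indicator {0<..<s} \<tau> * ennreal (norm (partial w e (x + \<tau> *\<^sub>R e) - D (x + \<tau> *\<^sub>R e))))"
proof -
  have [measurable]: "partial w e \<in> borel_measurable borel"
    by (intro C_infinity_borel C_infinity_partial w e)
  let ?y = "\<lambda>\<tau>. x + \<tau> *\<^sub>R e"
  have "ennreal (norm (w (x + s *\<^sub>R e) - w x)) \<le> (\<integral>\<^sub>+\<tau>. indicator {0<..<s} \<tau> * ennreal (norm (partial w e (?y \<tau>))))"
    by (rule C_infinity_line_bound[OF w e s])
  also have "\<dots> \<le> (\<integral>\<^sub>+\<tau>. indicator {0<..<s} \<tau> * ennreal (norm (D (?y \<tau>))) +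
      indicator {0<..<s} \<tau> * ennreal (norm (partial w e (?y \<tau>) - D (?y \<tau>))))"
    by (intro nn_integral_mono, simp only: distrib_left[symmetric], intro mult_left_mono)
       (use ennreal_norm_triangle[of "D y" "partial w e y - D y" for y] in simp_all)
  finally show ?thesis by (simp add: nn_integral_add)
qed

lemma nn_integral_L1_tendsto_0:
  fixes f :: "nat \<Rightarrow> 'a::euclidean_space \<Rightarrow> 'b::euclidean_space"
  assumes [measurable]: "\<And>n. f n \<in> borel_measurable borel" "A \<in> sets borel"
    and A: "emeasure lborel A < \<infinity>"
    and lim: "(\<lambda>n. \<integral>\<^sub>+x. indicator A x * ennreal ((norm (f n x))\<^sup>2)) \<longlonglongrightarrow> 0"
  shows "(\<lambda>n. \<integral>\<^sub>+x. indicator A x * ennreal (norm (f n x))) \<longlonglongrightarrow> 0"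
proof (rule order_tendstoI)
  fix a :: ennreal assume "0 < a"
  have "(\<lambda>n. emeasure lborel A * (\<integral>\<^sub>+x. indicator A x * ennreal ((norm (f n x))\<^sup>2))) \<longlonglongrightarrow> emeasure lborel A * 0"
    using A lim by (intro ennreal_tendsto_cmult) auto
  then have lim': "(\<lambda>n. emeasure lborel A * (\<integral>\<^sub>+x. indicator A x * ennreal ((norm (f n x))\<^sup>2))) \<longlonglongrightarrow> 0" by simp
  have cs: "(\<integral>\<^sub>+x. indicator A x * ennreal (norm (f n x)))\<^sup>2 \<le> emeasure lborel A * (\<integral>\<^sub>+x. indicator A x * ennreal ((norm (f n x))\<^sup>2))" for n
  proof -
    have "(\<integral>\<^sub>+x. indicator A x * (indicator A x * ennreal (norm (f n x))))\<^sup>2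
        \<le> (\<integral>\<^sub>+x. (indicator A x)\<^sup>2) * (\<integral>\<^sub>+x. (indicator A x * ennreal (norm (f n x)))\<^sup>2)"
      by (rule Cauchy_Schwarz_nn_integral) measurable
    also have "(\<integral>\<^sub>+x. (indicator A x)\<^sup>2) = (\<integral>\<^sub>+x. indicator A x)"
      by (intro nn_integral_cong) (auto simp: indicator_def)
    also have "\<dots> = emeasure lborel A" by simp
    also have "(\<integral>\<^sub>+x. (indicator A x * ennreal (norm (f n x)))\<^sup>2) = (\<integral>\<^sub>+x. indicator A x * ennreal ((norm (f n x))\<^sup>2))"
      by (intro nn_integral_cong) (auto simp: indicator_def ennreal_power)
    also have "(\<integral>\<^sub>+x. indicator A x * (indicator A x * ennreal (norm (f n x)))) = (\<integral>\<^sub>+x. indicator A x * ennreal (norm (f n x)))"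
      by (intro nn_integral_cong) (auto simp: indicator_def)
    finally show ?thesis .
  qed
  have "0 < a\<^sup>2" using \<open>0 < a\<close> by (simp add: zero_less_iff_neq_zero)
  from order_tendstoD(2)[OF lim' this]
  show "\<forall>\<^sub>F n in sequentially. (\<integral>\<^sub>+x. indicator A x * ennreal (norm (f n x))) < a"
  proof eventually_elim
    case (elim n)
    show ?case
    proof (rule ccontr)
      assume "\<not> ?thesis"
      then have "a\<^sup>2 \<le> (\<integral>\<^sub>+x. indicator A x * ennreal (norm (f n x)))\<^sup>2" by (intro power_mono) auto
      with cs[of n] elim show False by (meson le_less_trans not_less)
    qed
  qed
qed simp

text \<open>
  The form in which the trace is used: on a cylinder of finite measure convergence in \<open>L\<^sup>2\<close> implies
  convergence in \<open>L\<^sup>1\<close>, and the estimates below are linear in \<open>u\<close> and its gradient.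
\<close>

definition L1_approximation ::
    "'a::euclidean_space set \<Rightarrow> real \<Rightarrow> ('a \<times> real \<Rightarrow> 'b::euclidean_space) \<Rightarrow>
     ('a \<times> real \<Rightarrow> 'a \<times> real \<Rightarrow> 'b) \<Rightarrow> ('a \<Rightarrow> 'b) \<Rightarrow> (nat \<Rightarrow> 'a \<times> real \<Rightarrow> 'b) \<Rightarrow> bool" where
  "L1_approximation B d u Du T w \<longleftrightarrow> (\<forall>n. C_infinity (w n)) \<and>
    ((\<lambda>n. \<integral>\<^sub>+x. indicator (B \<times> {0<..<d}) x * ennreal (norm (w n x - u x))) \<longlonglongrightarrow> 0) \<and>
    (\<forall>e\<in>Basis. (\<lambda>n. \<integral>\<^sub>+x. indicator (B \<times> {0<..<d}) x * ennreal (norm (partial (w n) e x - Du e x))) \<longlonglongrightarrow> 0) \<and>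
    ((\<lambda>n. \<integral>\<^sub>+p. indicator B p * ennreal (norm (w n (p, 0) - T p))) \<longlonglongrightarrow> 0)"

lemma has_bottom_trace_L1:
  fixes u :: "'a::euclidean_space \<times> real \<Rightarrow> 'b::euclidean_space"
  assumes tr: "has_bottom_trace B d u Du T"
    and [measurable]: "u \<in> borel_measurable borel" "T \<in> borel_measurable borel" "B \<in> sets borel"
    and Dm: "\<forall>e\<in>Basis. Du e \<in> borel_measurable borel"
    and B: "emeasure lborel B < \<infinity>"
  shows "\<exists>w. L1_approximation B d u Du T w"
proof -
  let ?Q = "B \<times> {0<..<d}"
  obtain w where w: "\<And>n. C_infinity (w n)"
    and lim: "(\<lambda>n. \<integral>\<^sub>+x. indicator ?Q x * ennreal ((norm (w n x - u x))\<^sup>2 +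
                norm_grad_sq (\<lambda>b x. partial (w n) b x - Du b x) x)) \<longlonglongrightarrow> 0"
    and limT: "(\<lambda>n. \<integral>\<^sub>+p. indicator B p * ennreal ((norm (w n (p, 0) - T p))\<^sup>2)) \<longlonglongrightarrow> 0"
    using tr by (auto simp: has_bottom_trace_def mult.commute)
  have Q [measurable]: "?Q \<in> sets borel" by (rule borel_Times) auto
  have Qfin: "emeasure lborel ?Q < \<infinity>"
  proof -
    have "emeasure lborel ?Q = emeasure lborel B * emeasure lborel {0<..<d}"
      by (subst lborel_prod[symmetric]) (rule lborel.emeasure_pair_measure_Times, auto)
    moreover have "emeasure lborel {0<..<d} < \<infinity>"
      using bounded_box[of 0 d] by (intro emeasure_bounded_finite) simp
    ultimately show ?thesis using B by (simp add: ennreal_mult_less_top)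
  qed
  have [measurable]: "w n \<in> borel_measurable borel" for n by (rule C_infinity_borel[OF w])
  have [measurable]: "(\<lambda>p. w n (p, 0)) \<in> borel_measurable borel" for n
    by (intro cont_borel continuous_on_compose2[OF C_infinity_continuous[OF w, of UNIV]]) auto
  have dominated: "(\<lambda>n. \<integral>\<^sub>+x. indicator ?Q x * ennreal (norm (g n x))) \<longlonglongrightarrow> 0"
    if [measurable]: "\<And>n. g n \<in> borel_measurable borel"
      and le: "\<And>n x. (norm (g n x))\<^sup>2 \<le> (norm (w n x - u x))\<^sup>2 + norm_grad_sq (\<lambda>b x. partial (w n) b x - Du b x) x"
    for g :: "nat \<Rightarrow> 'a \<times> real \<Rightarrow> 'b"
  proof (rule nn_integral_L1_tendsto_0[OF _ Q Qfin])
    show "(\<lambda>n. \<integral>\<^sub>+x. indicator ?Q x * ennreal ((norm (g n x))\<^sup>2)) \<longlonglongrightarrow> 0"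
      by (rule tendsto_sandwich[OF _ _ tendsto_const lim])
         (auto intro!: always_eventually nn_integral_mono mult_left_mono ennreal_leI le)
  qed measurable
  have "L1_approximation B d u Du T w"
    unfolding L1_approximation_def
  proof (intro conjI ballI allI w dominated)
    show "(\<lambda>n. \<integral>\<^sub>+p. indicator B p * ennreal (norm (w n (p, 0) - T p))) \<longlonglongrightarrow> 0"
      by (rule nn_integral_L1_tendsto_0[OF _ _ B limT]) measurable
    fix e :: "'a \<times> real" and n x assume e: "e \<in> Basis"
    show "(\<lambda>x. partial (w n) e x - Du e x) \<in> borel_measurable borel"
      using Dm e C_infinity_borel[OF C_infinity_partial[OF w e], of n] by (intro borel_measurable_diff) auto
    show "(norm (partial (w n) e x - Du e x))\<^sup>2 \<le> (norm (w n x - u x))\<^sup>2 +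
        norm_grad_sq (\<lambda>b x. partial (w n) b x - Du b x) x"
      using member_le_sum[of e Basis "\<lambda>b. (norm (partial (w n) b x - Du b x))\<^sup>2"] e
      by (auto simp: norm_grad_sq_def intro: add_increasing)
  qed (auto simp: norm_grad_sq_def sum_nonneg)
  then show ?thesis by (rule exI[of _ w])
qed

lemma nn_integral_shift_average_le:
  fixes g :: "'a::euclidean_space \<Rightarrow> ennreal"
  assumes [measurable]: "g \<in> borel_measurable borel" "A \<in> sets borel" "C \<in> sets borel" and s: "0 \<le> s"
    and AC: "\<And>x \<tau>. x \<in> A \<Longrightarrow> 0 < \<tau> \<Longrightarrow> \<tau> < s \<Longrightarrow> x + \<tau> *\<^sub>R e \<in> C"
  shows "(\<integral>\<^sub>+x. indicator A x * (\<integral>\<^sub>+\<tau>. indicator {0<..<s} \<tau> * g (x + \<tau> *\<^sub>R e)))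
    \<le> ennreal s * (\<integral>\<^sub>+x. indicator C x * g x)"
proof -
  have "(\<integral>\<^sub>+x. indicator A x * (\<integral>\<^sub>+\<tau>. indicator {0<..<s} \<tau> * g (x + \<tau> *\<^sub>R e)))
      = (\<integral>\<^sub>+x. \<integral>\<^sub>+\<tau>. indicator A x * (indicator {0<..<s} \<tau> * g (x + \<tau> *\<^sub>R e)))"
    by (simp add: nn_integral_cmult)
  also have "\<dots> = (\<integral>\<^sub>+x. \<integral>\<^sub>+\<tau>. indicator A (x - \<tau> *\<^sub>R e) * (indicator {0<..<s} \<tau> * g x))"
    using nn_integral_shear[of "\<lambda>z. indicator A (snd z) * (indicator {0<..<s} (fst z) * g (snd z + fst z *\<^sub>R e))" e]
    by simp
  also have "\<dots> \<le> (\<integral>\<^sub>+x. \<integral>\<^sub>+\<tau>. (indicator C x * g x) * indicator {0<..<s} \<tau>)"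
  proof (intro nn_integral_mono)
    fix x \<tau>
    show "indicator A (x - \<tau> *\<^sub>R e) * (indicator {0<..<s} \<tau> * g x) \<le> (indicator C x * g x) * indicator {0<..<s} \<tau>"
      using AC[of "x - \<tau> *\<^sub>R e" \<tau>] by (auto simp: indicator_def)
  qed
  also have "\<dots> = ennreal s * (\<integral>\<^sub>+x. indicator C x * g x)"
    using s by (simp add: nn_integral_cmult nn_integral_multc mult.commute)
  finally show ?thesis .
qed

lemma measurable_column_integral:
  fixes g :: "'a::euclidean_space \<times> real \<Rightarrow> ennreal"
  assumes [measurable]: "g \<in> borel_measurable borel"
  shows "(\<lambda>x. \<integral>\<^sub>+\<zeta>. indicator {0<..<snd x} \<zeta> * g (fst x, \<zeta>)) \<in> borel_measurable borel"
proof -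
  have [measurable]: "(\<lambda>z::('a \<times> real) \<times> real. g (fst (fst z), snd z)) \<in> borel_measurable borel"
    by (rule measurable_compose[OF _ assms]) (auto intro!: cont_borel)
  have [measurable]: "{z::('a \<times> real) \<times> real. 0 < snd z \<and> snd z < snd (fst z)} \<in> sets borel"
    by measurable
  have "(\<lambda>z::('a \<times> real) \<times> real. indicator {z. 0 < snd z \<and> snd z < snd (fst z)} z * g (fst (fst z), snd z)) \<in> borel_measurable borel"
    by measurable
  then have "(\<lambda>z::('a \<times> real) \<times> real. indicator {0<..<snd (fst z)} (snd z) * g (fst (fst z), snd z)) \<in> borel_measurable borel"
    by (simp add: indicator_def)
  then show ?thesis
    by (intro lborel.borel_measurable_nn_integral) (simp add: borel_prod[symmetric] split_beta')
qed

text \<open>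
  Over a point \<open>q\<close> the heights in \<open>S\<close> fill at most an interval of length \<open>2 s\<close>, and for each of them the
  inner integral is at most the integral of \<open>g\<close> over the column of \<open>C\<close> at \<open>q\<close>.
\<close>

lemma nn_integral_column_le:
  fixes g :: "'a::euclidean_space \<times> real \<Rightarrow> ennreal"
  assumes [measurable]: "g \<in> borel_measurable borel" "S \<in> sets borel" "C \<in> sets borel" and s: "0 \<le> s"
    and S: "\<And>q z. (q, z) \<in> S \<Longrightarrow> z \<in> {\<eta> q - s..\<eta> q + s}"
    and SC: "\<And>q z \<zeta>. (q, z) \<in> S \<Longrightarrow> 0 < \<zeta> \<Longrightarrow> \<zeta> < z \<Longrightarrow> (q, \<zeta>) \<in> C"
  shows "(\<integral>\<^sub>+x. indicator S x * (\<integral>\<^sub>+\<zeta>. indicator {0<..<snd x} \<zeta> * g (fst x, \<zeta>)))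
    \<le> ennreal (2 * s) * (\<integral>\<^sub>+x. indicator C x * g x)"
proof -
  have [measurable]: "(\<lambda>x. \<integral>\<^sub>+\<zeta>. indicator {0<..<snd x} \<zeta> * g (fst x, \<zeta>)) \<in> borel_measurable borel"
    by (rule measurable_column_integral) measurable
  define I where "I q = (\<integral>\<^sub>+\<zeta>. indicator C (q, \<zeta>) * g (q, \<zeta>))" for q
  have "(\<lambda>x. indicator C x * g x) \<in> borel_measurable borel" by measurable
  then have [measurable]: "I \<in> borel_measurable borel"
    unfolding I_def by (intro lborel.borel_measurable_nn_integral) (simp add: borel_prod[symmetric] split_beta')
  have "(\<integral>\<^sub>+x. indicator S x * (\<integral>\<^sub>+\<zeta>. indicator {0<..<snd x} \<zeta> * g (fst x, \<zeta>)))
      = (\<integral>\<^sub>+q. \<integral>\<^sub>+z. indicator S (q, z) * (\<integral>\<^sub>+\<zeta>. indicator {0<..<z} \<zeta> * g (q, \<zeta>)))"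
    by (subst nn_integral_lborel_pair(1)) simp_all
  also have "\<dots> \<le> (\<integral>\<^sub>+q. \<integral>\<^sub>+z. I q * indicator {\<eta> q - s..\<eta> q + s} z)"
  proof (intro nn_integral_mono)
    fix q z
    show "indicator S (q, z) * (\<integral>\<^sub>+\<zeta>. indicator {0<..<z} \<zeta> * g (q, \<zeta>)) \<le> I q * indicator {\<eta> q - s..\<eta> q + s} z"
    proof (cases "(q, z) \<in> S")
      case True
      have "(\<integral>\<^sub>+\<zeta>. indicator {0<..<z} \<zeta> * g (q, \<zeta>)) \<le> I q"
        unfolding I_def using SC[OF True] by (intro nn_integral_mono) (auto simp: indicator_def)
      with S[OF True] True show ?thesis by simp
    qed simp
  qed
  also have "\<dots> = (\<integral>\<^sub>+q. ennreal (2 * s) * I q)"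
    using s by (simp add: nn_integral_cmult mult.commute)
  also have "\<dots> = ennreal (2 * s) * (\<integral>\<^sub>+q. I q)"
    by (rule nn_integral_cmult) measurable
  also have "(\<integral>\<^sub>+q. I q) = (\<integral>\<^sub>+x. indicator C x * g x)"
    unfolding I_def by (rule nn_integral_lborel_pair(1)[symmetric]) measurable
  finally show ?thesis .
qed

text \<open>
  The inequality holds for the smooth approximations by the fundamental theorem of calculus. The
  segments do not leave the cylinder, so the errors are controlled by \<open>L\<^sup>1\<close> norms on it.
\<close>

lemma trace_shift_bound:
  fixes u :: "'a::euclidean_space \<times> real \<Rightarrow> 'b::euclidean_space"
  assumes w: "L1_approximation B d u Du T w"
    and [measurable]: "u \<in> borel_measurable borel" "Du e \<in> borel_measurable borel" "B \<in> sets borel" "S \<in> sets borel"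
    and e: "e \<in> Basis" and s: "0 \<le> s"
    and SQ: "\<And>x \<tau>. x \<in> S \<Longrightarrow> \<tau> \<in> {0..s} \<Longrightarrow> x + \<tau> *\<^sub>R e \<in> B \<times> {0<..<d}"
  shows "(\<integral>\<^sub>+x. indicator S x * ennreal (norm (u (x + s *\<^sub>R e) - u x))) \<le>
    (\<integral>\<^sub>+x. indicator S x * (\<integral>\<^sub>+\<tau>. indicator {0<..<s} \<tau> * ennreal (norm (Du e (x + \<tau> *\<^sub>R e)))))"
    (is "?X \<le> ?Y")
proof -
  let ?Q = "B \<times> {0<..<d}"
  let ?k = "\<lambda>n x. ennreal (norm (w n x - u x))" and ?g = "\<lambda>n x. ennreal (norm (partial (w n) e x - Du e x))"
  define a c where "a n = (\<integral>\<^sub>+x. indicator ?Q x * ?k n x)" and "c n = (\<integral>\<^sub>+x. indicator ?Q x * ?g n x)" for n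
  have C: "C_infinity (w n)" for n using w by (simp add: L1_approximation_def)
  have lim: "a \<longlonglongrightarrow> 0" "c \<longlonglongrightarrow> 0"
    using w e unfolding L1_approximation_def a_def[abs_def] c_def[abs_def] by blast+
  have [measurable]: "?Q \<in> sets borel" by (rule borel_Times) auto
  have [measurable]: "w n \<in> borel_measurable borel" "partial (w n) e \<in> borel_measurable borel" for n
    by (intro C_infinity_borel C_infinity_partial C e)+
  have shifted: "(\<integral>\<^sub>+x. indicator S x * ?k n (x + \<tau> *\<^sub>R e)) \<le> a n" if "\<tau> \<in> {0..s}" for n \<tau>
  proof -
    have "(\<integral>\<^sub>+x. indicator S x * ?k n (x + \<tau> *\<^sub>R e)) \<le> (\<integral>\<^sub>+x. indicator ?Q (x + \<tau> *\<^sub>R e) * ?k n (x + \<tau> *\<^sub>R e))"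
      using SQ[OF _ that] by (intro nn_integral_mono mult_right_mono) (auto simp: indicator_def)
    also have "\<dots> = a n"
      unfolding a_def by (rule nn_integral_translate) measurable
    finally show ?thesis .
  qed
  have main: "?X \<le> ?Y + (ennreal s * c n + (a n + a n))" for n
  proof -
    let ?I = "\<lambda>x. \<integral>\<^sub>+\<tau>. indicator {0<..<s} \<tau> * ennreal (norm (Du e (x + \<tau> *\<^sub>R e)))"
    let ?J = "\<lambda>x. \<integral>\<^sub>+\<tau>. indicator {0<..<s} \<tau> * ?g n (x + \<tau> *\<^sub>R e)"
    have "ennreal (norm (u (x + s *\<^sub>R e) - u x)) \<le> ?I x + ?J x + ?k n (x + s *\<^sub>R e) + ?k n x" for x
    proof -
      have "ennreal (norm (u (x + s *\<^sub>R e) - u x)) \<le> ennreal (norm (w n (x + s *\<^sub>R e) - w n x) + norm (w n (x + s *\<^sub>R e) - u (x + s *\<^sub>R e)) + norm (w n x - u x))"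
        by (rule ennreal_leI) norm
      also have "\<dots> = ennreal (norm (w n (x + s *\<^sub>R e) - w n x)) + ?k n (x + s *\<^sub>R e) + ?k n x"
        by (simp add: ennreal_plus)
      also have "ennreal (norm (w n (x + s *\<^sub>R e) - w n x)) \<le> ?I x + ?J x"
        by (rule C_infinity_line_bound_perturbed[OF C e s]) measurable
      finally show ?thesis by (simp add: add_right_mono)
    qed
    then have "?X \<le> (\<integral>\<^sub>+x. indicator S x * (?I x + ?J x + ?k n (x + s *\<^sub>R e) + ?k n x))"
      by (intro nn_integral_mono mult_left_mono) auto
    also have "\<dots> = ?Y + (\<integral>\<^sub>+x. indicator S x * ?J x) + (\<integral>\<^sub>+x. indicator S x * ?k n (x + s *\<^sub>R e)) + (\<integral>\<^sub>+x. indicator S x * ?k n x)"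
      by (simp add: distrib_left nn_integral_add)
    also have "(\<integral>\<^sub>+x. indicator S x * ?J x) \<le> ennreal s * c n"
      unfolding c_def using s SQ by (intro nn_integral_shift_average_le) auto
    also have "(\<integral>\<^sub>+x. indicator S x * ?k n (x + s *\<^sub>R e)) \<le> a n"
      using s by (intro shifted) auto
    also have "(\<integral>\<^sub>+x. indicator S x * ?k n x) \<le> a n"
      using shifted[of 0] s by simp
    finally show ?thesis by (simp add: add_mono add_ac)
  qed
  have "(\<lambda>n. ?Y + (ennreal s * c n + (a n + a n))) \<longlonglongrightarrow> ?Y + (ennreal s * 0 + (0 + 0))"
    by (intro tendsto_add tendsto_const ennreal_tendsto_cmult lim) simp
  then show ?thesis using main by (intro LIMSEQ_le_const[where X = "\<lambda>n. ?Y + (ennreal s * c n + (a n + a n))"]) auto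
qed

text \<open>
  The same on vertical segments, which now start at the bottom, where the approximations converge to
  the trace.
\<close>

lemma trace_height_bound:
  fixes u :: "'a::euclidean_space \<times> real \<Rightarrow> 'b::euclidean_space"
  defines "e \<equiv> (0, 1)"
  assumes w: "L1_approximation B d u Du T w"
    and [measurable]: "u \<in> borel_measurable borel" "Du e \<in> borel_measurable borel" "T \<in> borel_measurable borel"
      "B \<in> sets borel" "S \<in> sets borel"
    and d: "0 < d" and SQ: "S \<subseteq> B \<times> {0<..<d}"
  shows "(\<integral>\<^sub>+x. indicator S x * ennreal (norm (u x - T (fst x)))) \<le>
    (\<integral>\<^sub>+x. indicator S x * (\<integral>\<^sub>+\<zeta>. indicator {0<..<snd x} \<zeta> * ennreal (norm (Du e (fst x, \<zeta>)))))"
    (is "?X \<le> ?Y")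
proof -
  let ?Q = "B \<times> {0<..<d}"
  let ?k = "\<lambda>n x. ennreal (norm (w n x - u x))" and ?g = "\<lambda>n x. ennreal (norm (partial (w n) e x - Du e x))"
    and ?l = "\<lambda>n p. ennreal (norm (w n (p, 0) - T p))"
  define a c t where "a n = (\<integral>\<^sub>+x. indicator ?Q x * ?k n x)" and "c n = (\<integral>\<^sub>+x. indicator ?Q x * ?g n x)"
    and "t n = (\<integral>\<^sub>+p. indicator B p * ?l n p)" for n
  have e: "e \<in> Basis" by (simp add: e_def Basis_prod_def)
  have C: "C_infinity (w n)" for n using w by (simp add: L1_approximation_def)
  have lim: "a \<longlonglongrightarrow> 0" "c \<longlonglongrightarrow> 0" "t \<longlonglongrightarrow> 0"
    using w e unfolding L1_approximation_def a_def[abs_def] c_def[abs_def] t_def[abs_def] by blast+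
  have [measurable]: "?Q \<in> sets borel" by (rule borel_Times) auto
  have [measurable]: "w n \<in> borel_measurable borel" "partial (w n) e \<in> borel_measurable borel" for n
    by (intro C_infinity_borel C_infinity_partial C e)+
  have [measurable]: "(\<lambda>p. w n (p, 0)) \<in> borel_measurable borel" for n
    by (intro cont_borel continuous_on_compose2[OF C_infinity_continuous[OF C, of UNIV]]) auto
  have column: "(\<integral>\<^sub>+x. indicator S x * ?l n (fst x)) \<le> ennreal d * t n" for n
  proof -
    have "(\<integral>\<^sub>+x. indicator S x * ?l n (fst x)) \<le> (\<integral>\<^sub>+x. (indicator B (fst x) * ?l n (fst x)) * indicator {0<..<d} (snd x))"
      using SQ by (intro nn_integral_mono) (auto simp: indicator_def)
    also have "\<dots> = (\<integral>\<^sub>+p. (indicator B p * ?l n p) * ennreal d)"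
      using d by (subst nn_integral_lborel_pair(1)) (auto simp: nn_integral_cmult)
    also have "\<dots> = ennreal d * t n"
      unfolding t_def by (subst nn_integral_multc) (auto simp: mult.commute)
    finally show ?thesis .
  qed
  have main: "?X \<le> ?Y + (ennreal d * c n + ennreal d * t n + a n)" for n
  proof -
    let ?I = "\<lambda>x. \<integral>\<^sub>+\<zeta>. indicator {0<..<snd x} \<zeta> * ennreal (norm (Du e (fst x, \<zeta>)))"
    let ?J = "\<lambda>x. \<integral>\<^sub>+\<zeta>. indicator {0<..<snd x} \<zeta> * ?g n (fst x, \<zeta>)"
    have [measurable]: "?I \<in> borel_measurable borel" "?J \<in> borel_measurable borel"
      using measurable_column_integral[of "\<lambda>x. ennreal (norm (Du e x))"] measurable_column_integral[of "?g n"] by simp_all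
    have "indicator S x * ennreal (norm (u x - T (fst x))) \<le> indicator S x * (?I x + ?J x + ?l n (fst x) + ?k n x)" for x
    proof (cases "x \<in> S")
      case True
      then have z: "0 \<le> snd x" using SQ by (cases x) auto
      have "ennreal (norm (u x - T (fst x))) \<le> ennreal (norm (w n x - w n (fst x, 0)) + norm (w n (fst x, 0) - T (fst x)) + norm (w n x - u x))"
        by (rule ennreal_leI) norm
      also have "\<dots> = ennreal (norm (w n x - w n (fst x, 0))) + ?l n (fst x) + ?k n x"
        by (simp add: ennreal_plus)
      also have "ennreal (norm (w n x - w n (fst x, 0))) \<le> ?I x + ?J x"
        using C_infinity_line_bound_perturbed[OF C e z \<open>Du e \<in> borel_measurable borel\<close>, of n "(fst x, 0)"] by (simp add: e_def)
      finally show ?thesis using True by (simp add: add_right_mono)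
    qed simp
    then have "?X \<le> (\<integral>\<^sub>+x. indicator S x * (?I x + ?J x + ?l n (fst x) + ?k n x))"
      by (intro nn_integral_mono) auto
    also have "\<dots> = ?Y + (\<integral>\<^sub>+x. indicator S x * ?J x) + (\<integral>\<^sub>+x. indicator S x * ?l n (fst x)) + (\<integral>\<^sub>+x. indicator S x * ?k n x)"
      by (simp add: distrib_left nn_integral_add)
    also have "(\<integral>\<^sub>+x. indicator S x * ?J x) \<le> ennreal (2 * (d / 2)) * c n"
      unfolding c_def using d SQ by (intro nn_integral_column_le[where \<eta> = "\<lambda>_. d / 2"]) (auto dest!: subsetD)
    also have "(\<integral>\<^sub>+x. indicator S x * ?l n (fst x)) \<le> ennreal d * t n" by (rule column)
    also have "(\<integral>\<^sub>+x. indicator S x * ?k n x) \<le> a n"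
      unfolding a_def using SQ by (intro nn_integral_mono) (auto simp: indicator_def)
    finally show ?thesis by (simp add: add_mono add_ac)
  qed
  have "(\<lambda>n. ?Y + (ennreal d * c n + ennreal d * t n + a n)) \<longlonglongrightarrow> ?Y + (ennreal d * 0 + ennreal d * 0 + 0)"
    by (intro tendsto_add tendsto_const ennreal_tendsto_cmult lim) simp_all
  then show ?thesis using main by (intro LIMSEQ_le_const[where X = "\<lambda>n. ?Y + (ennreal d * c n + ennreal d * t n + a n)"]) auto
qed

section \<open>The elastic energy controls the Lipschitz minorant\<close>

lemma in_Omega_iff: "x \<in> Omega h \<longleftrightarrow> 0 < snd x \<and> snd x < h (fst x)"
  by (cases x) (auto simp: Omega_def)

text \<open>
  Disjoint pieces of the sets of a finite cover are compared one by one.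
\<close>

lemma nn_integral_le_by_finite_cover:
  fixes f g :: "'a::euclidean_space \<Rightarrow> ennreal"
  assumes "finite I" and [measurable]: "f \<in> borel_measurable borel" "g \<in> borel_measurable borel"
    and "\<And>i. i \<in> I \<Longrightarrow> U i \<in> sets borel"
    and "\<And>i S. i \<in> I \<Longrightarrow> S \<in> sets borel \<Longrightarrow> S \<subseteq> A \<inter> U i \<Longrightarrow>
      (\<integral>\<^sub>+x. indicator S x * f x) \<le> (\<integral>\<^sub>+x. indicator S x * g x)"
    and "A \<in> sets borel" "A \<subseteq> (\<Union>i\<in>I. U i)"
  shows "(\<integral>\<^sub>+x. indicator A x * f x) \<le> (\<integral>\<^sub>+x. indicator A x * g x)"
  using assms(1,4-)
proof (induction I arbitrary: A rule: finite_induct)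
  case (insert i I)
  have [measurable]: "A \<in> sets borel" "U i \<in> sets borel" using insert by auto
  have split: "(\<integral>\<^sub>+x. indicator A x * k x) =
      (\<integral>\<^sub>+x. indicator (A \<inter> U i) x * k x) + (\<integral>\<^sub>+x. indicator (A - U i) x * k x)"
    if [measurable]: "k \<in> borel_measurable borel" for k :: "'a \<Rightarrow> ennreal"
    by (subst nn_integral_add[symmetric]) (auto intro!: nn_integral_cong simp: indicator_def)
  have "(\<integral>\<^sub>+x. indicator (A \<inter> U i) x * f x) \<le> (\<integral>\<^sub>+x. indicator (A \<inter> U i) x * g x)"
    by (rule insert.prems(2)[of i]) auto
  moreover have "(\<integral>\<^sub>+x. indicator (A - U i) x * f x) \<le> (\<integral>\<^sub>+x. indicator (A - U i) x * g x)"
  proof (rule insert.IH)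
    fix j S assume "j \<in> I" "S \<in> sets borel" "S \<subseteq> (A - U i) \<inter> U j"
    then show "(\<integral>\<^sub>+x. indicator S x * f x) \<le> (\<integral>\<^sub>+x. indicator S x * g x)"
      by (intro insert.prems(2)[of j]) auto
  qed (use insert.prems in auto)
  ultimately show ?case by (simp add: split add_mono)
qed simp

lemma emeasure_subgraph:
  fixes U :: "'a::euclidean_space set"
  assumes [measurable]: "f \<in> borel_measurable borel" "U \<in> sets borel" and "\<And>q. 0 \<le> f q"
  shows "emeasure lborel {x. fst x \<in> U \<and> 0 < snd x \<and> snd x < f (fst x)} = (\<integral>\<^sub>+q. indicator U q * ennreal (f q))"
proof -
  have [measurable]: "{x. fst x \<in> U \<and> 0 < snd x \<and> snd x < f (fst x)} \<in> sets borel" by measurable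
  have "emeasure lborel {x. fst x \<in> U \<and> 0 < snd x \<and> snd x < f (fst x)}
      = (\<integral>\<^sub>+x. indicator {x. fst x \<in> U \<and> 0 < snd x \<and> snd x < f (fst x)} x)"
    by (rule nn_integral_indicator[symmetric]) simp
  also have "\<dots> = (\<integral>\<^sub>+q. \<integral>\<^sub>+z. indicator {x. fst x \<in> U \<and> 0 < snd x \<and> snd x < f (fst x)} (q, z))"
    by (rule nn_integral_lborel_pair(1)) measurable
  also have "\<dots> = (\<integral>\<^sub>+q. \<integral>\<^sub>+z. indicator U q * indicator {0<..<f q} z)"
    by (intro nn_integral_cong) (auto simp: indicator_def)
  also have "\<dots> = (\<integral>\<^sub>+q. indicator U q * ennreal (f q))"
    using assms(3) by (simp add: nn_integral_cmult)
  finally show ?thesis .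
qed

text \<open>
  Put \<open>v x = (u x - fst x) \<bullet> b\<close>. The integral of \<open>v\<close> over \<open>A\<close> equals that of \<open>v (x + s e)\<close> over the translate \<open>A - s e\<close>.
  Comparing the two leaves the increments of \<open>v\<close> on \<open>A\<close> and the values of \<open>v\<close> on a symmetric difference. Since
  \<open>fst x \<bullet> b\<close> grows by \<open>s\<close>, the increments of \<open>v\<close> are those of \<open>u \<bullet> b\<close> minus \<open>s\<close>, which produces \<open>s\<close> times the
  measure of \<open>A\<close>.
\<close>

lemma shifted_subgraph_identity:
  fixes u :: "R3 \<Rightarrow> R2" and b :: R2
  defines "e \<equiv> (b, 0::real)"
  assumes [measurable]: "u \<in> borel_measurable borel" "A \<in> sets borel" "C \<in> sets borel" "S \<in> sets borel"
    and b: "b \<in> Basis" and s: "0 \<le> s"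
    and AC: "A \<subseteq> C" "\<And>x. x \<in> A \<Longrightarrow> x + s *\<^sub>R e \<in> C"
    and sym: "\<And>x. (x \<in> A) \<noteq> (x - s *\<^sub>R e \<in> A) \<Longrightarrow> x \<in> S"
    and fin: "emeasure lborel C < \<infinity>" and bd: "bounded C"
    and L2: "(\<integral>\<^sub>+x. indicator C x * ennreal ((norm (u x))\<^sup>2)) < \<infinity>"
  shows "ennreal s * emeasure lborel A \<le> (\<integral>\<^sub>+x. indicator A x * ennreal (norm (u (x + s *\<^sub>R e) - u x)))
    + (\<integral>\<^sub>+x. indicator S x * ennreal (norm (u x - fst x)))"
proof -
  define v where "v x = u x \<bullet> b - fst x \<bullet> b" for x
  have [measurable]: "v \<in> borel_measurable borel" unfolding v_def by measurable
  have vle: "\<bar>v x\<bar> \<le> norm (u x - fst x)" for x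
    using Basis_le_norm[OF b, of "u x - fst x"] by (simp add: v_def inner_diff_left)
  obtain R where R: "\<And>x. x \<in> C \<Longrightarrow> norm x \<le> R" using bd by (auto simp: bounded_iff)
  have intC: "integrable lborel (\<lambda>x. indicator C x * v x)"
  proof (rule integrableI_bounded)
    have "(\<integral>\<^sub>+x. ennreal (norm (indicator C x * v x)))
        \<le> (\<integral>\<^sub>+x. indicator C x * ennreal ((norm (u x))\<^sup>2) + ennreal (1 + \<bar>R\<bar>) * indicator C x)"
    proof (rule nn_integral_mono)
      fix x
      show "ennreal (norm (indicator C x * v x)) \<le> indicator C x * ennreal ((norm (u x))\<^sup>2) + ennreal (1 + \<bar>R\<bar>) * indicator C x"
      proof (cases "x \<in> C")
        case True
        have "norm (u x) \<le> (norm (u x))\<^sup>2 + 1"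
          using sum_squares_ge_zero[of "norm (u x) - 1" "norm (u x)"] by (simp add: power2_eq_square algebra_simps)
        moreover have "norm (fst x) \<le> norm x" by (cases x) (simp add: norm_Pair)
        ultimately have "\<bar>v x\<bar> \<le> (norm (u x))\<^sup>2 + (1 + \<bar>R\<bar>)"
          using vle[of x] norm_triangle_ineq4[of "u x" "fst x"] R[OF True] by linarith
        then show ?thesis using True by (simp flip: ennreal_plus)
      qed simp
    qed
    also have "\<dots> = (\<integral>\<^sub>+x. indicator C x * ennreal ((norm (u x))\<^sup>2)) + ennreal (1 + \<bar>R\<bar>) * emeasure lborel C"
      by (simp add: nn_integral_add nn_integral_cmult)
    also have "\<dots> < \<infinity>" using L2 fin by (simp add: ennreal_mult_less_top)
    finally show "(\<integral>\<^sub>+x. ennreal (norm (indicator C x * v x))) < \<infinity>" .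
  qed measurable
  have intA: "integrable lborel (\<lambda>x. indicator A x * v x)"
    by (rule Bochner_Integration.integrable_bound[OF intC]) (use AC(1) in \<open>auto simp: indicator_def\<close>)
  have intA': "integrable lborel (\<lambda>x. indicator A (x + s *\<^sub>R e) * v (x + s *\<^sub>R e))"
    using integrable_translate[OF intA] .
  have intS: "integrable lborel (\<lambda>x. indicator A x * v (x + s *\<^sub>R e))"
    by (rule Bochner_Integration.integrable_bound[OF integrable_translate[OF intC, of "s *\<^sub>R e"]])
       (use AC(2) in \<open>auto simp: indicator_def\<close>)
  have "emeasure lborel A \<le> emeasure lborel C" using AC(1) by (intro emeasure_mono) auto
  with fin have Afin: "emeasure lborel A < \<infinity>" by (rule le_less_trans[rotated])
  have intI: "integrable lborel (\<lambda>x. indicator A x :: real)"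
    using Afin by (intro integrable_real_indicator) auto
  define P where "P x = indicator A x * ((u (x + s *\<^sub>R e) - u x) \<bullet> b)" for x
  define Q where "Q x = (indicator A (x + s *\<^sub>R e) - indicator A x) * v (x + s *\<^sub>R e)" for x
  have bb: "b \<bullet> b = 1" using b by (simp add: inner_Basis)
  have P_eq: "P x = indicator A x * v (x + s *\<^sub>R e) - indicator A x * v x + s * indicator A x" for x
    by (simp add: P_def v_def e_def inner_diff_left inner_add_left bb algebra_simps)
  have Q_eq: "Q x = indicator A (x + s *\<^sub>R e) * v (x + s *\<^sub>R e) - indicator A x * v (x + s *\<^sub>R e)" for x
    by (simp add: Q_def algebra_simps)
  have intP: "integrable lborel P" unfolding P_eq using intS intA intI by simp
  have intQ: "integrable lborel Q" unfolding Q_eq using intA' intS by simp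
  have "(LINT x|lborel. P x + Q x) = (LINT x|lborel. (indicator A (x + s *\<^sub>R e) * v (x + s *\<^sub>R e) - indicator A x * v x) + s * indicator A x)"
    by (simp add: P_eq Q_eq algebra_simps)
  also have "\<dots> = (LINT x|lborel. indicator A (x + s *\<^sub>R e) * v (x + s *\<^sub>R e)) - (LINT x|lborel. indicator A x * v x) + s * measure lborel A"
    using intA' intA intI by simp
  also have "(LINT x|lborel. indicator A (x + s *\<^sub>R e) * v (x + s *\<^sub>R e)) = (LINT x|lborel. indicator A x * v x)"
    by (rule integral_translate[of "\<lambda>x. indicator A x * v x"]) measurable
  finally have key: "s * measure lborel A = (LINT x|lborel. P x + Q x)" by simp
  have "ennreal s * emeasure lborel A = ennreal (s * measure lborel A)"
    using Afin s by (simp add: emeasure_eq_ennreal_measure ennreal_mult)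
  also have "\<dots> \<le> ennreal (norm (LINT x|lborel. P x + Q x))"
    unfolding key by (intro ennreal_leI) simp
  also have "\<dots> \<le> (\<integral>\<^sub>+x. ennreal (norm (P x + Q x)))"
    using intP intQ by (intro integral_norm_bound_ennreal) auto
  also have "\<dots> \<le> (\<integral>\<^sub>+x. indicator A x * ennreal (norm (u (x + s *\<^sub>R e) - u x)) + (\<lambda>x. indicator S x * ennreal (norm (u x - fst x))) (x + s *\<^sub>R e))"
  proof (rule nn_integral_mono)
    fix x
    have "ennreal (norm (P x)) \<le> indicator A x * ennreal (norm (u (x + s *\<^sub>R e) - u x))"
      using Basis_le_norm[OF b, of "u (x + s *\<^sub>R e) - u x"] by (auto simp: P_def indicator_def)
    moreover have "ennreal (norm (Q x)) \<le> indicator S (x + s *\<^sub>R e) * ennreal (norm (u (x + s *\<^sub>R e) - fst (x + s *\<^sub>R e)))"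
      using vle[of "x + s *\<^sub>R e"] sym[of "x + s *\<^sub>R e"] by (auto simp: Q_def indicator_def intro!: ennreal_leI)
    ultimately show "ennreal (norm (P x + Q x)) \<le>
        indicator A x * ennreal (norm (u (x + s *\<^sub>R e) - u x)) + (\<lambda>x. indicator S x * ennreal (norm (u x - fst x))) (x + s *\<^sub>R e)"
      by (intro order_trans[OF ennreal_norm_triangle]) (simp add: add_mono)
  qed
  also have "\<dots> = (\<integral>\<^sub>+x. indicator A x * ennreal (norm (u (x + s *\<^sub>R e) - u x)))
    + (\<integral>\<^sub>+x. (\<lambda>x. indicator S x * ennreal (norm (u x - fst x))) (x + s *\<^sub>R e))"
    by (rule nn_integral_add) measurable
  also have "(\<integral>\<^sub>+x. (\<lambda>x. indicator S x * ennreal (norm (u x - fst x))) (x + s *\<^sub>R e))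
      = (\<integral>\<^sub>+x. indicator S x * ennreal (norm (u x - fst x)))"
    by (rule nn_integral_translate) measurable
  finally show ?thesis .
qed

text \<open>
  Let \<open>A\<close> be the subgraph of \<open>\<eta>\<close> and \<open>C\<close> a slightly larger set. In the preceding lemma the increments of \<open>u\<close>
  contribute at most \<open>s \<integral>\<^sub>C \<bar>\<partial>\<^sub>b u\<bar>\<close>. The symmetric difference lies within height \<open>s\<close> of the graph, because \<open>\<eta>\<close> is
  Lipschitz along \<open>b\<close>, and there the distance of \<open>u\<close> from its bottom values is an integral of \<open>\<partial>\<^sub>z u\<close>; this
  contributes at most \<open>2 s \<integral>\<^sub>C \<bar>\<partial>\<^sub>z u\<bar>\<close>. Divide by \<open>s\<close>, use \<open>m + 2 n \<le> 1/2 + 5/2 (m\<^sup>2 + n\<^sup>2)\<close>, absorb half of the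
  measure of \<open>A\<close>, and let \<open>s \<rightarrow> 0\<close>. The margin \<open>\<epsilon>\<close> and the bounded support provide cylinders of a uniform
  radius on which the trace is available.
\<close>

lemma elastic_energy_bounds_minorant:
  fixes h \<eta> :: "R2 \<Rightarrow> real" and u :: "R3 \<Rightarrow> R2" and b :: R2
  assumes h: "continuous_on UNIV h" and \<eta>: "continuous_on UNIV \<eta>" "\<And>p. 0 \<le> \<eta> p" "bounded {p. 0 < \<eta> p}"
    and \<epsilon>: "0 < \<epsilon>" "\<And>p. 0 < \<eta> p \<Longrightarrow> \<eta> p + \<epsilon> \<le> h p"
    and b: "b \<in> Basis" and lip: "\<And>p s. \<eta> p \<le> \<eta> (p + s *\<^sub>R b) + \<bar>s\<bar>"
    and u [measurable]: "u \<in> borel_measurable borel" and Dm: "\<forall>e\<in>Basis. Du e \<in> borel_measurable borel"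
    and L2: "(\<integral>\<^sub>+x. indicator (Omega h) x * ennreal ((norm (u x))\<^sup>2)) < \<infinity>"
    and bc: "bottom_condition h u Du"
    and E: "(\<integral>\<^sub>+x. indicator (Omega h) x * ennreal (norm_grad_sq Du x)) \<le> ennreal E" "0 \<le> E"
  shows "(\<integral>\<^sub>+p. ennreal (\<eta> p)) \<le> ennreal (5 * E)"
proof -
  define e :: R3 where "e = (b, 0)"
  have e: "e \<in> Basis" "(0, 1) \<in> (Basis :: R3 set)" "e \<noteq> (0, 1)" "norm e = 1"
    using b by (auto simp: e_def Basis_prod_def norm_Pair)
  note [measurable] = Dm[rule_format, OF e(1)] Dm[rule_format, OF e(2)]
  have [measurable]: "h \<in> borel_measurable borel" "\<eta> \<in> borel_measurable borel"
    using h \<eta>(1) by (auto intro: borel_measurable_continuous_onI)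
  obtain N where N: "\<And>p. 0 < \<eta> p \<Longrightarrow> norm p \<le> N" using \<eta>(3) by (auto simp: bounded_iff)
  \<comment> \<open>Uniform continuity on a neighbourhood of the support gives the radius \<open>\<delta>\<close> of the cylinders.\<close>
  have "uniformly_continuous_on (cball 0 (N + 1)) (\<lambda>p. (h p, \<eta> p))"
    by (intro compact_uniformly_continuous compact_cball continuous_intros continuous_on_subset[OF h] continuous_on_subset[OF \<eta>(1)]) auto
  moreover have "0 < \<epsilon> / 4" using \<epsilon>(1) by simp
  ultimately obtain d0 where d0: "0 < d0" "\<And>p q. p \<in> cball 0 (N + 1) \<Longrightarrow> q \<in> cball 0 (N + 1) \<Longrightarrow> dist q p < d0 \<Longrightarrow>
      dist (h q, \<eta> q) (h p, \<eta> p) < \<epsilon> / 4"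
    unfolding uniformly_continuous_on_def by metis
  define \<delta> where "\<delta> = min d0 1 / 3"
  have \<delta>: "0 < \<delta>" "3 * \<delta> \<le> d0" "3 * \<delta> \<le> 1" using d0(1) by (auto simp: \<delta>_def)
  have near: "h p < h q + \<epsilon> / 4" "\<eta> q < \<eta> p + \<epsilon> / 4" if "0 < \<eta> p" "dist p q < 3 * \<delta>" for p q
  proof -
    have "norm p \<le> N" using N that by simp
    moreover have "norm q \<le> norm p + dist p q" by (metis dist_norm norm_minus_commute norm_triangle_sub)
    ultimately have "dist (h q, \<eta> q) (h p, \<eta> p) < \<epsilon> / 4"
      using that \<delta> by (intro d0(2)) (auto simp: dist_commute)
    then have "\<bar>h q - h p\<bar> < \<epsilon> / 4" "\<bar>\<eta> q - \<eta> p\<bar> < \<epsilon> / 4"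
      using dist_fst_le[of "(h q, \<eta> q)" "(h p, \<eta> p)"] dist_snd_le[of "(h q, \<eta> q)" "(h p, \<eta> p)"]
      by (auto simp: dist_real_def)
    then show "h p < h q + \<epsilon> / 4" "\<eta> q < \<eta> p + \<epsilon> / 4" by linarith+
  qed
  define U where "U = (\<Union>p\<in>{p. 0 < \<eta> p}. ball p \<delta>)"
  have "open U" by (auto simp: U_def)
  then have [measurable]: "U \<in> sets borel" by simp
  have UE: "\<exists>p. 0 < \<eta> p \<and> dist p q < \<delta>" if "q \<in> U" for q
    using that unfolding U_def by force
  have UN: "norm q \<le> N + 1" if "q \<in> U" for q
  proof -
    obtain p where "0 < \<eta> p" "dist p q < \<delta>" using UE[OF \<open>q \<in> U\<close>] by blast
    moreover have "norm q \<le> norm p + dist p q" by (metis dist_norm norm_minus_commute norm_triangle_sub)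
    ultimately show ?thesis using N[of p] \<delta> by simp
  qed
  then have bU: "bounded U" unfolding bounded_iff by blast
  have "compact (closure U)" using bU by (simp add: compact_closure)
  moreover have "closure U \<subseteq> (\<Union>c\<in>U. ball c \<delta>)"
    using \<delta>(1) by (force simp: closure_approachable)
  ultimately obtain F where F: "F \<subseteq> U" "finite F" "closure U \<subseteq> (\<Union>c\<in>F. ball c \<delta>)"
    by (rule compactE_image[OF _ open_ball])
  have cyl: "\<exists>d>0. (\<exists>w. L1_approximation (ball c (2 * \<delta>)) d u Du (\<lambda>p. p) w) \<and> (\<forall>q\<in>ball c (2 * \<delta>). \<eta> q + \<epsilon> / 2 < d)"
    if "c \<in> F" for c
  proof -
    obtain p where p: "0 < \<eta> p" "dist p c < \<delta>" using UE[of c] \<open>c \<in> F\<close> F(1) by blast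
    \<comment> \<open>Between \<open>\<eta>\<close> and \<open>h\<close>, at distance at least \<open>\<epsilon> / 2\<close> above \<open>\<eta>\<close> on the whole ball.\<close>
    define d where "d = \<eta> p + 3 * \<epsilon> / 4"
    have "0 < d" using p \<epsilon> by (simp add: d_def)
    have q: "d < h q" "\<eta> q + \<epsilon> / 2 < d" if "q \<in> ball c (2 * \<delta>)" for q
    proof -
      have "dist p q < 3 * \<delta>" using that p(2) dist_triangle[of p q c] by simp
      with near[OF p(1) this] \<epsilon>(2)[OF p(1)] show "d < h q" "\<eta> q + \<epsilon> / 2 < d"
        unfolding d_def by linarith+
    qed
    have "ball c (2 * \<delta>) \<times> {0<..<d} \<subseteq> Omega h"
      using q(1) by (force simp: in_Omega_iff)
    then have "has_bottom_trace (ball c (2 * \<delta>)) d u Du (\<lambda>(x, y). (x, y))"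
      using bc \<open>0 < d\<close> \<delta>(1) unfolding bottom_condition_def by (meson mult_pos_pos zero_less_numeral)
    then have "\<exists>w. L1_approximation (ball c (2 * \<delta>)) d u Du (\<lambda>p. p) w"
      using Dm by (intro has_bottom_trace_L1 u emeasure_bounded_finite) (auto simp: case_prod_unfold)
    with q(2) \<open>0 < d\<close> show ?thesis by blast
  qed
  define A where "A = {x::R3. fst x \<in> UNIV \<and> 0 < snd x \<and> snd x < \<eta> (fst x)}"
  have mA [measurable]: "A \<in> sets borel" unfolding A_def by measurable
  have emA: "emeasure lborel A = (\<integral>\<^sub>+p. ennreal (\<eta> p))"
    unfolding A_def using \<eta>(2) by (subst emeasure_subgraph) auto
  define a where "a = (LINT p|lborel. \<eta> p)"
  have inteta: "integrable lborel \<eta>"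
  proof (rule integrable_continuous_compact_support[OF \<eta>(1), of "cball 0 N"])
    show "\<eta> p = 0" if "p \<notin> cball 0 N" for p
      using that N[of p] \<eta>(2)[of p] by (cases "0 < \<eta> p") auto
  qed simp
  have a: "(\<integral>\<^sub>+p. ennreal (\<eta> p)) = ennreal a" "0 \<le> a"
    unfolding a_def using inteta \<eta>(2) by (auto intro!: nn_integral_eq_integral integral_nonneg_AE)
  have Ufin: "emeasure lborel U < \<infinity>" using bU by (rule emeasure_bounded_finite)
  define k where "k = measure lborel U"
  have k: "emeasure lborel U = ennreal k" "0 \<le> k"
    using Ufin by (auto simp: k_def emeasure_eq_ennreal_measure)
  have step: "a \<le> s * k + 5 * E" if s: "0 < s" "s < \<delta>" "s < \<epsilon> / 2" for s
  proof -
    \<comment> \<open>Contains the translates of \<open>A\<close> by \<open>\<tau> b\<close> with \<open>0 \<le> \<tau> \<le> s\<close> and the columns below the points of \<open>S\<close>.\<close>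
    define C where "C = {x::R3. fst x \<in> U \<and> 0 < snd x \<and> snd x < \<eta> (fst x) + s}"
    have mC [measurable]: "C \<in> sets borel" unfolding C_def by measurable
    have emC: "emeasure lborel C \<le> ennreal (a + s * k)"
    proof -
      have "emeasure lborel C = (\<integral>\<^sub>+q. indicator U q * ennreal (\<eta> q + s))"
        unfolding C_def using \<eta>(2) s by (subst emeasure_subgraph) (auto intro: add_nonneg_nonneg)
      also have "\<dots> \<le> (\<integral>\<^sub>+q. ennreal (\<eta> q) + ennreal s * indicator U q)"
        using \<eta>(2) s by (intro nn_integral_mono) (auto simp: indicator_def ennreal_plus)
      also have "\<dots> = ennreal (a + s * k)"
        using s k a by (simp add: nn_integral_add nn_integral_cmult ennreal_mult ennreal_plus)
      finally show ?thesis .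
    qed
    have UI: "q + t *\<^sub>R b \<in> U" if "0 < \<eta> q" "\<bar>t\<bar> \<le> s" for q t
    proof -
      have "q + t *\<^sub>R b \<in> ball q \<delta>" using that(2) s b by (simp add: dist_norm)
      with that(1) show ?thesis unfolding U_def by blast
    qed
    have UI0: "q \<in> U" if "0 < \<eta> q" for q using UI[OF that, of 0] s by simp
    have C\<Omega>: "C \<subseteq> Omega h"
    proof
      fix x assume x: "x \<in> C"
      then obtain p where p: "0 < \<eta> p" "dist p (fst x) < \<delta>" using UE[of "fst x"] by (auto simp: C_def)
      have "dist p (fst x) < 3 * \<delta>" using p(2) \<delta>(1) by simp
      then have "snd x < h (fst x)" if "snd x < \<eta> (fst x) + s"
        using near[OF p(1), of "fst x"] that s \<epsilon>(2)[OF p(1)] by linarith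
      with x show "x \<in> Omega h" by (auto simp: C_def in_Omega_iff)
    qed
    have AC: "x + \<tau> *\<^sub>R e \<in> C" if "x \<in> A" "0 \<le> \<tau>" "\<tau> \<le> s" for x \<tau>
      using that UI[of "fst x" \<tau>] lip[of "fst x" \<tau>] by (auto simp: A_def C_def e_def)
    \<comment> \<open>Contains the symmetric difference of \<open>A\<close> and its translate by \<open>s b\<close>.\<close>
    define S where "S = {x\<in>C. \<bar>snd x - \<eta> (fst x)\<bar> \<le> s}"
    have [measurable]: "S \<in> sets borel"
      unfolding S_def using mC by measurable
    have sym: "x \<in> S" if "(x \<in> A) \<noteq> (x - s *\<^sub>R e \<in> A)" for x
    proof -
      obtain q z where x: "x = (q, z)" by (cases x)
      have lipq: "\<eta> q \<le> \<eta> (q - s *\<^sub>R b) + s" "\<eta> (q - s *\<^sub>R b) \<le> \<eta> q + s"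
        using lip[of q "- s"] lip[of "q - s *\<^sub>R b" s] s by auto
      from that have *: "(0 < z \<and> z < \<eta> q \<and> \<eta> (q - s *\<^sub>R b) \<le> z) \<or> (0 < z \<and> \<eta> q \<le> z \<and> z < \<eta> (q - s *\<^sub>R b))"
        by (auto simp: x A_def e_def)
      then have "0 < \<eta> q \<or> 0 < \<eta> (q - s *\<^sub>R b)" by auto
      then have "q \<in> U" using UI0[of q] UI[of "q - s *\<^sub>R b" s] s by auto
      with * lipq show ?thesis by (auto simp: x S_def C_def)
    qed
    let ?U = "\<lambda>c. ball c \<delta> \<times> (UNIV :: real set)"
    have coverU: "x \<in> (\<Union>c\<in>F. ?U c)" if "fst x \<in> U" for x
      using that F(3) closure_subset[of U] by (cases x) force
    have mU: "?U c \<in> sets borel" for c :: R2 by (intro borel_open open_Times) auto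
    have shiftm: "(\<lambda>x. \<integral>\<^sub>+\<tau>. indicator {0<..<s} \<tau> * ennreal (norm (Du e (x + \<tau> *\<^sub>R e)))) \<in> borel_measurable borel"
      by measurable
    have "(\<integral>\<^sub>+x. indicator A x * ennreal (norm (u (x + s *\<^sub>R e) - u x))) \<le>
      (\<integral>\<^sub>+x. indicator A x * (\<integral>\<^sub>+\<tau>. indicator {0<..<s} \<tau> * ennreal (norm (Du e (x + \<tau> *\<^sub>R e)))))"
    proof (rule nn_integral_le_by_finite_cover[OF F(2) _ shiftm mU _ mA])
      show "A \<subseteq> (\<Union>c\<in>F. ?U c)" using coverU UI0 by (auto simp: A_def)
      fix c T assume c: "c \<in> F" and T: "T \<in> sets borel" "T \<subseteq> A \<inter> ?U c"
      obtain d w where d: "0 < d" "L1_approximation (ball c (2 * \<delta>)) d u Du (\<lambda>p. p) w" "\<And>q. q \<in> ball c (2 * \<delta>) \<Longrightarrow> \<eta> q + \<epsilon> / 2 < d"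
        using cyl[OF c] by blast
      show "(\<integral>\<^sub>+x. indicator T x * ennreal (norm (u (x + s *\<^sub>R e) - u x))) \<le>
        (\<integral>\<^sub>+x. indicator T x * (\<integral>\<^sub>+\<tau>. indicator {0<..<s} \<tau> * ennreal (norm (Du e (x + \<tau> *\<^sub>R e)))))"
      proof (rule trace_shift_bound[OF d(2) u _ _ T(1) e(1)])
        fix x \<tau> assume "x \<in> T" and \<tau>: "\<tau> \<in> {0..s}"
        then have x: "dist c (fst x) < \<delta>" "0 < snd x" "snd x < \<eta> (fst x)" using T(2) by (auto simp: A_def)
        have "dist c (fst x + \<tau> *\<^sub>R b) \<le> dist c (fst x) + dist (fst x) (fst x + \<tau> *\<^sub>R b)" by (rule dist_triangle)
        also have "dist (fst x) (fst x + \<tau> *\<^sub>R b) \<le> s" using \<tau> b by (simp add: dist_norm)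
        finally have "fst x + \<tau> *\<^sub>R b \<in> ball c (2 * \<delta>)" using x s by simp
        moreover have "snd x < d" using d(3)[of "fst x"] x \<delta>(1) \<epsilon>(1) by simp
        ultimately show "x + \<tau> *\<^sub>R e \<in> ball c (2 * \<delta>) \<times> {0<..<d}"
          using x by (cases x) (auto simp: e_def)
      qed (use s in auto)
    qed measurable
    also have "\<dots> \<le> ennreal s * (\<integral>\<^sub>+x. indicator C x * ennreal (norm (Du e x)))"
      using s AC by (intro nn_integral_shift_average_le) auto
    finally have b1: "(\<integral>\<^sub>+x. indicator A x * ennreal (norm (u (x + s *\<^sub>R e) - u x)))
      \<le> ennreal s * (\<integral>\<^sub>+x. indicator C x * ennreal (norm (Du e x)))" .
    have colm: "(\<lambda>x. \<integral>\<^sub>+\<zeta>. indicator {0<..<snd x} \<zeta> * ennreal (norm (Du (0, 1) (fst x, \<zeta>)))) \<in> borel_measurable borel"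
      by (rule measurable_column_integral) measurable
    have "(\<integral>\<^sub>+x. indicator S x * ennreal (norm (u x - fst x))) \<le>
      (\<integral>\<^sub>+x. indicator S x * (\<integral>\<^sub>+\<zeta>. indicator {0<..<snd x} \<zeta> * ennreal (norm (Du (0, 1) (fst x, \<zeta>)))))"
    proof (rule nn_integral_le_by_finite_cover[OF F(2) _ colm mU])
      show "S \<subseteq> (\<Union>c\<in>F. ?U c)" using coverU by (auto simp: S_def C_def)
      fix c T assume c: "c \<in> F" and T: "T \<in> sets borel" "T \<subseteq> S \<inter> ?U c"
      obtain d w where d: "0 < d" "L1_approximation (ball c (2 * \<delta>)) d u Du (\<lambda>p. p) w" "\<And>q. q \<in> ball c (2 * \<delta>) \<Longrightarrow> \<eta> q + \<epsilon> / 2 < d"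
        using cyl[OF c] by blast
      show "(\<integral>\<^sub>+x. indicator T x * ennreal (norm (u x - fst x))) \<le>
        (\<integral>\<^sub>+x. indicator T x * (\<integral>\<^sub>+\<zeta>. indicator {0<..<snd x} \<zeta> * ennreal (norm (Du (0, 1) (fst x, \<zeta>)))))"
      proof (rule trace_height_bound[OF d(2) u _ _ _ T(1) d(1)])
        show "T \<subseteq> ball c (2 * \<delta>) \<times> {0<..<d}"
        proof
          fix x assume "x \<in> T"
          then have x: "dist c (fst x) < \<delta>" "0 < snd x" "snd x < \<eta> (fst x) + s" using T(2) by (auto simp: S_def C_def)
          then show "x \<in> ball c (2 * \<delta>) \<times> {0<..<d}"
            using d(3)[of "fst x"] s \<delta>(1) by (cases x) auto
        qed
      qed auto
    qed measurable
    also have "\<dots> \<le> ennreal (2 * s) * (\<integral>\<^sub>+x. indicator C x * ennreal (norm (Du (0, 1) x)))"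
      using s by (intro nn_integral_column_le[where \<eta> = \<eta>]) (auto simp: S_def C_def)
    finally have b2: "(\<integral>\<^sub>+x. indicator S x * ennreal (norm (u x - fst x)))
      \<le> ennreal (2 * s) * (\<integral>\<^sub>+x. indicator C x * ennreal (norm (Du (0, 1) x)))" .
    have bC: "bounded C"
    proof -
      have "compact (\<eta> ` cball 0 (N + 1))"
        by (intro compact_continuous_image continuous_on_subset[OF \<eta>(1)]) auto
      then obtain M where M: "\<And>q. norm q \<le> N + 1 \<Longrightarrow> \<bar>\<eta> q\<bar> \<le> M"
        using compact_imp_bounded by (force simp: bounded_iff)
      have "C \<subseteq> cball 0 (N + 1) \<times> cball 0 (M + s)"
        using UN M by (fastforce simp: C_def)
      then show ?thesis
        by (rule bounded_subset[rotated]) (intro bounded_Times bounded_cball)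
    qed
    have "ennreal s * ennreal a \<le> (\<integral>\<^sub>+x. indicator A x * ennreal (norm (u (x + s *\<^sub>R e) - u x)))
      + (\<integral>\<^sub>+x. indicator S x * ennreal (norm (u x - fst x)))"
      unfolding a(1)[symmetric] emA[symmetric] e_def
    proof (rule shifted_subgraph_identity[where C = C])
      show "A \<subseteq> C" using AC[of _ 0] s by auto
      show "emeasure lborel C < \<infinity>" using emC by (rule le_less_trans) simp
      have "(\<integral>\<^sub>+x. indicator C x * ennreal ((norm (u x))\<^sup>2)) \<le> (\<integral>\<^sub>+x. indicator (Omega h) x * ennreal ((norm (u x))\<^sup>2))"
        using C\<Omega> by (intro nn_integral_mono mult_right_mono) (auto simp: indicator_def)
      then show "(\<integral>\<^sub>+x. indicator C x * ennreal ((norm (u x))\<^sup>2)) < \<infinity>"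
        using L2 by (rule le_less_trans)
    qed (use b s bC AC[of _ s] sym in \<open>auto simp: e_def\<close>)
    also have "\<dots> \<le> ennreal s * (\<integral>\<^sub>+x. indicator C x * ennreal (norm (Du e x)))
        + ennreal (2 * s) * (\<integral>\<^sub>+x. indicator C x * ennreal (norm (Du (0, 1) x)))"
      by (intro add_mono b1 b2)
    also have "\<dots> = ennreal s * ((\<integral>\<^sub>+x. indicator C x * ennreal (norm (Du e x)))
        + 2 * (\<integral>\<^sub>+x. indicator C x * ennreal (norm (Du (0, 1) x))))"
      using s by (simp add: distrib_left ennreal_mult mult_ac)
    also have "(\<integral>\<^sub>+x. indicator C x * ennreal (norm (Du e x)))
        + 2 * (\<integral>\<^sub>+x. indicator C x * ennreal (norm (Du (0, 1) x)))
        = (\<integral>\<^sub>+x. indicator C x * ennreal (norm (Du e x)) + 2 * (indicator C x * ennreal (norm (Du (0, 1) x))))"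
      by (simp add: nn_integral_add nn_integral_cmult)
    also have "\<dots> \<le> (\<integral>\<^sub>+x. ennreal (1 / 2) * indicator C x + ennreal (5 / 2) * (indicator (Omega h) x * ennreal (norm_grad_sq Du x)))"
    proof (rule nn_integral_mono)
      fix x
      show "indicator C x * ennreal (norm (Du e x)) + 2 * (indicator C x * ennreal (norm (Du (0, 1) x))) \<le>
        ennreal (1 / 2) * indicator C x + ennreal (5 / 2) * (indicator (Omega h) x * ennreal (norm_grad_sq Du x))"
      proof (cases "x \<in> C")
        case True
        define m n where "m = norm (Du e x)" and "n = norm (Du (0, 1) x)"
        have "m\<^sup>2 + n\<^sup>2 = (\<Sum>b\<in>{e, (0, 1)}. (norm (Du b x))\<^sup>2)"
          using e(3) by (simp add: m_def n_def)
        also have "\<dots> \<le> norm_grad_sq Du x"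
          unfolding norm_grad_sq_def using e by (intro sum_mono2) auto
        finally have sq: "m\<^sup>2 + n\<^sup>2 \<le> norm_grad_sq Du x" .
        have "m + 2 * n \<le> 1 / 2 + 5 / 2 * (m\<^sup>2 + n\<^sup>2)"
        proof -
          have "0 \<le> 5 / 2 * (m - 1 / 5)\<^sup>2 + 5 / 2 * (n - 2 / 5)\<^sup>2" by simp
          also have "\<dots> = 1 / 2 + 5 / 2 * (m\<^sup>2 + n\<^sup>2) - (m + 2 * n)"
            by (simp add: power2_eq_square field_simps)
          finally show ?thesis by simp
        qed
        also have "\<dots> \<le> 1 / 2 + 5 / 2 * norm_grad_sq Du x"
          using sq by (intro add_left_mono mult_left_mono) auto
        finally have "m + 2 * n \<le> 1 / 2 + 5 / 2 * norm_grad_sq Du x" .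
        then have "ennreal (m + 2 * n) \<le> ennreal (1 / 2 + 5 / 2 * norm_grad_sq Du x)" by (rule ennreal_leI)
        moreover have "ennreal (m + 2 * n) = ennreal m + 2 * ennreal n"
          by (simp add: m_def n_def ennreal_plus ennreal_mult)
        moreover have "ennreal (1 / 2 + 5 / 2 * norm_grad_sq Du x) = ennreal (1 / 2) + ennreal (5 / 2) * ennreal (norm_grad_sq Du x)"
          by (subst ennreal_plus) (simp_all add: norm_grad_sq_def sum_nonneg ennreal_mult[symmetric])
        moreover have "x \<in> Omega h" using True C\<Omega> by blast
        ultimately show ?thesis
          using True by (simp add: m_def n_def)
      qed simp
    qed
    also have "\<dots> = ennreal (1 / 2) * emeasure lborel C + ennreal (5 / 2) * (\<integral>\<^sub>+x. indicator (Omega h) x * ennreal (norm_grad_sq Du x))"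
    proof -
      have [measurable]: "Du i \<in> borel_measurable borel" if "i \<in> Basis" for i using Dm that by blast
      have [measurable]: "(\<lambda>x. norm_grad_sq Du x) \<in> borel_measurable borel"
        unfolding norm_grad_sq_def by measurable
      have "open (Omega h)"
      proof -
        have "Omega h = {x. 0 < snd x} \<inter> {x. snd x < h (fst x)}" by (auto simp: in_Omega_iff)
        then show ?thesis
          by (auto intro!: open_Int open_Collect_less continuous_intros continuous_on_compose2[OF h])
      qed
      then have [measurable]: "Omega h \<in> sets borel" by simp
      show ?thesis by (simp add: nn_integral_add nn_integral_cmult)
    qed
    also have "\<dots> \<le> ennreal (1 / 2) * ennreal (a + s * k) + ennreal (5 / 2) * ennreal E"
      by (intro add_mono mult_left_mono emC E) auto
    also have "\<dots> = ennreal (1 / 2 * (a + s * k) + 5 / 2 * E)"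
      using a(2) k(2) s(1) E(2) by (subst (1 2) ennreal_mult[symmetric]; simp flip: ennreal_plus)
    finally have "ennreal (s * a) \<le> ennreal (s * (1 / 2 * (a + s * k) + 5 / 2 * E))"
      using s a k E by (simp add: ennreal_mult mult_left_mono)
    then have "s * a \<le> s * (1 / 2 * (a + s * k) + 5 / 2 * E)"
      using s a k E by (subst (asm) ennreal_le_iff) auto
    then have "a \<le> 1 / 2 * (a + s * k) + 5 / 2 * E" using s by simp
    then show ?thesis by argo
  qed
  have "a \<le> 5 * E"
  proof (rule field_le_epsilon)
    fix \<gamma> :: real assume "0 < \<gamma>"
    define s where "s = min (min (\<delta> / 2) (\<epsilon> / 4)) (\<gamma> / (k + 1))"
    have "s \<le> \<delta> / 2" "s \<le> \<epsilon> / 4" unfolding s_def by linarith+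
    moreover have "0 < s" using \<delta>(1) \<epsilon>(1) k(2) \<open>0 < \<gamma>\<close> by (simp add: s_def)
    ultimately have "0 < s" "s < \<delta>" "s < \<epsilon> / 2" using \<delta>(1) \<epsilon>(1) by linarith+
    from step[OF this] have "a \<le> s * k + 5 * E" .
    moreover have "s * k \<le> \<gamma> / (k + 1) * (k + 1)"
      using k(2) \<open>0 < s\<close> \<open>0 < \<gamma>\<close> by (intro mult_mono) (auto simp: s_def)
    ultimately show "a \<le> 5 * E + \<gamma>" using k(2) by simp
  qed
  then show ?thesis unfolding a(1) by (intro ennreal_leI)
qed

section \<open>The lower bound\<close>

lemma bottom_condition_cong:
  assumes "bottom_condition h u Du"
    and "\<And>x. x \<in> Omega h \<Longrightarrow> u' x = u x" "\<And>e x. x \<in> Omega h \<Longrightarrow> Du' e x = Du e x"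
  shows "bottom_condition h u' Du'"
  unfolding bottom_condition_def
proof (intro allI impI)
  fix p :: R2 and r d :: real assume *: "0 < r \<and> 0 < d \<and> ball p r \<times> {0<..<d} \<subseteq> Omega h"
  have "(\<integral>\<^sup>+x\<in>ball p r \<times> {0<..<d}. ennreal ((norm (w x - u' x))\<^sup>2 +
          norm_grad_sq (\<lambda>b x. partial w b x - Du' b x) x) \<partial>lborel) =
        (\<integral>\<^sup>+x\<in>ball p r \<times> {0<..<d}. ennreal ((norm (w x - u x))\<^sup>2 +
          norm_grad_sq (\<lambda>b x. partial w b x - Du b x) x) \<partial>lborel)" for w
  proof (rule nn_integral_cong)
    fix x :: R3
    show "ennreal ((norm (w x - u' x))\<^sup>2 + norm_grad_sq (\<lambda>b x. partial w b x - Du' b x) x) *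
          indicator (ball p r \<times> {0<..<d}) x =
        ennreal ((norm (w x - u x))\<^sup>2 + norm_grad_sq (\<lambda>b x. partial w b x - Du b x) x) *
          indicator (ball p r \<times> {0<..<d}) x"
    proof (cases "x \<in> ball p r \<times> {0<..<d}")
      case True
      then have "x \<in> Omega h" using * by blast
      then show ?thesis by (simp add: assms(2,3) norm_grad_sq_def)
    qed simp
  qed
  moreover have "has_bottom_trace (ball p r) d u Du (\<lambda>(x, y). (x, y))"
    using assms(1) * unfolding bottom_condition_def by blast
  ultimately show "has_bottom_trace (ball p r) d u' Du' (\<lambda>(x, y). (x, y))"
    by (simp add: has_bottom_trace_def)
qed

lemma open_Omega: "continuous_on UNIV h \<Longrightarrow> open (Omega h)"
proof -
  assume h: "continuous_on UNIV h"
  have "Omega h = {x. 0 < snd x} \<inter> {x. snd x < h (fst x)}" by (auto simp: in_Omega_iff)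
  then show ?thesis
    by (auto intro!: open_Int open_Collect_less continuous_intros continuous_on_compose2[OF h])
qed

text \<open>
  Lowering the minorant by \<open>1 / (n + 1)\<close> and cutting it off by the cone \<open>n - norm p\<close> keeps the Lipschitz
  property along \<open>b\<close> and produces the margin and the bounded support; the functions increase to the
  minorant.
\<close>

lemma elastic_energy_bounds_lip_minorant:
  fixes h :: "R2 \<Rightarrow> real" and u :: "R3 \<Rightarrow> R2" and b :: R2
  assumes h: "continuous_on UNIV h" "\<And>p. 0 \<le> h p" and b: "b \<in> Basis"
    and u: "u \<in> L2 (Omega h)" and wg: "has_weak_gradient (Omega h) u Du" and bc: "bottom_condition h u Du"
    and E: "(\<integral>\<^sup>+x\<in>Omega h. ennreal (norm_grad_sq Du x) \<partial>lborel) \<le> ennreal E" "0 \<le> E"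
  shows "(\<integral>\<^sub>+p. ennreal (lip_minorant h b p)) \<le> ennreal (5 * E)"
proof -
  define r where "r = lip_minorant h b"
  have cr: "continuous_on UNIV r" unfolding r_def using h(2,1) by (rule continuous_on_lip_minorant)
  have r0: "0 \<le> r p" "r p \<le> h p" for p
    unfolding r_def using h(2) by (auto intro: lip_minorant_nonneg lip_minorant_le_self)
  have rlip: "r p \<le> r (p + s *\<^sub>R b) + \<bar>s\<bar>" for p s
    unfolding r_def using h(2) by (rule lip_minorant_le_shift)
  define u' where "u' x = indicator (Omega h) x *\<^sub>R u x" for x
  define Du' where "Du' e x = indicator (Omega h) x *\<^sub>R Du e x" for e x
  have u': "u' \<in> borel_measurable borel" and Du': "\<forall>e\<in>Basis. Du' e \<in> borel_measurable borel"
    unfolding u'_def Du'_def using wg open_Omega[OF h(1)]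
    by (auto simp: has_weak_gradient_def intro!: locally_integrable_borel)
  have bc': "bottom_condition h u' Du'"
    by (rule bottom_condition_cong[OF bc]) (auto simp: u'_def Du'_def)
  have L2': "(\<integral>\<^sub>+x. indicator (Omega h) x * ennreal ((norm (u' x))\<^sup>2)) < \<infinity>"
  proof -
    have "(\<integral>\<^sub>+x. ennreal (norm (indicator (Omega h) x *\<^sub>R (norm (u x))\<^sup>2))) < \<infinity>"
      using u unfolding L2_def set_integrable_def integrable_iff_bounded by simp
    also have "(\<integral>\<^sub>+x. ennreal (norm (indicator (Omega h) x *\<^sub>R (norm (u x))\<^sup>2))) =
        (\<integral>\<^sub>+x. indicator (Omega h) x * ennreal ((norm (u' x))\<^sup>2))"
      by (intro nn_integral_cong) (auto simp: indicator_def u'_def)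
    finally show ?thesis .
  qed
  have E': "(\<integral>\<^sub>+x. indicator (Omega h) x * ennreal (norm_grad_sq Du' x)) \<le> ennreal E"
  proof -
    have "(\<integral>\<^sub>+x. indicator (Omega h) x * ennreal (norm_grad_sq Du' x)) = (\<integral>\<^sup>+x\<in>Omega h. ennreal (norm_grad_sq Du x) \<partial>lborel)"
      by (intro nn_integral_cong) (auto simp: indicator_def Du'_def norm_grad_sq_def)
    with E(1) show ?thesis by simp
  qed
  define \<eta> where "\<eta> n p = max 0 (min (r p - 1 / real (Suc n)) (real n - norm p))" for n p
  have bound: "(\<integral>\<^sub>+p. ennreal (\<eta> n p)) \<le> ennreal (5 * E)" for n
  proof (rule elastic_energy_bounds_minorant[OF h(1) _ _ _ _ _ b _ u' Du' L2' bc' E' E(2)])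
    show "continuous_on UNIV (\<eta> n)" unfolding \<eta>_def by (intro continuous_intros cr)
    show "0 \<le> \<eta> n p" for p by (simp add: \<eta>_def)
    have "norm p \<le> real n" if "0 < \<eta> n p" for p using that by (auto simp: \<eta>_def)
    then show "bounded {p. 0 < \<eta> n p}" unfolding bounded_iff by blast
    show "0 < 1 / real (Suc n)" by simp
    show "\<eta> n p + 1 / real (Suc n) \<le> h p" if "0 < \<eta> n p" for p
    proof -
      have "\<eta> n p \<le> r p - 1 / real (Suc n)" using that by (auto simp: \<eta>_def)
      with r0(2)[of p] show ?thesis by simp
    qed
    show "\<eta> n p \<le> \<eta> n (p + s *\<^sub>R b) + \<bar>s\<bar>" for p s
    proof -
      have "norm (p + s *\<^sub>R b) \<le> norm p + \<bar>s\<bar>" using norm_triangle_ineq[of p "s *\<^sub>R b"] b by simp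
      with rlip[of p s] show ?thesis unfolding \<eta>_def by linarith
    qed
  qed
  have "(\<lambda>n. \<integral>\<^sub>+p. ennreal (\<eta> n p)) \<longlonglongrightarrow> (\<integral>\<^sub>+p. ennreal (r p))"
  proof (rule nn_integral_LIMSEQ)
    have "\<eta> m p \<le> \<eta> n p" if "m \<le> n" for m n p
    proof -
      have "1 / real (Suc n) \<le> 1 / real (Suc m)" using that by (intro divide_left_mono) auto
      moreover have "real m \<le> real n" using that by simp
      ultimately show ?thesis unfolding \<eta>_def by linarith
    qed
    then show "incseq (\<lambda>n p. ennreal (\<eta> n p))"
      by (auto simp: incseq_def le_fun_def intro!: ennreal_leI)
    have "\<eta> n \<in> borel_measurable borel" for n
      unfolding \<eta>_def by (intro cont_borel cr)
    then show "(\<lambda>p. ennreal (\<eta> n p)) \<in> borel_measurable lborel" for n by simp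
    fix p
    have "(\<lambda>n. max 0 (r p - 1 / real (Suc n))) \<longlonglongrightarrow> max 0 (r p - 0)"
      using LIMSEQ_inverse_real_of_nat by (intro tendsto_intros) (simp add: inverse_eq_divide)
    moreover obtain N where "r p + norm p \<le> real N" using real_arch_simple by blast
    then have "\<forall>\<^sub>F n in sequentially. max 0 (r p - 1 / real (Suc n)) = \<eta> n p"
    proof (intro eventually_sequentiallyI[of N])
      fix n assume "r p + norm p \<le> real N" "N \<le> n"
      then have "r p - 1 / real (Suc n) \<le> real n - norm p"
        by (smt (verit) divide_nonneg_nonneg of_nat_0_le_iff of_nat_mono)
      then show "max 0 (r p - 1 / real (Suc n)) = \<eta> n p" by (simp add: \<eta>_def min_absorb1)
    qed
    ultimately have "(\<lambda>n. \<eta> n p) \<longlonglongrightarrow> max 0 (r p - 0)" by (rule Lim_transform_eventually)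
    then show "(\<lambda>n. ennreal (\<eta> n p)) \<longlonglongrightarrow> ennreal (r p)" using r0(1)[of p] by (intro tendsto_ennrealI) simp
  qed
  then show ?thesis
    unfolding r_def[symmetric] by (rule LIMSEQ_le_const2) (use bound in auto)
qed

theorem energy_lower_bound:
  assumes adm: "admissible V u Du h Dh" and V: "0 < V"
  shows "ennreal (1 / 1000 * min V (V powr (6 / 7))) \<le> energy Du h Dh"
proof (rule ccontr)
  define E where "E = 1 / 1000 * min V (V powr (6 / 7))"
  assume "\<not> ?thesis"
  then have less: "energy Du h Dh \<le> ennreal E" by (simp add: E_def)
  have "0 < E" using V by (simp add: E_def)
  define x where "x = E powr (1 / 6)"
  have x: "0 < x" using \<open>0 < E\<close> by (simp add: x_def)
  have x6: "x ^ 6 = E" and x7: "x ^ 7 = E powr (7 / 6)"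
    using \<open>0 < E\<close> by (simp_all add: x_def powr_powr flip: powr_realpow)
  have h: "continuous_on UNIV h" "\<And>p. 0 \<le> h p" and wgh: "has_weak_gradient UNIV h Dh"
    and hint: "integrable lborel h" "(LINT p|lborel. h p) = V"
    and u: "u \<in> L2 (Omega h)" and wg: "has_weak_gradient (Omega h) u Du" and bc: "bottom_condition h u Du"
    using adm by (auto simp: admissible_def H1_def)
  have el: "(\<integral>\<^sup>+x\<in>Omega h. ennreal (norm_grad_sq Du x) \<partial>lborel) \<le> ennreal E"
    and su: "(\<integral>\<^sub>+p. ennreal (norm_grad_sq Dh p)) \<le> ennreal E"
    using less unfolding energy_def by (meson add_increasing2 add_increasing order_trans order_refl zero_le)+
  have "ennreal V = (\<integral>\<^sub>+p. ennreal (h p))"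
    using nn_integral_eq_integral[OF hint(1)] h(2) hint(2) by simp
  also have "\<dots> \<le> ennreal (10 * x ^ 6 + 422 * x ^ 7)"
  proof (rule volume_le[OF h wgh x])
    show "(\<integral>\<^sub>+p. ennreal (lip_minorant h b p)) \<le> ennreal (5 * x ^ 6)" if "b \<in> Basis" for b
      unfolding x6 using \<open>0 < E\<close> by (intro elastic_energy_bounds_lip_minorant[OF h that u wg bc el]) simp
    show "(\<integral>\<^sub>+p. ennreal (norm_grad_sq Dh p)) \<le> ennreal (x ^ 6)"
      unfolding x6 by (rule su)
  qed
  finally have "V \<le> 10 * x ^ 6 + 422 * x ^ 7"
    using x by (subst (asm) ennreal_le_iff) auto
  moreover have "x ^ 6 \<le> 1 / 1000 * V" unfolding x6 by (simp add: E_def)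
  moreover have "x ^ 7 \<le> 1 / 1000 * V"
  proof -
    have "x ^ 7 \<le> (1 / 1000 * V powr (6 / 7)) powr (7 / 6)"
      unfolding x7 using \<open>0 < E\<close> by (intro powr_mono2) (auto simp: E_def)
    also have "\<dots> = (1 / 1000) powr (7 / 6) * V"
      using V by (subst powr_mult) (simp_all only: powr_powr, simp)
    also have "\<dots> \<le> (1 / 1000) powr 1 * V"
      using V by (intro mult_right_mono powr_mono') auto
    finally show ?thesis by simp
  qed
  ultimately show False using V by simp
qed

section \<open>The upper bound\<close>

lemma nn_integral_dilate:
  fixes f :: "R2 \<Rightarrow> ennreal"
  assumes [measurable]: "f \<in> borel_measurable borel" and R: "0 < R"
  shows "(\<integral>\<^sub>+p. f ((1 / R) *\<^sub>R p)) = ennreal (R\<^sup>2) * (\<integral>\<^sub>+p. f p)"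
proof -
  have "(\<integral>\<^sub>+p. f ((1 / R) *\<^sub>R p)) =
      (\<integral>\<^sup>+p. f ((1 / R) *\<^sub>R p) \<partial>density (distr lborel borel (\<lambda>p::R2. 0 + R *\<^sub>R p)) (\<lambda>_. ennreal (\<bar>R\<bar> ^ DIM(R2))))"
    using R by (subst lborel_affine[of R 0]) auto
  also have "\<dots> = ennreal (R\<^sup>2) * (\<integral>\<^sub>+p. f p)"
    using R by (subst nn_integral_density, simp, simp, subst nn_integral_distr) (auto simp: nn_integral_cmult power2_eq_square)
  finally show ?thesis .
qed

lemma continuous_in_L2:
  fixes f :: "'a::euclidean_space \<Rightarrow> 'b::euclidean_space"
  assumes f: "continuous_on UNIV f" and "open \<Omega>" "bounded \<Omega>"
  shows "f \<in> L2 \<Omega>"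
proof -
  have [measurable]: "f \<in> borel_measurable borel" using f by (rule borel_measurable_continuous_onI)
  have [measurable]: "\<Omega> \<in> sets borel" using assms by simp
  have "set_integrable lborel (closure \<Omega>) (\<lambda>x. (norm (f x))\<^sup>2)"
    unfolding set_integrable_def using assms(3)
    by (intro borel_integrable_compact) (auto simp: compact_closure intro!: continuous_intros continuous_on_subset[OF f])
  then have "set_integrable lborel \<Omega> (\<lambda>x. (norm (f x))\<^sup>2)"
    by (rule set_integrable_subset) (auto simp: closure_subset)
  then show ?thesis by (simp add: L2_def set_borel_measurable_def)
qed

lemma continuous_compact_support_in_Linfinity:
  fixes f :: "'a::euclidean_space \<Rightarrow> 'b::euclidean_space"
  assumes f: "continuous_on UNIV f" and K: "compact K" and "\<And>x. x \<notin> K \<Longrightarrow> f x = 0"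
  shows "f \<in> Linfinity UNIV"
proof -
  have [measurable]: "f \<in> borel_measurable borel" using f by (rule borel_measurable_continuous_onI)
  have "bounded (f ` K)"
    using K by (intro compact_imp_bounded compact_continuous_image continuous_on_subset[OF f]) auto
  then obtain C where C: "\<And>x. x \<in> K \<Longrightarrow> norm (f x) \<le> C" by (auto simp: bounded_iff)
  have "norm (f x) \<le> max C 0" for x
    using C[of x] assms(3)[of x] by (cases "x \<in> K") auto
  then show ?thesis by (auto simp: Linfinity_def set_borel_measurable_def intro!: exI[of _ "max C 0"])
qed

definition island :: "R2 \<Rightarrow> real" where
  "island = box_bump (- One) One 1"

lemma test_function_island: "test_function UNIV island"
  unfolding island_def by (rule test_function_box_bump)

lemma island_nonneg: "0 \<le> island p"
  unfolding island_def by (rule box_bump_nonneg)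

lemma C_infinity_island: "C_infinity island"
  using test_function_island by (simp add: test_function_UNIV_iff)

lemma island_outside: "2 < norm p \<Longrightarrow> island p = 0"
proof -
  assume p: "2 < norm p"
  have "norm p \<le> 2" if "p \<in> box (- One) One"
  proof -
    have "\<bar>fst p\<bar> < 1" "\<bar>snd p\<bar> < 1"
      using that by (auto simp: mem_box Basis_R2 inner_Pair_0 abs_less_iff inner_sum_left Basis_prod_def sum.union_disjoint)
    then show ?thesis
      using norm_Pair_le[of "fst p" "snd p"] by simp
  qed
  with p show ?thesis unfolding island_def by (intro box_bump_outside) auto
qed

lemma island_volume:
  obtains v where "0 < v" "(\<integral>\<^sub>+p. ennreal (island p)) = ennreal v"
proof -
  have int: "integrable lborel island"
    by (rule integrable_continuous_compact_support[OF C_infinity_continuous[OF C_infinity_island], of "cball 0 2"])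
       (auto intro: island_outside)
  have nn: "(\<integral>\<^sub>+p. ennreal (island p)) = ennreal (LINT p|lborel. island p)"
    using int island_nonneg by (intro nn_integral_eq_integral) auto
  have "(LINT p|lborel. island p) \<noteq> 0"
  proof
    assume "(LINT p|lborel. island p) = 0"
    then have "AE p in lborel. island p = 0"
      using integral_nonneg_eq_0_iff_AE[OF int] island_nonneg by simp
    then have "AE p in lborel. p \<notin> box (- One) (One :: R2)"
      by eventually_elim (use box_bump_inside[of _ "- One" One 1] in \<open>force simp: island_def\<close>)
    then have "emeasure lborel (box (- One) (One :: R2)) = 0"
      by (subst (asm) AE_iff_null) (auto simp: null_sets_def)
    moreover have "emeasure lborel (box (- One) (One :: R2)) = ennreal (\<Prod>b\<in>Basis. (One - - One :: R2) \<bullet> b)"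
      by (rule emeasure_lborel_box) (simp add: inner_sum_left_Basis)
    moreover have "0 < (\<Prod>b\<in>Basis. (One - - One :: R2) \<bullet> b)"
      by (intro prod_pos) (simp add: inner_add_left inner_sum_left_Basis)
    ultimately show False by (metis ennreal_eq_0_iff not_le)
  qed
  moreover have "0 \<le> (LINT p|lborel. island p)" using island_nonneg by (intro integral_nonneg_AE) auto
  ultimately show ?thesis using that nn by fastforce
qed

text \<open>
  For \<open>\<kappa> = 0\<close> the film keeps the lattice of the substrate; for \<open>\<kappa> = 1 / R\<close> the strain decays over a height
  comparable to the radius of the island.
\<close>

definition relaxed_disp :: "real \<Rightarrow> R3 \<Rightarrow> R2" where
  "relaxed_disp \<kappa> x = exp (- \<kappa> * snd x) *\<^sub>R fst x"

lemma C_infinity_relaxed_disp: "C_infinity (relaxed_disp \<kappa>)"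
proof -
  have D: "((\<lambda>x::R3. c * exp (- \<kappa> * snd x)) has_derivative (\<lambda>v. (c * (- \<kappa> * snd v)) * exp (- \<kappa> * snd x))) (at x)" for c x
    by (auto intro!: derivative_eq_intros)
  have "C_k k (\<lambda>x::R3. c * exp (- \<kappa> * snd x))" for k c
  proof (induction k arbitrary: c)
    case 0
    show ?case by (auto intro!: continuous_intros)
  next
    case (Suc k)
    then show ?case
      by (auto simp only: C_k.simps frechet_derivative_eqI[OF D] differentiable_def intro: D)
  qed
  from this[of _ 1] have "C_infinity (\<lambda>x::R3. exp (- \<kappa> * snd x))" by (simp add: C_infinity_def)
  then show ?thesis
    unfolding relaxed_disp_def[abs_def] by (rule C_infinity_scaleR[OF _ C_infinity_bounded_linear[OF bounded_linear_fst]])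
qed

lemma norm_grad_sq_relaxed_disp:
  "norm_grad_sq (partial (relaxed_disp \<kappa>)) x =
    (exp (- \<kappa> * snd x))\<^sup>2 * (2 + \<kappa>\<^sup>2 * (norm (fst x))\<^sup>2)"
proof -
  have "(relaxed_disp \<kappa> has_derivative (\<lambda>v. exp (- \<kappa> * snd x) *\<^sub>R fst v + (- \<kappa> * snd v * exp (- \<kappa> * snd x)) *\<^sub>R fst x)) (at x)"
    unfolding relaxed_disp_def[abs_def] by (auto intro!: derivative_eq_intros)
  from frechet_derivative_eqI[OF this] show ?thesis
    by (simp add: norm_grad_sq_def Basis_prod_def power_mult_distrib algebra_simps norm_Pair)
qed

context
  fixes H R :: real
  assumes H: "0 < H" and R: "0 < R"
begin

definition "profile p = H * island ((1 / R) *\<^sub>R p)"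

lemma C_infinity_profile: "C_infinity profile"
  unfolding profile_def[abs_def]
  using C_infinity_affine[OF C_infinity_island, of "1 / R" 0]
  by (intro C_infinity_mult C_infinity_const) simp

lemma profile_nonneg: "0 \<le> profile p"
  using H by (simp add: profile_def island_nonneg)

lemma profile_support: "profile p \<noteq> 0 \<Longrightarrow> norm p \<le> 2 * R"
  using island_outside[of "(1 / R) *\<^sub>R p"] R by (force simp: profile_def not_less field_simps)

lemma profile_gradient:
  assumes "b \<in> Basis"
  shows "partial profile b p = H / R * partial island b ((1 / R) *\<^sub>R p)"
proof -
  have "((\<lambda>p. island ((1 / R) *\<^sub>R p)) has_derivative (\<lambda>v. (1 / R) *\<^sub>R partial island v ((1 / R) *\<^sub>R p))) (at p)"
    using has_derivative_affine_compose[of island "1 / R" p 0] C_infinity_differentiable[OF C_infinity_island] by simp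
  then have "(profile has_derivative (\<lambda>v. H * ((1 / R) *\<^sub>R partial island v ((1 / R) *\<^sub>R p)))) (at p)"
    unfolding profile_def[abs_def] by (rule has_derivative_mult_right)
  then show ?thesis by (simp add: frechet_derivative_eqI)
qed

lemma nn_integral_profile: "(\<integral>\<^sub>+p. ennreal (profile p)) = ennreal (H * R\<^sup>2) * (\<integral>\<^sub>+p. ennreal (island p))"
proof -
  have [measurable]: "island \<in> borel_measurable borel"
    by (rule C_infinity_borel[OF C_infinity_island])
  have "(\<integral>\<^sub>+p. ennreal (profile p)) = (\<integral>\<^sub>+p. (\<lambda>q. ennreal H * ennreal (island q)) ((1 / R) *\<^sub>R p))"
    using H by (simp add: profile_def ennreal_mult island_nonneg)
  also have "\<dots> = ennreal (R\<^sup>2) * (\<integral>\<^sub>+p. ennreal H * ennreal (island p))"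
    using R by (rule nn_integral_dilate[rotated]) measurable
  finally show ?thesis using H by (simp add: nn_integral_cmult ennreal_mult mult_ac)
qed

lemma surface_energy_profile:
  "(\<integral>\<^sub>+p. ennreal (norm_grad_sq (partial profile) p)) =
    ennreal (H\<^sup>2) * (\<integral>\<^sub>+p. ennreal (norm_grad_sq (partial island) p))"
proof -
  let ?J = "\<lambda>p. norm_grad_sq (partial island) p"
  have [measurable]: "(\<lambda>p. partial island b p) \<in> borel_measurable borel" if "b \<in> Basis" for b
    by (rule C_infinity_borel[OF C_infinity_partial[OF C_infinity_island that]])
  have [measurable]: "?J \<in> borel_measurable borel" unfolding norm_grad_sq_def by measurable
  have eq: "norm_grad_sq (partial profile) p = (H / R)\<^sup>2 * ?J ((1 / R) *\<^sub>R p)" for p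
    unfolding norm_grad_sq_def sum_distrib_left
    by (rule sum.cong) (simp_all only: profile_gradient, simp add: power_mult_distrib power_divide)
  have "(\<integral>\<^sub>+p. ennreal (norm_grad_sq (partial profile) p)) =
      (\<integral>\<^sub>+p. (\<lambda>q. ennreal ((H / R)\<^sup>2) * ennreal (?J q)) ((1 / R) *\<^sub>R p))"
    by (simp add: eq ennreal_mult norm_grad_sq_def sum_nonneg)
  also have "\<dots> = ennreal (R\<^sup>2) * (\<integral>\<^sub>+p. ennreal ((H / R)\<^sup>2) * ennreal (?J p))"
    using R by (rule nn_integral_dilate[rotated]) measurable
  also have "\<dots> = ennreal (R\<^sup>2) * ennreal ((H / R)\<^sup>2) * (\<integral>\<^sub>+p. ennreal (?J p))"
    by (simp add: nn_integral_cmult mult.assoc)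
  also have "ennreal (R\<^sup>2) * ennreal ((H / R)\<^sup>2) = ennreal (H\<^sup>2)"
    using R by (subst ennreal_mult[symmetric]) (auto simp: power_divide)
  finally show ?thesis .
qed

lemma bounded_Omega_profile: "bounded (Omega profile)"
proof -
  have "compact (profile ` cball 0 (2 * R))"
    using C_infinity_continuous[OF C_infinity_profile] by (intro compact_continuous_image) auto
  then obtain M where M: "\<And>p. norm p \<le> 2 * R \<Longrightarrow> \<bar>profile p\<bar> \<le> M"
    using compact_imp_bounded by (force simp: bounded_iff)
  have "Omega profile \<subseteq> cball 0 (2 * R) \<times> cball 0 M"
  proof
    fix x assume x: "x \<in> Omega profile"
    then have "norm (fst x) \<le> 2 * R" by (intro profile_support) (auto simp: in_Omega_iff)
    with x M[of "fst x"] show "x \<in> cball 0 (2 * R) \<times> cball 0 M" by (cases x) (auto simp: in_Omega_iff)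
  qed
  then show ?thesis
    by (rule bounded_subset[rotated]) (intro bounded_Times bounded_cball)
qed

lemma admissible_profile:
  assumes vol: "(\<integral>\<^sub>+p. ennreal (profile p)) = ennreal V" and V: "0 \<le> V"
  shows "admissible V (relaxed_disp \<kappa>) (partial (relaxed_disp \<kappa>))
    profile (partial profile)"
proof -
  have c: "continuous_on UNIV profile" by (rule C_infinity_continuous[OF C_infinity_profile])
  have o: "open (Omega profile)" using c by (rule open_Omega)
  have out: "profile p = 0" if "p \<notin> cball 0 (2 * R)" for p
    using that profile_support[of p] by auto
  have int: "integrable lborel profile"
    using c compact_cball out by (rule integrable_continuous_compact_support)
  have wh: "has_weak_gradient UNIV profile (partial profile)"
    by (intro has_weak_gradient_C_infinity C_infinity_profile open_UNIV)
  have wu: "has_weak_gradient (Omega profile) (relaxed_disp \<kappa>) (partial (relaxed_disp \<kappa>))"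
    by (intro has_weak_gradient_C_infinity C_infinity_relaxed_disp o)
  have "profile \<in> Linfinity UNIV"
    using c compact_cball out by (rule continuous_compact_support_in_Linfinity)
  moreover have "(\<lambda>p. partial profile b p) \<in> Linfinity UNIV" if "b \<in> Basis" for b
  proof (rule continuous_compact_support_in_Linfinity[OF _ compact_cball])
    show "continuous_on UNIV (\<lambda>p. partial profile b p)"
      by (intro C_infinity_continuous C_infinity_partial C_infinity_profile that)
    show "partial profile b p = 0" if "p \<notin> cball 0 (2 * R)" for p
      using profile_support that by (intro partial_eq_0_outside_cball[of profile "2 * R"]) auto
  qed
  ultimately have "profile \<in> W1infinity UNIV" using wh by (auto simp: W1infinity_def)
  moreover have "relaxed_disp \<kappa> \<in> H1 (Omega profile)"
    unfolding H1_def using wu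
    by (auto intro!: continuous_in_L2 C_infinity_continuous C_infinity_partial C_infinity_relaxed_disp o bounded_Omega_profile)
  moreover have "bottom_condition profile (relaxed_disp \<kappa>) (partial (relaxed_disp \<kappa>))"
    unfolding bottom_condition_def has_bottom_trace_def
    by (intro allI impI exI[of _ "\<lambda>n. relaxed_disp \<kappa>"])
       (auto simp: C_infinity_relaxed_disp norm_grad_sq_def relaxed_disp_def split_beta)
  moreover have "(LINT p|lborel. profile p) = V"
    using nn_integral_eq_integral[OF int] vol V profile_nonneg by (auto intro!: integral_nonneg_AE)
  ultimately show ?thesis
    using c wh wu int profile_nonneg by (simp add: admissible_def)
qed

lemma F_s_3D_le:
  assumes vol: "(\<integral>\<^sub>+p. ennreal (profile p)) = ennreal V" and V: "0 \<le> V"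
  shows "F_s_3D V \<le> (\<integral>\<^sup>+x\<in>Omega profile. ennreal ((exp (- \<kappa> * snd x))\<^sup>2 * (2 + \<kappa>\<^sup>2 * (norm (fst x))\<^sup>2)) \<partial>lborel)
    + ennreal (H\<^sup>2) * (\<integral>\<^sub>+p. ennreal (norm_grad_sq (partial island) p))"
proof -
  have "F_s_3D V \<le> energy (partial (relaxed_disp \<kappa>)) profile (partial profile)"
    unfolding F_s_3D_def using admissible_profile[OF assms, of \<kappa>] by (intro Inf_lower) blast
  then show ?thesis by (simp add: energy_def norm_grad_sq_relaxed_disp surface_energy_profile)
qed

lemma elastic_energy_unrelaxed:
  assumes vol: "(\<integral>\<^sub>+p. ennreal (profile p)) = ennreal V"
  shows "(\<integral>\<^sup>+x\<in>Omega profile. ennreal ((exp (- 0 * snd x))\<^sup>2 * (2 + 0\<^sup>2 * (norm (fst x))\<^sup>2)) \<partial>lborel) = 2 * ennreal V"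
proof -
  have [measurable]: "profile \<in> borel_measurable borel"
    by (rule C_infinity_borel[OF C_infinity_profile])
  have [measurable]: "Omega profile \<in> sets borel"
    using open_Omega[OF C_infinity_continuous[OF C_infinity_profile]] by simp
  have "Omega profile = {x. fst x \<in> UNIV \<and> 0 < snd x \<and> snd x < profile (fst x)}"
    by (auto simp: in_Omega_iff)
  also have "emeasure lborel \<dots> = (\<integral>\<^sub>+q. indicator UNIV q * ennreal (profile q))"
    by (rule emeasure_subgraph) (auto simp: profile_nonneg)
  finally have "emeasure lborel (Omega profile) = ennreal V" using vol by simp
  then show ?thesis by (simp add: nn_integral_cmult)
qed

lemma elastic_energy_relaxed:
  "(\<integral>\<^sup>+x\<in>Omega profile. ennreal ((exp (- (1 / R) * snd x))\<^sup>2 * (2 + (1 / R)\<^sup>2 * (norm (fst x))\<^sup>2)) \<partial>lborel)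
    \<le> ennreal (3 * R ^ 3) * emeasure lborel (cball (0::R2) 2)"
proof -
  have [measurable]: "cball (0::R2) 2 \<in> sets borel" by simp
  have "(\<integral>\<^sup>+x\<in>Omega profile. ennreal ((exp (- (1 / R) * snd x))\<^sup>2 * (2 + (1 / R)\<^sup>2 * (norm (fst x))\<^sup>2)) \<partial>lborel)
      \<le> (\<integral>\<^sub>+x. (ennreal 6 * indicator (cball (0::R2) 2) ((1 / R) *\<^sub>R fst x)) * (ennreal (exp (- (2 / R) * snd x)) * indicator {0..} (snd x)))"
  proof (rule nn_integral_mono)
    fix x :: R3
    show "ennreal ((exp (- (1 / R) * snd x))\<^sup>2 * (2 + (1 / R)\<^sup>2 * (norm (fst x))\<^sup>2)) * indicator (Omega profile) x
      \<le> (ennreal 6 * indicator (cball (0::R2) 2) ((1 / R) *\<^sub>R fst x)) * (ennreal (exp (- (2 / R) * snd x)) * indicator {0..} (snd x))"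
    proof (cases "x \<in> Omega profile")
      case True
      then have n: "norm (fst x) \<le> 2 * R" by (intro profile_support) (auto simp: in_Omega_iff)
      then have "(norm (fst x))\<^sup>2 \<le> (2 * R)\<^sup>2" by (intro power_mono) auto
      then have "(1 / R)\<^sup>2 * (norm (fst x))\<^sup>2 \<le> 4" using R by (simp add: field_simps)
      moreover have "(exp (- (1 / R) * snd x))\<^sup>2 = exp (- (2 / R) * snd x)"
        by (simp flip: exp_double)
      ultimately have "ennreal ((exp (- (1 / R) * snd x))\<^sup>2 * (2 + (1 / R)\<^sup>2 * (norm (fst x))\<^sup>2))
          \<le> ennreal (6 * exp (- (2 / R) * snd x))"
        by (intro ennreal_leI) (simp add: mult.commute)
      also have "\<dots> = ennreal 6 * ennreal (exp (- (2 / R) * snd x))" by (rule ennreal_mult) auto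
      finally show ?thesis using True n R by (auto simp: in_Omega_iff divide_simps)
    qed simp
  qed
  also have "\<dots> = (\<integral>\<^sup>+p. (ennreal 6 * indicator (cball (0::R2) 2) ((1 / R) *\<^sub>R p)) * (\<integral>\<^sub>+z. ennreal (exp (- (2 / R) * z)) * indicator {0..} z) \<partial>(lborel :: R2 measure))"
    by (subst nn_integral_lborel_pair(1)) (auto simp: nn_integral_cmult)
  also have "(\<integral>\<^sub>+z. ennreal (exp (- (2 / R) * z)) * indicator {0..} z) = ennreal (0 - - (R / 2) * exp (- (2 / R) * 0))"
  proof (rule nn_integral_FTC_atLeast[where F = "\<lambda>z. - (R / 2) * exp (- (2 / R) * z)"])
    have "((\<lambda>z. - (R / 2) * exp (- ((2 / R) * z))) \<longlongrightarrow> - (R / 2) * 0) at_top"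
      using R
      by (intro tendsto_mult tendsto_const filterlim_compose[OF exp_at_bot] filterlim_compose[OF filterlim_uminus_at_bot_at_top]
          filterlim_tendsto_pos_mult_at_top[OF tendsto_const _ filterlim_ident]) simp
    then show "((\<lambda>z. - (R / 2) * exp (- (2 / R) * z)) \<longlongrightarrow> 0) at_top" by simp
  qed (use R in \<open>auto intro!: derivative_eq_intros\<close>)
  also have "(\<integral>\<^sup>+p. (ennreal 6 * indicator (cball (0::R2) 2) ((1 / R) *\<^sub>R p)) * ennreal (0 - - (R / 2) * exp (- (2 / R) * 0)) \<partial>(lborel :: R2 measure))
      = (\<integral>\<^sup>+p. (ennreal 6 * ennreal (R / 2)) * indicator (cball (0::R2) 2) ((1 / R) *\<^sub>R p) \<partial>(lborel :: R2 measure))"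
    by (intro nn_integral_cong) (simp add: mult_ac)
  also have "\<dots> = ennreal (6 * (R / 2)) * (\<integral>\<^sup>+p. indicator (cball (0::R2) 2) ((1 / R) *\<^sub>R p) \<partial>(lborel :: R2 measure))"
    by (subst nn_integral_cmult, measurable) (subst ennreal_mult, use R in simp_all)
  also have "(\<integral>\<^sup>+p. indicator (cball (0::R2) 2) ((1 / R) *\<^sub>R p) \<partial>(lborel :: R2 measure)) = ennreal (R\<^sup>2) * emeasure lborel (cball (0::R2) 2)"
    using R by (subst nn_integral_dilate) auto
  also have "ennreal (6 * (R / 2)) * (ennreal (R\<^sup>2) * emeasure lborel (cball (0::R2) 2)) = ennreal (3 * R ^ 3) * emeasure lborel (cball (0::R2) 2)"
    using R by (simp add: mult.assoc[symmetric] ennreal_mult[symmetric] power3_eq_cube power2_eq_square)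
  finally show ?thesis .
qed

end

text \<open>
  Two islands with the volume \<open>H R\<^sup>2 v = V\<close>: a flat one with \<open>H\<^sup>2 = V\<close> and \<open>u = (x, y)\<close>, and a tall one with
  \<open>H\<^sup>2\<close> and \<open>R\<^sup>3\<close> both of order \<open>V\<^sup>6\<^sup>/\<^sup>7\<close> whose strain is confined to height \<open>R\<close>.
\<close>

lemma energy_upper_bound:
  obtains C where "0 < C" "\<And>V. 0 < V \<Longrightarrow> F_s_3D V \<le> ennreal (C * min V (V powr (6 / 7)))"
proof -
  obtain v where v: "0 < v" "(\<integral>\<^sub>+p. ennreal (island p)) = ennreal v" by (rule island_volume)
  let ?J = "\<lambda>p. norm_grad_sq (partial island) p"
  have "integrable lborel ?J"
  proof (rule integrable_continuous_compact_support[OF _ compact_cball[of 0 2]])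
    show "continuous_on UNIV ?J"
      unfolding norm_grad_sq_def
      by (intro continuous_intros C_infinity_continuous C_infinity_partial C_infinity_island)
    show "?J p = 0" if "p \<notin> cball 0 2" for p
    proof -
      have "{x. island x \<noteq> 0} \<subseteq> cball 0 2" using island_outside by force
      from partial_eq_0_outside_cball[OF this that] show ?thesis by (simp add: norm_grad_sq_def)
    qed
  qed
  then have "(\<integral>\<^sub>+p. ennreal (?J p)) = ennreal (LINT p|lborel. ?J p)"
    by (intro nn_integral_eq_integral) (auto simp: norm_grad_sq_def sum_nonneg)
  then obtain J where J: "(\<integral>\<^sub>+p. ennreal (?J p)) = ennreal J" "0 \<le> J"
    using that[of "LINT p|lborel. ?J p"] by (auto intro!: integral_nonneg_AE simp: norm_grad_sq_def sum_nonneg)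
  have "emeasure lborel (cball (0::R2) 2) < \<infinity>" by (intro emeasure_bounded_finite) simp
  then obtain a where a: "emeasure lborel (cball (0::R2) 2) = ennreal a" "0 \<le> a"
    by (auto simp: less_top_ennreal)
  define C where "C = 2 + J + 3 * a / (v * sqrt v)"
  have "0 < C" using v J a by (simp add: C_def add_pos_nonneg)
  show ?thesis
  proof (rule that[OF \<open>0 < C\<close>])
    fix V :: real assume V: "0 < V"
    have 1: "F_s_3D V \<le> ennreal (C * V)"
    proof -
      define H where "H = sqrt V"
      define R where "R = sqrt (sqrt V / v)"
      have HR: "0 < H" "0 < R" using V v by (auto simp: H_def R_def)
      have "H * R\<^sup>2 * v = V" using V v by (simp add: H_def R_def)
      then have vol: "(\<integral>\<^sub>+p. ennreal (profile H R p)) = ennreal V"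
        using nn_integral_profile[OF HR] v HR by (simp add: ennreal_mult[symmetric])
      have "F_s_3D V \<le> 2 * ennreal V + ennreal (H\<^sup>2) * ennreal J"
        using F_s_3D_le[OF HR vol, of 0] elastic_energy_unrelaxed[OF HR vol] V J by simp
      also have "\<dots> = ennreal ((2 + J) * V)"
      proof -
        have "2 * ennreal V = ennreal (2 * V)" using V by (simp add: ennreal_mult)
        moreover have "ennreal (H\<^sup>2) * ennreal J = ennreal (J * V)"
          using V J by (simp add: H_def ennreal_mult[symmetric] mult.commute)
        ultimately show ?thesis using V J by (simp add: ennreal_plus[symmetric] algebra_simps del: ennreal_plus)
      qed
      also have "\<dots> \<le> ennreal (C * V)"
        using V v a by (intro ennreal_leI mult_right_mono) (auto simp: C_def)
      finally show ?thesis .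
    qed
    have 2: "F_s_3D V \<le> ennreal (C * V powr (6 / 7))"
    proof -
      define H where "H = V powr (3 / 7)"
      define R where "R = V powr (2 / 7) / sqrt v"
      have HR: "0 < H" "0 < R" using V v by (auto simp: H_def R_def)
      have R2: "R\<^sup>2 = V powr (4 / 7) / v" and H2: "H\<^sup>2 = V powr (6 / 7)"
        and R3: "R ^ 3 = V powr (6 / 7) / (v * sqrt v)"
        using V v by (simp_all add: R_def H_def power_divide powr_power power3_eq_cube[of "sqrt v"])
      have "H * R\<^sup>2 * v = V"
        using V v by (simp add: R2 H_def powr_add[symmetric])
      then have vol: "(\<integral>\<^sub>+p. ennreal (profile H R p)) = ennreal V"
        using nn_integral_profile[OF HR] v HR by (simp add: ennreal_mult[symmetric])
      have "F_s_3D V \<le> ennreal (3 * R ^ 3) * ennreal a + ennreal (H\<^sup>2) * ennreal J"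
        using F_s_3D_le[OF HR vol, of "1 / R"] elastic_energy_relaxed[OF HR] V
        unfolding J(1) a(1) by (meson add_right_mono less_imp_le order_trans)
      also have "\<dots> = ennreal ((3 * a / (v * sqrt v) + J) * V powr (6 / 7))"
      proof -
        have "ennreal (3 * R ^ 3) * ennreal a = ennreal (3 * a / (v * sqrt v) * V powr (6 / 7))"
          using HR(2) a(2) v(1) by (subst ennreal_mult[symmetric]) (simp_all add: R3 mult_ac)
        moreover have "ennreal (H\<^sup>2) * ennreal J = ennreal (J * V powr (6 / 7))"
          using J by (simp add: H2 ennreal_mult[symmetric] mult.commute)
        ultimately show ?thesis
          using v J a by (simp add: ennreal_plus[symmetric] distrib_right del: ennreal_plus)
      qed
      also have "\<dots> \<le> ennreal (C * V powr (6 / 7))"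
        by (intro ennreal_leI mult_right_mono) (auto simp: C_def)
      finally show ?thesis .
    qed
    show "F_s_3D V \<le> ennreal (C * min V (V powr (6 / 7)))"
      using 1 2 by (simp add: min_def)
  qed
qed

theorem theorem5p1:
  "\<exists>c::real. 0 < c \<and>
     (\<forall>V::real. 0 < V \<longrightarrow>
        ennreal (c * min V (V powr (6 / 7))) \<le> F_s_3D V \<and>
        F_s_3D V \<le> ennreal (inverse c * min V (V powr (6 / 7))))"
proof -
  obtain C where C: "0 < C" "\<And>V. 0 < V \<Longrightarrow> F_s_3D V \<le> ennreal (C * min V (V powr (6 / 7)))"
    using energy_upper_bound by metis
  define c where "c = min (1 / 1000) (1 / C)"
  have c: "0 < c" "c \<le> 1 / 1000" "c \<le> 1 / C" using C(1) by (auto simp: c_def)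
  show ?thesis
  proof (intro exI[of _ c] conjI allI impI)
    fix V :: real assume V: "0 < V"
    then have m: "0 \<le> min V (V powr (6 / 7))" by simp
    have "ennreal (c * min V (V powr (6 / 7))) \<le> ennreal (1 / 1000 * min V (V powr (6 / 7)))"
      using c m by (intro ennreal_leI mult_right_mono) auto
    also have "\<dots> \<le> F_s_3D V"
      unfolding F_s_3D_def using energy_lower_bound[OF _ V] by (intro Inf_greatest) auto
    finally show "ennreal (c * min V (V powr (6 / 7))) \<le> F_s_3D V" .
    have "C \<le> inverse c" using c C(1) by (simp add: field_simps)
    then have "ennreal (C * min V (V powr (6 / 7))) \<le> ennreal (inverse c * min V (V powr (6 / 7)))"
      using m by (intro ennreal_leI mult_right_mono)
    with C(2)[OF V] show "F_s_3D V \<le> ennreal (inverse c * min V (V powr (6 / 7)))"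
      by (rule order_trans)
  qed (rule c(1))
qed

end
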